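(* Consider the AdamW-style Shampoo algorithm (defined in the context) run for $K\ge 1$ iterations on a differentiable function $f:\mathbb{R}^{m\times n}\to\mathbb{R}$ with lower bound $f^*$ and $f(\mathbf{X}_1)>f^*$, with exponents $p,q\in(0,+\infty]$ satisfying $\frac1p+\frac1q=1$ (that is, $\omega=1$). Suppose that Assumptions 1-3 (stated in the context) hold, and that for some deterministic $\hat\varepsilon\ge\varepsilon$ the condition $$\mathbf{L}_{k,\varepsilon}\succeq\hat\varepsilon\,\mathbf{I}_m,\qquad \mathbf{R}_{k,\varepsilon}\succeq\hat\varepsilon\,\mathbf{I}_n\qquad (k=1,\dots,K)$$ holds. Let $\gamma\in(0,1)$ and $0<\tau\le 1$ be arbitrary, and let $$\hat\sigma^2=\max\Big\{\sigma^2,\frac{L(f(\mathbf{X}_1)-f^* )}{K\gamma^2}\Big\},\quad 1-\theta=\sqrt{\frac{L(f(\mathbf{X}_1)-f^* )}{K\hat\sigma^2}},\quad \theta\le\beta\le\sqrt\theta,\quad \varepsilon=\frac{\tau\hat\sigma^2}{m+n},$$ $$\eta=\sqrt{\frac{\hat\varepsilon(f(\mathbf{X}_1)-f^* )}{4LK\hat\sigma^2}},\quad 0\le\lambda\le\frac{1}{\sqrt{1152\,\hat\varepsilon}\,K^{3/4}}\sqrt[4]{\frac{L^3\hat\sigma^2}{f(\mathbf{X}_1)-f^*}},\quad \|\mathbf{X}_1\|_{op}\le\sqrt{\frac{\hat\varepsilon K(f(\mathbf{X}_1)-f^* )}{L\hat\sigma^2}}.$$ Then $\lambda\|\mathbf{X}_k\|_{op}<1$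 for all $k=1,2,\dots,K$, and $$\frac1K\sum_{k=1}^K\mathbb{E}\big[\|\nabla f(\mathbf{X}_k)\|_*\big]\le\Big(8\sqrt{m+n}+\frac{119\hat\sigma}{\sqrt{\hat\varepsilon}}\Big)\max\left\{\sqrt[4]{\frac{\sigma^2L(f(\mathbf{X}_1)-f^* )}{K}},\ \sqrt{\frac{L(f(\mathbf{X}_1)-f^* )}{K\gamma}}\right\}.$$ In the case $\hat\varepsilon=\varepsilon$ (for which the condition on $\mathbf{L}_{k,\varepsilon},\mathbf{R}_{k,\varepsilon}$ always holds), $$\frac1K\sum_{k=1}^K\mathbb{E}\big[\|\nabla f(\mathbf{X}_k)\|_*\big]\le 127\sqrt{\frac{m+n}{\tau}}\max\left\{\sqrt[4]{\frac{\sigma^2L(f(\mathbf{X}_1)-f^* )}{K}},\ \sqrt{\frac{L(f(\mathbf{X}_1)-f^* )}{K\gamma}}\right\},$$ and when moreover $\tau=1$, $$\frac1K\sum_{k=1}^K\mathbb{E}\big[\|\nabla f(\mathbf{X}_k)\|_*\big]\le 127\sqrt{m+n}\,\max\left\{\sqrt[4]{\frac{\sigma^2L(f(\mathbf{X}_1)-f^* )}{K}},\ \sqrt{\frac{L(f(\mathbf{X}_1)-f^* )}{K\gamma}}\right\}.$$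
   Context: Norms: $\|\cdot\|_F$, $\|\cdot\|_{op}$, $\|\cdot\|_*$ are the Frobenius norm, the spectral norm (largest singular value) and the nuclear norm (sum of singular values). $\preceq$ is the Loewner order. Powers of a symmetric positive (semi)definite matrix are defined by applying the power to the eigenvalues in an eigendecomposition. Algorithm (AdamW-style Shampoo). Hyperparameters $\eta>0$, $\theta,\beta\in[0,1)$, $\lambda\ge0$, $\varepsilon>0$, and $p,q\in(0,+\infty]$ with $\frac1p+\frac1q=2-\omega$, $\omega\in(0,2]$ (convention $1/\infty=0$; $\mathbf{L}_{k,\varepsilon}^{\pm1/\infty}=\mathbf{I}_m$, $\mathbf{R}_{k,\varepsilon}^{\pm1/\infty}=\mathbf{I}_n$). Start from a deterministic $\mathbf{X}_1\in\mathbb{R}^{m\times n}$, $\mathbf{M}_0=\mathbf{0}$, $\mathbf{L}_0=\mathbf{0}$, $\mathbf{R}_0=\mathbf{0}$. For $k=1,\dots,K$: obtain a random stochastic gradient $\mathbf{G}_k\in\mathbb{R}^{m\times n}$ at $\mathbf{X}_k$ and set $\mathbf{M}_k=\theta\mathbf{M}_{k-1}+(1-\theta)\mathbf{G}_k$, $\mathbf{L}_k=\beta\mathbf{L}_{k-1}+(1-\beta)\mathbf{G}_k\mathbf{G}_k^T$, $\mathbf{R}_k=\beta\mathbf{R}_{k-1}+(1-\beta)\mathbf{G}_k^T\mathbf{G}_k$, $\mathbf{L}_{k,\varepsilon}=\mathbf{L}_k+\varepsilon\mathbf{I}_m$, $\mathbf{R}_{k,\varepsilon}=\mathbf{R}_k+\varepsilon\mathbf{I}_n$,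 $\mathbf{X}_{k+1}=(1-\lambda\eta)\mathbf{X}_k-\eta\,\mathbf{L}_{k,\varepsilon}^{-\frac1{2p}}\mathbf{M}_k\mathbf{R}_{k,\varepsilon}^{-\frac1{2q}}$. $\mathcal{F}_k=\sigma(\mathbf{G}_1,\dots,\mathbf{G}_k)$ is the sigma-algebra generated by the stochastic gradients up to $k$ ($\mathcal{F}_0$ trivial), $\mathbb{E}_k[\cdot|\mathcal{F}_{k-1}]$ is conditional expectation given $\mathcal{F}_{k-1}$, $\mathbb{E}$ is total expectation. Assumption 1 (smoothness): $\|\nabla f(\mathbf{Y})-\nabla f(\mathbf{X})\|_F\le L\|\mathbf{Y}-\mathbf{X}\|_F$ for all $\mathbf{X},\mathbf{Y}$, with $L>0$. Assumption 2 (unbiasedness): $\mathbb{E}_k[\mathbf{G}_k|\mathcal{F}_{k-1}]=\nabla f(\mathbf{X}_k)$ for every $k$. Assumption 3: for some (deterministic) symmetric positive semidefinite $\Sigma_L\in\mathbb{R}^{m\times m}$, $\Sigma_R\in\mathbb{R}^{n\times n}$ and every $k$, $\mathbb{E}_k[(\mathbf{G}_k-\nabla f(\mathbf{X}_k))(\mathbf{G}_k-\nabla f(\mathbf{X}_k))^T|\mathcal{F}_{k-1}]\preceq\Sigma_L$ and $\mathbb{E}_k[(\mathbf{G}_k-\nabla f(\mathbf{X}_k))^T(\mathbf{G}_k-\nabla f(\mathbf{X}_k))|\mathcal{F}_{k-1}]\preceq\Sigma_R$. Set $\sigma^2=\frac{\operatorname{tr}(\Sigma_L)+\operatorname{tr}(\Sigma_R)}{2}$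 and $\sigma=\sqrt{\sigma^2}$, $\hat\sigma=\sqrt{\hat\sigma^2}$. $f^*$ is a finite real number with $f(\mathbf{X})\ge f^*$ for all $\mathbf{X}$. *)

theory Defs
  imports "HOL-Probability.Probability"
begin

text \<open>
  The type \<^typ>\<open>real^'n^'m\<close> of real matrices with \<open>CARD('m)\<close> rows and \<open>CARD('n)\<close> columns
  carries the Euclidean structure of its entries: \<^const>\<open>norm\<close> on it is the Frobenius norm and
  the inner product of \<open>A\<close> and \<open>B\<close> is the trace of \<open>A\<^sup>T B\<close>.
\<close>

definition singular_values :: "real^'n^'m \<Rightarrow> real set" where
  "singular_values A =
     {s. 0 \<le> s \<and> (\<exists>v. v \<noteq> 0 \<and> (transpose A ** A) *v v = s\<^sup>2 *\<^sub>R v)}"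

definition singular_value_mult :: "real^'n^'m \<Rightarrow> real \<Rightarrow> nat" where
  "singular_value_mult A s = dim {v. (transpose A ** A) *v v = s\<^sup>2 *\<^sub>R v}"

text \<open>
  With \<open>A\<^sup>T A\<close> there are \<open>CARD('n)\<close> singular values counted with multiplicity. When
  \<open>CARD('n) > CARD('m)\<close> the list is padded with zeros, which changes neither of the two norms below.
\<close>

definition spectral_norm :: "real^'n^'m \<Rightarrow> real" where
  "spectral_norm A = Max (singular_values A)"

definition nuclear_norm :: "real^'n^'m \<Rightarrow> real" where
  "nuclear_norm A = (\<Sum>s\<in>singular_values A. real (singular_value_mult A s) * s)"

definition psd :: "real^'n^'n \<Rightarrow> bool" where
  "psd A \<longleftrightarrow> transpose A = A \<and> (\<forall>x. 0 \<le> x \<bullet> (A *v x))"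

definition loewner_le :: "real^'n^'n \<Rightarrow> real^'n^'n \<Rightarrow> bool" (infix \<open>\<preceq>\<^sub>L\<close> 50) where
  "A \<preceq>\<^sub>L B \<longleftrightarrow> psd (B - A)"

definition diag_matrix :: "('n \<Rightarrow> real) \<Rightarrow> real^'n^'n" where
  "diag_matrix d = (\<chi> i j. if i = j then d i else 0)"

text \<open>
  The value does not depend on the chosen eigendecomposition, so the description is proper for every
  symmetric matrix. It is only used for positive definite \<open>A\<close>, where exponent \<open>0\<close> gives the identity.
\<close>

definition matrix_powr :: "real^'n^'n \<Rightarrow> real \<Rightarrow> real^'n^'n" where
  "matrix_powr A r =
     (THE B. \<exists>Q d. orthogonal_matrix Q \<and> A = Q ** diag_matrix d ** transpose Q \<and>
                   B = Q ** diag_matrix (\<lambda>i. d i powr r) ** transpose Q)"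

text \<open>
  One trajectory of the algorithm. Since \<open>1 / \<infinity> = 0\<close> in \<^typ>\<open>ereal\<close>, an infinite exponent parameter
  turns the corresponding preconditioner into the identity matrix.
\<close>

definition adamw_shampoo ::
  "real \<Rightarrow> real \<Rightarrow> real \<Rightarrow> real \<Rightarrow> real \<Rightarrow> ereal \<Rightarrow> ereal \<Rightarrow> nat \<Rightarrow> real^'n^'m \<Rightarrow>
   (nat \<Rightarrow> real^'n^'m) \<Rightarrow> (nat \<Rightarrow> real^'n^'m) \<Rightarrow> (nat \<Rightarrow> real^'n^'m) \<Rightarrow>
   (nat \<Rightarrow> real^'m^'m) \<Rightarrow> (nat \<Rightarrow> real^'n^'n) \<Rightarrow> bool" where
  "adamw_shampoo \<eta> \<theta> \<beta> lam \<epsilon> p q K X\<^sub>1 G X Mo Lp Rp \<longleftrightarrow>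
     X 1 = X\<^sub>1 \<and> Mo 0 = 0 \<and> Lp 0 = 0 \<and> Rp 0 = 0 \<and>
     (\<forall>k\<in>{1..K}.
        Mo k = \<theta> *\<^sub>R Mo (k - 1) + (1 - \<theta>) *\<^sub>R G k \<and>
        Lp k = \<beta> *\<^sub>R Lp (k - 1) + (1 - \<beta>) *\<^sub>R (G k ** transpose (G k)) \<and>
        Rp k = \<beta> *\<^sub>R Rp (k - 1) + (1 - \<beta>) *\<^sub>R (transpose (G k) ** G k) \<and>
        X (k + 1) = (1 - lam * \<eta>) *\<^sub>R X k -
          \<eta> *\<^sub>R (matrix_powr (Lp k + \<epsilon> *\<^sub>R mat 1) (real_of_ereal (- 1 / (2 * p))) ** Mo k **
                matrix_powr (Rp k + \<epsilon> *\<^sub>R mat 1) (real_of_ereal (- 1 / (2 * q)))))"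

definition gen_sigma ::
  "'a measure \<Rightarrow> (nat \<Rightarrow> 'a \<Rightarrow> 'b::topological_space) \<Rightarrow> nat \<Rightarrow> 'a measure" where
  "gen_sigma P G k = sigma (space P) (\<Union>t\<in>{1..k}. {G t -` A \<inter> space P | A. A \<in> sets borel})"

definition matrix_cond_exp ::
  "'a measure \<Rightarrow> 'a measure \<Rightarrow> ('a \<Rightarrow> real^'n^'m) \<Rightarrow> 'a \<Rightarrow> real^'n^'m" where
  "matrix_cond_exp P F Z \<omega> = (\<chi> i j. real_cond_exp P F (\<lambda>\<omega>. Z \<omega> $ i $ j) \<omega>)"

end

theory Submission
  imports Defs
begin

text \<open>
  Put \<open>s = 1/p\<close>, \<open>t = 1/q\<close>. In the eigenbases of the two preconditioners one step is the entrywise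
  scaling of the momentum by \<open>c i j = l i powr (-s/2) * r j powr (-t/2)\<close>, and completing the square
  entry by entry in the descent inequality leaves the weighted gradient norm, a weight-decay term and
  the momentum error. By Young's inequality and contractivity the dual weights cost at most
  \<open>T = s tr L\<^bsup>1/2\<^esup> + t tr R\<^bsup>1/2\<^esup>\<close>, both for the nuclear norm of the gradient and for the iterate.

  Three estimates close the argument. The updates have spectral norm at most \<open>\<surd>2\<close>: the
  momentum is dominated by each accumulator (\<open>M M\<^sup>T \<le> 2 L\<close>, \<open>M\<^sup>T M \<le> 2 R\<close>), and Heinz interpolation
  between the two sides applies. The expectation of \<open>T\<close> is at most twice
  \<open>\<sigma> \<surd>(m + n)\<close> (with the hatted \<open>\<sigma>\<close>) plus an exponentially weighted sum of the nuclear norms of past gradients, whose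
  total is a multiple of \<open>(1 - \<theta>)\<^bsup>-1/2\<^esup>\<close> times the quantity to be bounded and is absorbed because its
  coefficient is of order \<open>1 - \<theta>\<close>. The momentum error obeys a contraction driven by the squared step
  lengths, which the negative term of the descent inequality cancels.
\<close>

declare transpose_matrix_vector [simp del]

lemma inner_matrix:
  fixes A B :: "real^'n^'m"
  shows "A \<bullet> B = (\<Sum>i\<in>UNIV. \<Sum>j\<in>UNIV. A$i$j * B$i$j)"
  by (simp add: inner_vec_def)

lemma transpose_simps:
  fixes A B :: "real^'n^'m"
  shows "transpose (A + B) = transpose A + transpose B" "transpose (A - B) = transpose A - transpose B"
    "transpose (0 :: real^'n^'m) = 0" "transpose (c *\<^sub>R A) = c *\<^sub>R transpose A"
  by (auto simp: transpose_def vec_eq_iff)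

lemma inner_transpose:
  fixes A B :: "real^'n^'m"
  shows "transpose A \<bullet> transpose B = A \<bullet> B"
  unfolding inner_matrix by (subst sum.swap) (simp add: transpose_def)

lemma norm_transpose [simp]: "norm (transpose A) = norm (A :: real^'n^'m)"
  by (simp add: norm_eq_sqrt_inner inner_transpose)

lemma inner_matrix_mul_left:
  fixes A :: "real^'k^'m" and B :: "real^'n^'k" and C :: "real^'n^'m"
  shows "(A ** B) \<bullet> C = B \<bullet> (transpose A ** C)"
proof -
  have "(A ** B) \<bullet> C = (\<Sum>i\<in>UNIV. \<Sum>j\<in>UNIV. \<Sum>k\<in>UNIV. A$i$k * B$k$j * C$i$j)"
    by (simp add: inner_matrix matrix_matrix_mult_def sum_distrib_right)
  also have "\<dots> = (\<Sum>j\<in>UNIV. \<Sum>i\<in>UNIV. \<Sum>k\<in>UNIV. A$i$k * B$k$j * C$i$j)"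
    by (rule sum.swap)
  also have "\<dots> = (\<Sum>j\<in>UNIV. \<Sum>k\<in>UNIV. \<Sum>i\<in>UNIV. A$i$k * B$k$j * C$i$j)"
    by (intro sum.cong refl sum.swap)
  also have "\<dots> = (\<Sum>k\<in>UNIV. \<Sum>j\<in>UNIV. \<Sum>i\<in>UNIV. A$i$k * B$k$j * C$i$j)"
    by (rule sum.swap)
  also have "\<dots> = B \<bullet> (transpose A ** C)"
    by (simp add: inner_matrix matrix_matrix_mult_def sum_distrib_left transpose_def mult_ac)
  finally show ?thesis .
qed

lemma inner_matrix_mul_right:
  fixes A :: "real^'k^'m" and B :: "real^'n^'k" and C :: "real^'n^'m"
  shows "(A ** B) \<bullet> C = A \<bullet> (C ** transpose B)"
proof -
  have "(A ** B) \<bullet> C = (transpose B ** transpose A) \<bullet> transpose C"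
    by (metis inner_transpose matrix_transpose_mul)
  also have "\<dots> = transpose A \<bullet> (B ** transpose C)"
    by (simp add: inner_matrix_mul_left)
  also have "\<dots> = A \<bullet> (C ** transpose B)"
    by (metis inner_transpose matrix_transpose_mul transpose_transpose)
  finally show ?thesis .
qed

lemma trace_eq_inner: "trace A = (A :: real^'n^'n) \<bullet> mat 1"
  by (simp add: trace_def inner_matrix mat_def if_distrib[where f="\<lambda>x. _ * x"] sum.delta' cong: if_cong)

lemma inner_gram: "trace (A ** transpose A) = (norm (A :: real^'n^'m))\<^sup>2"
  by (simp add: trace_eq_inner inner_matrix_mul_right power2_norm_eq_inner)

lemma transpose_vector_inner:
  fixes A :: "real^'n^'m"
  shows "x \<bullet> (A *v y) = (transpose A *v x) \<bullet> y"
  by (metis transpose_matrix_vector dot_lmul_matrix)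

lemma norm_matrix_vector_square:
  fixes A :: "real^'n^'m"
  shows "(norm (A *v v))\<^sup>2 = v \<bullet> ((transpose A ** A) *v v)"
  by (metis inner_commute matrix_vector_mul_assoc power2_norm_eq_inner transpose_vector_inner)

lemma matrix_bound_transpose:
  fixes A :: "real^'n^'m"
  assumes "\<And>v. norm (A *v v) \<le> c * norm v"
  shows "norm (transpose A *v u) \<le> c * norm u"
proof (cases "transpose A *v u = 0")
  case True
  have "0 \<le> c * norm (axis undefined 1 :: real^'n)" using assms[of "axis undefined 1"] norm_ge_zero order_trans by blast
  then have "0 \<le> c" by simp
  then show ?thesis using True by simp
next
  case False
  have "(norm (transpose A *v u))\<^sup>2 = u \<bullet> (A *v (transpose A *v u))"
    by (metis power2_norm_eq_inner transpose_vector_inner)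
  also have "\<dots> \<le> norm u * norm (A *v (transpose A *v u))" by (rule norm_cauchy_schwarz)
  also have "\<dots> \<le> norm u * (c * norm (transpose A *v u))" by (intro mult_left_mono assms) auto
  finally show ?thesis using False by (simp add: power2_eq_square mult.commute mult.left_commute)
qed

subsection \<open>The spectral theorem for real symmetric matrices\<close>

lemma symmetric_eigenvector_in_subspace:
  fixes A :: "real^'n^'n"
  assumes sym: "transpose A = A" and S: "subspace S" "S \<noteq> {0}" and inv: "\<And>x. x \<in> S \<Longrightarrow> A *v x \<in> S"
  obtains v c where "v \<in> S" "norm v = 1" "A *v v = c *\<^sub>R v"
proof -
  let ?U = "S \<inter> sphere 0 1"
  have "compact ?U"
    using closed_Int_compact[OF closed_subspace[OF S(1)] compact_sphere] .
  moreover have "?U \<noteq> {}"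
  proof -
    obtain x where "x \<in> S" "x \<noteq> 0" using S subspace_0 by blast
    then have "(1 / norm x) *\<^sub>R x \<in> ?U" using S(1) by (auto simp: subspace_scale)
    then show ?thesis by blast
  qed
  moreover have "continuous_on ?U (\<lambda>x. x \<bullet> (A *v x))"
    by (intro continuous_intros)
  ultimately obtain v where v: "v \<in> ?U" and vmax: "\<And>y. y \<in> ?U \<Longrightarrow> y \<bullet> (A *v y) \<le> v \<bullet> (A *v v)"
    by (meson continuous_attains_sup)
  define c where "c = v \<bullet> (A *v v)"
  have nv: "norm v = 1" "v \<in> S" "v \<bullet> v = 1" using v by (auto simp: norm_eq_1)
  have bound: "x \<bullet> (A *v x) \<le> c * (x \<bullet> x)" if "x \<in> S" for x
  proof (cases "x = 0")
    case False
    have "(1 / norm x) *\<^sub>R x \<in> ?U" using that False S(1) by (auto simp: subspace_scale)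
    from vmax[OF this] have "(1 / norm x)\<^sup>2 * (x \<bullet> (A *v x)) \<le> c"
      by (simp add: c_def matrix_vector_mult_scaleR power2_eq_square)
    then show ?thesis using False
      by (simp add: power2_norm_eq_inner[symmetric] field_simps)
  qed simp
  define w where "w = A *v v - c *\<^sub>R v"
  have wS: "w \<in> S" unfolding w_def using inv nv S(1) by (simp add: subspace_diff subspace_scale)
  have key: "2 * (w \<bullet> w) \<le> t * (c * (w \<bullet> w) - w \<bullet> (A *v w))" if "t > 0" for t
  proof -
    have "v + t *\<^sub>R w \<in> S" using wS nv S(1) by (simp add: subspace_add subspace_scale)
    from bound[OF this] have "c + 2 * t * (w \<bullet> (A *v v)) + t\<^sup>2 * (w \<bullet> (A *v w))
        \<le> c * (1 + 2 * t * (v \<bullet> w) + t\<^sup>2 * (w \<bullet> w))"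
    proof -
      have "v \<bullet> (A *v w) = w \<bullet> (A *v v)"
        by (metis transpose_vector_inner sym inner_commute)
      then have "(v + t *\<^sub>R w) \<bullet> (A *v (v + t *\<^sub>R w)) = c + 2 * t * (w \<bullet> (A *v v)) + t\<^sup>2 * (w \<bullet> (A *v w))"
        by (simp add: matrix_vector_right_distrib matrix_vector_mult_scaleR inner_add_left inner_add_right c_def power2_eq_square distrib_left)
      moreover have "(v + t *\<^sub>R w) \<bullet> (v + t *\<^sub>R w) = 1 + 2 * t * (v \<bullet> w) + t\<^sup>2 * (w \<bullet> w)"
        using nv by (simp add: inner_add_left inner_add_right inner_commute[of w v] power2_eq_square distrib_left)
      ultimately show ?thesis using bound[OF \<open>v + t *\<^sub>R w \<in> S\<close>] by simp
    qed
    then have "t * (2 * (w \<bullet> (A *v v) - c * (v \<bullet> w))) \<le> t * (t * (c * (w \<bullet> w) - w \<bullet> (A *v w)))"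
      by (simp add: power2_eq_square algebra_simps)
    then have "2 * (w \<bullet> (A *v v) - c * (v \<bullet> w)) \<le> t * (c * (w \<bullet> w) - w \<bullet> (A *v w))"
      using that by simp
    moreover have "w \<bullet> (A *v v) - c * (v \<bullet> w) = w \<bullet> (A *v v - c *\<^sub>R v)"
      by (simp add: inner_diff_right inner_commute[of w v])
    then have "w \<bullet> (A *v v) - c * (v \<bullet> w) = w \<bullet> w" by (simp add: w_def)
    ultimately show ?thesis by simp
  qed
  have "w \<bullet> w \<le> 0"
  proof (rule ccontr)
    assume "\<not> w \<bullet> w \<le> 0"
    then have pos: "w \<bullet> w > 0" by linarith
    define C where "C = \<bar>c * (w \<bullet> w) - w \<bullet> (A *v w)\<bar> + 1"
    have "C > 0" by (simp add: C_def add_nonneg_pos)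
    have "2 * (w \<bullet> w) \<le> (w \<bullet> w / C) * (c * (w \<bullet> w) - w \<bullet> (A *v w))"
      using key[of "w \<bullet> w / C"] pos \<open>C > 0\<close> by simp
    also have "\<dots> \<le> (w \<bullet> w / C) * C"
      using pos \<open>C > 0\<close> by (intro mult_left_mono) (auto simp: C_def)
    also have "\<dots> = w \<bullet> w" using \<open>C > 0\<close> by simp
    finally show False using pos by simp
  qed
  then have "w = 0" by (metis inner_eq_zero_iff inner_ge_zero order_antisym)
  then have "A *v v = c *\<^sub>R v" by (simp add: w_def)
  then show thesis using that nv by blast
qed

lemma symmetric_orthonormal_eigenbasis:
  fixes A :: "real^'n^'n"
  assumes sym: "transpose A = A"
  obtains B where "finite B" "card B = CARD('n)" "pairwise orthogonal B" "\<And>v. v \<in> B \<Longrightarrow> norm v = 1"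
    "\<And>v. v \<in> B \<Longrightarrow> \<exists>c. A *v v = c *\<^sub>R v"
proof -
  define good where "good B \<longleftrightarrow> finite B \<and> pairwise orthogonal B \<and> (\<forall>v\<in>B. norm v = 1 \<and> (\<exists>c. A *v v = c *\<^sub>R v))"
    for B :: "(real^'n) set"
  have ind: "independent B" if "good B" for B
    using that by (intro pairwise_orthogonal_independent) (auto simp: good_def)
  have le: "card B \<le> CARD('n)" if "good B" for B
    using independent_bound[OF ind[OF that]] by simp
  have "good {}" by (simp add: good_def)
  then obtain B where B: "good B" and max: "\<And>C. good C \<Longrightarrow> card C \<le> card B"
    using ex_has_greatest_nat[of good "{}" card "CARD('n) + 1"] le by (metis le_imp_less_Suc Suc_eq_plus1)
  have "card B = CARD('n)"
  proof (rule ccontr)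
    assume "card B \<noteq> CARD('n)"
    then have lt: "card B < CARD('n)" using le[OF B] by simp
    define S where "S = {x. \<forall>b\<in>B. b \<bullet> x = 0}"
    have "subspace S" by (auto simp: S_def subspace_def inner_add)
    have "span B \<noteq> UNIV"
    proof
      assume "span B = UNIV"
      then have "dim (UNIV :: (real^'n) set) \<le> card B"
        using B by (metis dim_le_card' dim_span good_def)
      then show False using lt by simp
    qed
    then obtain a where "a \<noteq> 0" "\<forall>x\<in>span B. a \<bullet> x = 0" using span_not_UNIV_orthogonal by blast
    then have "S \<noteq> {0}" by (auto simp: S_def inner_commute span_base)
    have inv: "A *v x \<in> S" if "x \<in> S" for x
    proof -
      have "b \<bullet> (A *v x) = 0" if "b \<in> B" for b
      proof -
        obtain c where "A *v b = c *\<^sub>R b" using B \<open>b \<in> B\<close> by (auto simp: good_def)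
        then have "b \<bullet> (A *v x) = c * (b \<bullet> x)" by (metis transpose_vector_inner sym inner_scaleR_left)
        then show ?thesis using \<open>x \<in> S\<close> \<open>b \<in> B\<close> by (simp add: S_def)
      qed
      then show ?thesis by (simp add: S_def)
    qed
    obtain v c where v: "v \<in> S" "norm v = 1" "A *v v = c *\<^sub>R v"
      by (rule symmetric_eigenvector_in_subspace[OF sym \<open>subspace S\<close> \<open>S \<noteq> {0}\<close> inv])
    have "v \<notin> B" using v by (auto simp: S_def)
    have "good (insert v B)"
      using B v by (auto simp: good_def pairwise_insert orthogonal_def S_def inner_commute)
    from max[OF this] show False using \<open>v \<notin> B\<close> B by (simp add: good_def)
  qed
  then show thesis using that B unfolding good_def by blast
qed

lemma matrix_mul_diag:
  fixes A :: "real^'n^'m"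
  shows "(A ** diag_matrix d) $ i $ j = A $ i $ j * d j" "(diag_matrix e ** A) $ i $ j = e i * A $ i $ j"
  by (simp_all add: matrix_matrix_mult_def diag_matrix_def if_distrib[where f="\<lambda>x. _ * x"]
      if_distrib[where f="\<lambda>x. x * _"] sum.delta sum.delta' cong: if_cong)

lemma transpose_diag_matrix [simp]: "transpose (diag_matrix d) = diag_matrix d"
  by (auto simp: transpose_def diag_matrix_def vec_eq_iff)

lemma diag_matrix_mul: "diag_matrix d ** diag_matrix e = diag_matrix (\<lambda>i. d i * e i)"
  by (simp add: vec_eq_iff matrix_mul_diag) (simp add: diag_matrix_def)

lemma orthogonal_matrixD:
  assumes "orthogonal_matrix (Q :: real^'n^'n)"
  shows "transpose Q ** Q = mat 1" "Q ** transpose Q = mat 1"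
  using assms by (auto simp: orthogonal_matrix_def)

theorem spectral_theorem:
  fixes A :: "real^'n^'n"
  assumes sym: "transpose A = A"
  obtains Q d where "orthogonal_matrix Q" "A = Q ** diag_matrix d ** transpose Q"
proof -
  obtain B where B: "finite B" "card B = CARD('n)" "pairwise orthogonal B" "\<And>v. v \<in> B \<Longrightarrow> norm v = 1"
    and eig: "\<And>v. v \<in> B \<Longrightarrow> \<exists>c. A *v v = c *\<^sub>R v"
    using symmetric_orthonormal_eigenbasis[OF sym] by blast
  obtain b where b: "bij_betw b (UNIV :: 'n set) B"
    using finite_same_card_bij[of "UNIV :: 'n set" B] B by auto
  have "\<forall>i. \<exists>c. A *v b i = c *\<^sub>R b i" using eig b by (auto simp: bij_betw_def)
  then obtain d where d: "\<And>i. A *v b i = d i *\<^sub>R b i" by metis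
  define Q :: "real^'n^'n" where "Q = (\<chi> i j. b j $ i)"
  have col: "column j Q = b j" for j by (simp add: column_def Q_def)
  have "orthogonal_matrix Q"
    unfolding orthogonal_matrix_orthonormal_columns col
    using B b by (metis UNIV_I bij_betw_apply bij_betw_imp_inj_on injD pairwise_def)
  have "A ** Q = Q ** diag_matrix d"
  proof -
    have "(A ** Q) $ i $ j = (Q ** diag_matrix d) $ i $ j" for i j
    proof -
      have "(A ** Q) $ i $ j = (A *v b j) $ i"
        by (simp add: matrix_matrix_mult_def matrix_vector_mult_def Q_def)
      then show ?thesis by (simp add: d matrix_mul_diag Q_def)
    qed
    then show ?thesis by (simp add: vec_eq_iff)
  qed
  then have "A = Q ** diag_matrix d ** transpose Q"
    by (metis \<open>orthogonal_matrix Q\<close> matrix_mul_assoc matrix_mul_rid orthogonal_matrixD(2))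
  then show thesis using that \<open>orthogonal_matrix Q\<close> by blast
qed

subsection \<open>Powers of symmetric matrices\<close>

abbreviation conj_diag :: "real^'n^'n \<Rightarrow> ('n \<Rightarrow> real) \<Rightarrow> real^'n^'n" where
  "conj_diag Q d \<equiv> Q ** diag_matrix d ** transpose Q"

lemma orthogonal_cancel:
  assumes "orthogonal_matrix (Q :: real^'n^'n)"
  shows "transpose Q ** (Q ** A) = A" "Q ** (transpose Q ** A) = A"
    "B ** transpose Q ** Q = B" "B ** Q ** transpose Q = B"
  using orthogonal_matrixD[OF assms] by (metis matrix_mul_assoc matrix_mul_lid matrix_mul_rid)+

lemma transpose_conj_diag [simp]: "transpose (conj_diag Q d) = conj_diag Q d"
  by (simp add: matrix_transpose_mul matrix_mul_assoc)

lemma conj_diag_mul: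
  assumes "orthogonal_matrix Q"
  shows "conj_diag Q d ** conj_diag Q e = conj_diag Q (\<lambda>i. d i * e i)"
proof -
  have "conj_diag Q d ** conj_diag Q e = Q ** diag_matrix d ** (transpose Q ** Q) ** diag_matrix e ** transpose Q"
    by (simp add: matrix_mul_assoc)
  also have "\<dots> = Q ** (diag_matrix d ** diag_matrix e) ** transpose Q"
    by (simp add: orthogonal_matrixD[OF assms] matrix_mul_assoc)
  finally show ?thesis by (simp add: diag_matrix_mul)
qed

lemma conj_diag_one:
  assumes "orthogonal_matrix (Q :: real^'n^'n)"
  shows "conj_diag Q (\<lambda>i. 1) = mat 1"
proof -
  have "diag_matrix (\<lambda>i. 1) = (mat 1 :: real^'n^'n)" by (simp add: diag_matrix_def mat_def)
  then show ?thesis by (simp add: orthogonal_matrixD[OF assms])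
qed

lemma inner_orthogonal_conj:
  fixes A B :: "real^'n^'m" and Q :: "real^'m^'m" and V :: "real^'n^'n"
  assumes Q: "orthogonal_matrix Q" and V: "orthogonal_matrix V"
  shows "(transpose Q ** A ** V) \<bullet> (transpose Q ** B ** V) = A \<bullet> B"
proof -
  have "(transpose Q ** A ** V) \<bullet> (transpose Q ** B ** V) = (transpose Q ** A) \<bullet> (transpose Q ** B ** V ** transpose V)"
    by (rule inner_matrix_mul_right)
  also have "\<dots> = (transpose Q ** A) \<bullet> (transpose Q ** B)"
    by (simp add: orthogonal_cancel[OF V])
  also have "\<dots> = A \<bullet> B"
    by (simp add: inner_matrix_mul_left orthogonal_cancel[OF Q])
  finally show ?thesis .
qed

lemma norm_orthogonal_conj:
  fixes A :: "real^'n^'m"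
  assumes "orthogonal_matrix Q" and "orthogonal_matrix V"
  shows "norm (transpose Q ** A ** V) = norm A"
  by (simp add: norm_eq_sqrt_inner inner_orthogonal_conj[OF assms])

lemma orthogonal_matrix_norm:
  assumes "orthogonal_matrix (Q :: real^'n^'n)"
  shows "norm (Q *v x) = norm x" "norm (transpose Q *v x) = norm x"
proof -
  have *: "norm (R *v x) = norm x" if "orthogonal_matrix R" for R :: "real^'n^'n"
  proof -
    have "(norm (R *v x))\<^sup>2 = (norm x)\<^sup>2"
      unfolding norm_matrix_vector_square orthogonal_matrixD[OF that] by (simp add: power2_norm_eq_inner)
    then show ?thesis by simp
  qed
  show "norm (Q *v x) = norm x" "norm (transpose Q *v x) = norm x"
    using *[of Q] *[of "transpose Q"] assms by simp_all
qed

text \<open>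
  Between two eigenbases \<open>Q\<close>, \<open>V\<close> the difference \<open>A - B\<close> has the entries
  \<open>(d i - e j) S i j\<close> with \<open>S = Q\<^sup>T V\<close>. Uniqueness of the powers and their Lipschitz
  continuity both come from applying a scalar function inside the bracket.
\<close>

lemma conj_diag_diff:
  fixes Q V :: "real^'n^'n"
  assumes Q: "orthogonal_matrix Q" and V: "orthogonal_matrix V"
  shows "(transpose Q ** (conj_diag Q d - conj_diag V e) ** V) $ i $ j = (d i - e j) * (transpose Q ** V) $ i $ j"
proof -
  have "transpose Q ** (conj_diag Q d - conj_diag V e) ** V =
      diag_matrix d ** (transpose Q ** V) - (transpose Q ** V) ** diag_matrix e"
  proof -
    have "transpose Q ** conj_diag Q d ** V = diag_matrix d ** (transpose Q ** V)"
      by (simp add: matrix_mul_assoc orthogonal_matrixD[OF Q])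
    moreover have "transpose Q ** conj_diag V e ** V = transpose Q ** V ** diag_matrix e ** (transpose V ** V)"
      by (simp add: matrix_mul_assoc)
    moreover have "transpose Q ** (A - B) ** V = transpose Q ** A ** V - transpose Q ** B ** V" for A B
    proof -
      have "transpose Q ** A ** V = transpose Q ** (A - B) ** V + transpose Q ** B ** V"
        by (simp add: vec_eq_iff matrix_matrix_mult_def left_diff_distrib right_diff_distrib sum_subtractf)
      then show ?thesis by simp
    qed
    ultimately show ?thesis by (simp add: orthogonal_matrixD[OF V])
  qed
  then show ?thesis by (simp add: matrix_mul_diag left_diff_distrib mult.commute)
qed

lemma conj_diag_diff_bound:
  fixes Q V :: "real^'n^'n"
  assumes Q: "orthogonal_matrix Q" and V: "orthogonal_matrix V"
    and g: "\<And>i j. \<bar>g (d i) - g (e j)\<bar> \<le> C * \<bar>d i - e j\<bar>" and "C \<ge> 0"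
  shows "norm (conj_diag Q (\<lambda>i. g (d i)) - conj_diag V (\<lambda>i. g (e i))) \<le> C * norm (conj_diag Q d - conj_diag V e)"
proof -
  have sq: "(norm A)\<^sup>2 = (\<Sum>i\<in>UNIV. \<Sum>j\<in>UNIV. (A$i$j)\<^sup>2)" for A :: "real^'n^'n"
    unfolding power2_norm_eq_inner inner_matrix by (simp add: power2_eq_square)
  define S where "S = transpose Q ** V"
  have n: "(norm (conj_diag Q a - conj_diag V b))\<^sup>2 = (\<Sum>i\<in>UNIV. \<Sum>j\<in>UNIV. ((a i - b j) * S$i$j)\<^sup>2)" for a b
    using norm_orthogonal_conj[OF Q V, of "conj_diag Q a - conj_diag V b"]
    unfolding sq[of "transpose Q ** (conj_diag Q a - conj_diag V b) ** V", unfolded conj_diag_diff[OF Q V], folded S_def, symmetric]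
    by simp
  have "(norm (conj_diag Q (\<lambda>i. g (d i)) - conj_diag V (\<lambda>i. g (e i))))\<^sup>2 \<le> (C * norm (conj_diag Q d - conj_diag V e))\<^sup>2"
    unfolding power_mult_distrib n sum_distrib_left
  proof (intro sum_mono)
    fix i j
    have "(g (d i) - g (e j))\<^sup>2 \<le> (C * (d i - e j))\<^sup>2"
      using g[of i j] \<open>C \<ge> 0\<close> by (simp add: abs_le_square_iff[symmetric] abs_mult)
    then show "(g (d i) - g (e j))\<^sup>2 * (S $ i $ j)\<^sup>2 \<le> C\<^sup>2 * ((d i - e j)\<^sup>2 * (S $ i $ j)\<^sup>2)"
      by (simp add: power_mult_distrib mult_right_mono mult.assoc[symmetric])
  qed
  then show ?thesis using \<open>C \<ge> 0\<close> by (simp add: power2_le_iff_abs_le abs_le_square_iff[symmetric])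
qed

lemma matrix_powr_conj_diag:
  assumes Q: "orthogonal_matrix Q"
  shows "matrix_powr (conj_diag Q d) r = conj_diag Q (\<lambda>i. d i powr r)"
  unfolding matrix_powr_def
proof (rule the_equality)
  show "\<exists>Q' d'. orthogonal_matrix Q' \<and> conj_diag Q d = conj_diag Q' d' \<and>
      conj_diag Q (\<lambda>i. d i powr r) = conj_diag Q' (\<lambda>i. d' i powr r)"
    using Q by blast
next
  fix B assume "\<exists>Q' d'. orthogonal_matrix Q' \<and> conj_diag Q d = conj_diag Q' d' \<and> B = conj_diag Q' (\<lambda>i. d' i powr r)"
  then obtain V e where V: "orthogonal_matrix V" and eq: "conj_diag Q d = conj_diag V e"
    and B: "B = conj_diag V (\<lambda>i. e i powr r)" by blast
  define g :: "real \<Rightarrow> real" where "g x = x powr r" for x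
  define C where "C = (\<Sum>i\<in>UNIV. \<Sum>j\<in>UNIV. \<bar>g (e i) - g (d j)\<bar> / \<bar>e i - d j\<bar>)"
  have "norm (conj_diag V (\<lambda>i. g (e i)) - conj_diag Q (\<lambda>i. g (d i))) \<le> C * norm (conj_diag V e - conj_diag Q d)"
  proof (rule conj_diag_diff_bound[OF V Q])
    show "C \<ge> 0" by (auto simp: C_def intro!: sum_nonneg)
    fix i j
    show "\<bar>g (e i) - g (d j)\<bar> \<le> C * \<bar>e i - d j\<bar>"
    proof (cases "e i = d j")
      case False
      have "\<bar>g (e i) - g (d j)\<bar> / \<bar>e i - d j\<bar> \<le> (\<Sum>j\<in>UNIV. \<bar>g (e i) - g (d j)\<bar> / \<bar>e i - d j\<bar>)"
        by (rule member_le_sum) auto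
      also have "\<dots> \<le> C" unfolding C_def by (rule member_le_sum) (auto intro!: sum_nonneg)
      finally show ?thesis using False by (simp add: divide_simps)
    qed simp
  qed
  then show "B = conj_diag Q (\<lambda>i. d i powr r)" by (simp add: eq B g_def)
qed

lemma diag_matrix_vector [simp]: "(diag_matrix d *v w) $ i = d i * w $ i"
  by (simp add: matrix_vector_mult_def diag_matrix_def if_distrib[where f="\<lambda>x. x * _"] sum.delta cong: if_cong)

lemma conj_diag_quadratic_form: "x \<bullet> (conj_diag Q d *v x) = (\<Sum>i\<in>UNIV. d i * ((transpose Q *v x) $ i)\<^sup>2)"
proof -
  have "x \<bullet> (conj_diag Q d *v x) = (transpose Q *v x) \<bullet> (diag_matrix d *v (transpose Q *v x))"
    by (metis matrix_vector_mul_assoc transpose_vector_inner)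
  also have "\<dots> = (\<Sum>i\<in>UNIV. d i * ((transpose Q *v x) $ i)\<^sup>2)"
    by (simp add: inner_vec_def power2_eq_square mult_ac)
  finally show ?thesis .
qed

lemma conj_diag_eigenvalue:
  assumes "orthogonal_matrix Q"
  shows "column i Q \<bullet> (conj_diag Q d *v column i Q) = d i" "conj_diag Q d *v column i Q = d i *\<^sub>R column i Q"
    "norm (column i Q) = 1"
proof -
  have col: "column i Q = Q *v axis i 1" by (simp add: matrix_vector_mult_basis)
  have 1: "transpose Q *v column i Q = axis i 1"
    unfolding col by (simp add: matrix_vector_mul_assoc orthogonal_matrixD[OF assms])
  have "diag_matrix d *v axis i 1 = d i *\<^sub>R axis i 1"
    by (simp add: vec_eq_iff axis_def)
  then show "conj_diag Q d *v column i Q = d i *\<^sub>R column i Q"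
    using 1 by (simp add: col matrix_vector_mult_scaleR flip: matrix_vector_mul_assoc)
  show "norm (column i Q) = 1"
    unfolding col by (simp only: orthogonal_matrix_norm[OF assms]) simp
  show "column i Q \<bullet> (conj_diag Q d *v column i Q) = d i"
    by (simp add: conj_diag_quadratic_form 1 axis_def if_distrib[where f="\<lambda>x. x^2"] if_distrib[where f="\<lambda>x. _ * x"] sum.delta cong: if_cong)
qed

lemma loewner_ge_scaled_identity:
  fixes A :: "real^'n^'n"
  assumes "e *\<^sub>R mat 1 \<preceq>\<^sub>L A"
  shows "transpose A = A" "e * (x \<bullet> x) \<le> x \<bullet> (A *v x)"
proof -
  have 1: "transpose (A - e *\<^sub>R mat 1) = A - e *\<^sub>R mat 1" and 2: "0 \<le> x \<bullet> ((A - e *\<^sub>R mat 1) *v x)"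
    using assms by (auto simp: loewner_le_def psd_def)
  show "transpose A = A" using 1 by (simp add: transpose_simps)
  show "e * (x \<bullet> x) \<le> x \<bullet> (A *v x)"
    using 2 by (simp add: matrix_vector_mult_diff_rdistrib inner_diff_right scaleR_matrix_vector_assoc[symmetric])
qed

lemma loewner_ge_diagonalization:
  fixes A :: "real^'n^'n"
  assumes "e *\<^sub>R mat 1 \<preceq>\<^sub>L A"
  obtains Q d where "orthogonal_matrix Q" "A = conj_diag Q d" "\<And>i. e \<le> d i"
proof -
  obtain Q d where Q: "orthogonal_matrix Q" and A: "A = conj_diag Q d"
    using spectral_theorem[OF loewner_ge_scaled_identity(1)[OF assms]] by blast
  have "e \<le> d i" for i
    using loewner_ge_scaled_identity(2)[OF assms, of "column i Q"] conj_diag_eigenvalue(1)[OF Q, where i=i and d=d] conj_diag_eigenvalue(3)[OF Q, where i=i]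
    unfolding A by (simp add: power2_norm_eq_inner[symmetric])
  then show thesis using that Q A by blast
qed

lemma powr_lipschitz:
  fixes x y r e :: real
  assumes "e > 0" "x \<ge> e" "y \<ge> e" "r \<le> 1"
  shows "\<bar>x powr r - y powr r\<bar> \<le> (\<bar>r\<bar> * e powr (r - 1)) * \<bar>x - y\<bar>"
proof -
  have "norm (x powr r - y powr r) \<le> (\<bar>r\<bar> * e powr (r - 1)) * norm (x - y)"
  proof (rule field_differentiable_bound[of "{e..}" "\<lambda>x. x powr r" "\<lambda>x. r * x powr (r - 1)"])
    fix z assume "z \<in> {e..}"
    then have z: "z \<ge> e" "z > 0" using assms by auto
    then show "((\<lambda>x. x powr r) has_field_derivative r * z powr (r - 1)) (at z within {e..})"
      by (auto intro!: derivative_eq_intros simp: powr_diff)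
    have "z powr (r - 1) \<le> e powr (r - 1)" using z assms by (intro powr_mono2') auto
    then show "norm (r * z powr (r - 1)) \<le> \<bar>r\<bar> * e powr (r - 1)"
      by (simp add: abs_mult mult_left_mono)
  qed (use assms in auto)
  then show ?thesis by simp
qed

lemma continuous_on_matrix_powr:
  assumes "e > 0" "r \<le> 1"
  shows "continuous_on {A :: real^'n^'n. e *\<^sub>R mat 1 \<preceq>\<^sub>L A} (\<lambda>A. matrix_powr A r)"
proof (rule lipschitz_on_continuous_on[OF lipschitz_onI])
  show "0 \<le> \<bar>r\<bar> * e powr (r - 1)" by simp
  fix A B :: "real^'n^'n"
  assume "A \<in> {A. e *\<^sub>R mat 1 \<preceq>\<^sub>L A}" "B \<in> {A. e *\<^sub>R mat 1 \<preceq>\<^sub>L A}"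
  then obtain Q d V b where Q: "orthogonal_matrix Q" "A = conj_diag Q d" "\<And>i. e \<le> d i"
    and V: "orthogonal_matrix V" "B = conj_diag V b" "\<And>i. e \<le> b i"
    by (metis loewner_ge_diagonalization mem_Collect_eq)
  show "dist (matrix_powr A r) (matrix_powr B r) \<le> (\<bar>r\<bar> * e powr (r - 1)) * dist A B"
    unfolding Q(2) V(2) dist_norm matrix_powr_conj_diag[OF Q(1)] matrix_powr_conj_diag[OF V(1)]
    by (rule conj_diag_diff_bound[where g="\<lambda>x. x powr r", OF Q(1) V(1)])
       (use assms Q V in \<open>auto intro!: powr_lipschitz\<close>)
qed

subsection \<open>Singular values, spectral norm and nuclear norm\<close>

lemma gram_eigendecomposition:
  fixes A :: "real^'n^'m"
  obtains Q d where "orthogonal_matrix Q" "transpose A ** A = conj_diag Q (\<lambda>i. (d i)\<^sup>2)" "\<And>i. 0 \<le> d i"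
    "\<And>i. norm (A *v column i Q) = d i"
proof -
  have "transpose (transpose A ** A) = transpose A ** A" by (simp add: matrix_transpose_mul)
  from spectral_theorem[OF this] obtain Q e where Q: "orthogonal_matrix Q" and A: "transpose A ** A = conj_diag Q e" .
  have e: "e i = (norm (A *v column i Q))\<^sup>2" for i
    using conj_diag_eigenvalue(1)[OF Q, where i=i and d=e] by (simp add: norm_matrix_vector_square A)
  show thesis
    by (rule that[of Q "\<lambda>i. norm (A *v column i Q)"]) (use Q A in \<open>simp_all add: e[symmetric]\<close>)
qed

lemma conj_diag_eigenspace:
  assumes Q: "orthogonal_matrix Q"
  shows "{v. conj_diag Q d *v v = c *\<^sub>R v} = span ((\<lambda>i. column i Q) ` {i. d i = c})"
proof
  show "span ((\<lambda>i. column i Q) ` {i. d i = c}) \<subseteq> {v. conj_diag Q d *v v = c *\<^sub>R v}"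
  proof (rule span_minimal)
    show "(\<lambda>i. column i Q) ` {i. d i = c} \<subseteq> {v. conj_diag Q d *v v = c *\<^sub>R v}"
      using conj_diag_eigenvalue(2)[OF Q] by auto
    show "subspace {v. conj_diag Q d *v v = c *\<^sub>R v}"
      by (auto simp: subspace_def matrix_vector_right_distrib matrix_vector_mult_scaleR scaleR_right_distrib)
  qed
next
  show "{v. conj_diag Q d *v v = c *\<^sub>R v} \<subseteq> span ((\<lambda>i. column i Q) ` {i. d i = c})"
  proof safe
    fix v assume v: "conj_diag Q d *v v = c *\<^sub>R v"
    define w where "w = transpose Q *v v"
    have "v = Q *v w" by (simp add: w_def matrix_vector_mul_assoc orthogonal_matrixD[OF Q])
    have "diag_matrix d *v w = c *\<^sub>R w"
    proof -
      have "transpose Q *v (conj_diag Q d *v v) = diag_matrix d *v w"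
        by (simp add: w_def matrix_vector_mul_assoc matrix_mul_assoc orthogonal_matrixD[OF Q])
      then show ?thesis by (simp add: v matrix_vector_mult_scaleR w_def)
    qed
    then have "(diag_matrix d *v w) $ i = c * w $ i" for i by simp
    then have "d i * w $ i = c * w $ i" for i by simp
    then have zero: "w $ i = 0" if "d i \<noteq> c" for i using that by (metis mult_right_cancel)
    have "v = (\<Sum>i\<in>UNIV. w $ i *\<^sub>R column i Q)"
      unfolding \<open>v = Q *v w\<close> by (simp add: matrix_mult_sum scalar_mult_eq_scaleR)
    also have "\<dots> = (\<Sum>i\<in>{i. d i = c}. w $ i *\<^sub>R column i Q)"
      by (rule sum.mono_neutral_right) (auto simp: zero)
    also have "\<dots> \<in> span ((\<lambda>i. column i Q) ` {i. d i = c})"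
      by (intro span_sum span_scale span_base) auto
    finally show "v \<in> span ((\<lambda>i. column i Q) ` {i. d i = c})" .
  qed
qed

lemma orthogonal_columns:
  assumes Q: "orthogonal_matrix (Q :: real^'n^'n)"
  shows "inj (\<lambda>i. column i Q)" "independent ((\<lambda>i. column i Q) ` I)"
proof -
  have ort: "i \<noteq> j \<Longrightarrow> orthogonal (column i Q) (column j Q)" for i j
    using Q unfolding orthogonal_matrix_orthonormal_columns by blast
  have n: "column i Q \<noteq> 0" for i using conj_diag_eigenvalue(3)[OF Q, of i] by auto
  show "inj (\<lambda>i. column i Q)" by (intro injI) (metis n ort orthogonal_self)
  show "independent ((\<lambda>i. column i Q) ` I)"
    by (rule pairwise_orthogonal_independent) (auto simp: pairwise_def ort n, metis ort)
qed

lemma dim_conj_diag_eigenspace: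
  assumes Q: "orthogonal_matrix Q"
  shows "dim {v. conj_diag Q d *v v = c *\<^sub>R v} = card {i. d i = c}"
  unfolding conj_diag_eigenspace[OF Q] dim_span dim_eq_card_independent[OF orthogonal_columns(2)[OF Q]]
  by (rule card_image[OF inj_on_subset[OF orthogonal_columns(1)[OF Q]]]) simp

lemma singular_values_eq:
  fixes A :: "real^'n^'m"
  assumes Q: "orthogonal_matrix Q" and A: "transpose A ** A = conj_diag Q (\<lambda>i. (d i)\<^sup>2)" and d: "\<And>i. 0 \<le> d i"
  shows "singular_values A = range d" "0 \<le> s \<Longrightarrow> singular_value_mult A s = card {i. d i = s}"
proof -
  have eq: "{i. (d i)\<^sup>2 = s\<^sup>2} = {i. d i = s}" if "0 \<le> s" for s
    using d that by (auto simp: power2_eq_iff_nonneg)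
  show mult: "singular_value_mult A s = card {i. d i = s}" if "0 \<le> s" for s
    unfolding singular_value_mult_def A dim_conj_diag_eigenspace[OF Q] eq[OF that] ..
  show "singular_values A = range d"
  proof (intro set_eqI iffI)
    fix s assume "s \<in> singular_values A"
    then obtain v where "0 \<le> s" "v \<noteq> 0" "(transpose A ** A) *v v = s\<^sup>2 *\<^sub>R v"
      by (auto simp: singular_values_def)
    then have "v \<in> span ((\<lambda>i. column i Q) ` {i. d i = s})"
      using conj_diag_eigenspace[OF Q, of "\<lambda>i. (d i)\<^sup>2" "s\<^sup>2"] by (auto simp: A eq)
    then have "{i. d i = s} \<noteq> {}" using \<open>v \<noteq> 0\<close> by force
    then show "s \<in> range d" by auto
  next
    fix s assume "s \<in> range d"
    then obtain i where i: "s = d i" by auto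
    have "column i Q \<noteq> 0" using conj_diag_eigenvalue(3)[OF Q, of i] by auto
    then show "s \<in> singular_values A"
      unfolding singular_values_def A i using conj_diag_eigenvalue(2)[OF Q, where i=i and d="\<lambda>i. (d i)\<^sup>2"] d by blast
  qed
qed

lemma spectral_norm_attained:
  fixes A :: "real^'n^'m"
  obtains v where "v \<noteq> 0" "(transpose A ** A) *v v = (spectral_norm A)\<^sup>2 *\<^sub>R v" "0 \<le> spectral_norm A"
    "\<And>x. norm (A *v x) \<le> spectral_norm A * norm x"
proof -
  obtain Q d where Q: "orthogonal_matrix Q" and A: "transpose A ** A = conj_diag Q (\<lambda>i. (d i)\<^sup>2)" and d: "\<And>i. 0 \<le> d i"
    using gram_eigendecomposition by metis
  have sv: "singular_values A = range d" by (rule singular_values_eq[OF Q A d])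
  have "spectral_norm A \<in> range d" unfolding spectral_norm_def sv by (rule Max_in) auto
  then have "spectral_norm A \<in> singular_values A" using sv by simp
  then obtain v where v: "v \<noteq> 0" "(transpose A ** A) *v v = (spectral_norm A)\<^sup>2 *\<^sub>R v" "0 \<le> spectral_norm A"
    by (auto simp: singular_values_def)
  have le: "d i \<le> spectral_norm A" for i unfolding spectral_norm_def sv by (rule Max_ge) auto
  have "norm (A *v x) \<le> spectral_norm A * norm x" for x
  proof -
    have "(norm (A *v x))\<^sup>2 = (\<Sum>i\<in>UNIV. (d i)\<^sup>2 * ((transpose Q *v x) $ i)\<^sup>2)"
      unfolding norm_matrix_vector_square A conj_diag_quadratic_form ..
    also have "\<dots> \<le> (\<Sum>i\<in>UNIV. (spectral_norm A)\<^sup>2 * ((transpose Q *v x) $ i)\<^sup>2)"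
      using le d by (intro sum_mono mult_right_mono power_mono) auto
    also have "\<dots> = (spectral_norm A)\<^sup>2 * (norm (transpose Q *v x))\<^sup>2"
      by (simp add: sum_distrib_left power2_norm_eq_inner inner_vec_def) (simp add: power2_eq_square)
    also have "\<dots> = (spectral_norm A * norm x)\<^sup>2"
      by (simp add: orthogonal_matrix_norm[OF Q] power_mult_distrib)
    finally show ?thesis by (rule power2_le_imp_le) (simp add: v(3))
  qed
  then show thesis using that v by blast
qed

lemma spectral_norm_bound: "norm (A *v x) \<le> spectral_norm A * norm x"
  using spectral_norm_attained by blast

lemma spectral_norm_nonneg: "0 \<le> spectral_norm A"
  using spectral_norm_attained by blast

lemma spectral_norm_le:
  assumes "\<And>x. norm (A *v x) \<le> c * norm x"
  shows "spectral_norm A \<le> c"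
proof -
  obtain v where v: "v \<noteq> 0" "(transpose A ** A) *v v = (spectral_norm A)\<^sup>2 *\<^sub>R v" "0 \<le> spectral_norm A"
    using spectral_norm_attained by blast
  have "(norm (A *v v))\<^sup>2 = (spectral_norm A * norm v)\<^sup>2"
    unfolding norm_matrix_vector_square v(2) power_mult_distrib by (simp add: power2_norm_eq_inner)
  then have "norm (A *v v) = spectral_norm A * norm v" using v(3) by (simp add: power2_eq_iff_nonneg)
  then show ?thesis using assms[of v] v(1) by simp
qed

lemma nuclear_norm_eq_sum:
  fixes A :: "real^'n^'m"
  assumes Q: "orthogonal_matrix Q" and A: "transpose A ** A = conj_diag Q (\<lambda>i. (d i)\<^sup>2)" and d: "\<And>i. 0 \<le> d i"
  shows "nuclear_norm A = (\<Sum>i\<in>UNIV. d i)"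
proof -
  have "nuclear_norm A = (\<Sum>s\<in>range d. real (card {i. d i = s}) * s)"
    unfolding nuclear_norm_def singular_values_eq(1)[OF Q A d]
    by (intro sum.cong refl) (use singular_values_eq(2)[OF Q A d] d in auto)
  also have "\<dots> = (\<Sum>s\<in>range d. \<Sum>i\<in>{i. d i = s}. d i)"
    by (intro sum.cong refl) simp
  also have "\<dots> = (\<Sum>i\<in>UNIV. d i)"
    using sum.image_gen[of UNIV d d] by simp
  finally show ?thesis .
qed

lemma inner_le_nuclear_norm:
  fixes A O1 :: "real^'n^'m"
  assumes "\<And>x. norm (O1 *v x) \<le> c * norm x"
  shows "A \<bullet> O1 \<le> c * nuclear_norm A"
proof -
  obtain Q d where Q: "orthogonal_matrix Q" and A: "transpose A ** A = conj_diag Q (\<lambda>i. (d i)\<^sup>2)" and d: "\<And>i. 0 \<le> d i"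
    and n: "\<And>i. norm (A *v column i Q) = d i"
    using gram_eigendecomposition by metis
  have "A \<bullet> O1 = (A ** Q) \<bullet> (O1 ** Q)"
    using inner_orthogonal_conj[OF orthogonal_matrix_id Q, of A O1] by simp
  also have "\<dots> = (\<Sum>i\<in>UNIV. (A *v column i Q) \<bullet> (O1 *v column i Q))"
  proof -
    have "(B ** Q) $ k $ i = (B *v column i Q) $ k" for B :: "real^'n^'m" and k i
      by (simp add: matrix_matrix_mult_def matrix_vector_mult_def column_def)
    then show ?thesis unfolding inner_matrix by (subst sum.swap) (simp add: inner_vec_def)
  qed
  also have "\<dots> \<le> (\<Sum>i\<in>UNIV. c * d i)"
  proof (rule sum_mono)
    fix i
    have "(A *v column i Q) \<bullet> (O1 *v column i Q) \<le> norm (A *v column i Q) * norm (O1 *v column i Q)"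
      by (rule norm_cauchy_schwarz)
    also have "\<dots> \<le> d i * c" using assms[of "column i Q"] n[of i] d[of i] conj_diag_eigenvalue(3)[OF Q, of i]
      by (auto intro!: mult_left_mono)
    finally show "(A *v column i Q) \<bullet> (O1 *v column i Q) \<le> c * d i" by (simp add: mult.commute)
  qed
  also have "\<dots> = c * nuclear_norm A" by (simp add: nuclear_norm_eq_sum[OF Q A d] sum_distrib_left)
  finally show ?thesis .
qed

text \<open>The contraction is the polar factor of \<open>A\<close>, normalised on each right singular vector.\<close>

lemma nuclear_norm_attained:
  fixes A :: "real^'n^'m"
  obtains O1 where "\<And>x. norm (O1 *v x) \<le> norm x" "nuclear_norm A = A \<bullet> O1"
proof -
  obtain Q d where Q: "orthogonal_matrix Q" and A: "transpose A ** A = conj_diag Q (\<lambda>i. (d i)\<^sup>2)" and d: "\<And>i. 0 \<le> d i"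
    using gram_eigendecomposition by metis
  define h where "h i = (if d i = 0 then 0 else 1 / d i)" for i
  define O1 where "O1 = A ** conj_diag Q h"
  have "A \<bullet> O1 = (\<Sum>i\<in>UNIV. d i)"
  proof -
    have "A \<bullet> O1 = trace (transpose A ** A ** conj_diag Q h)"
    proof -
      have "A \<bullet> O1 = O1 \<bullet> (A ** mat 1)" by (simp add: inner_commute)
      also have "\<dots> = (transpose A ** O1) \<bullet> mat 1"
        using inner_matrix_mul_left[of "transpose A" O1 "mat 1"] by simp
      finally show ?thesis by (simp add: trace_eq_inner O1_def matrix_mul_assoc)
    qed
    also have "\<dots> = trace (conj_diag Q (\<lambda>i. (d i)\<^sup>2 * h i))"
      unfolding A conj_diag_mul[OF Q] ..
    also have "\<dots> = trace (diag_matrix (\<lambda>i. (d i)\<^sup>2 * h i) ** (transpose Q ** Q))"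
      by (subst matrix_mul_assoc[symmetric], subst trace_mul_sym) (simp add: matrix_mul_assoc)
    also have "\<dots> = (\<Sum>i\<in>UNIV. (d i)\<^sup>2 * h i)"
      by (simp add: orthogonal_matrixD[OF Q] trace_def diag_matrix_def)
    also have "\<dots> = (\<Sum>i\<in>UNIV. d i)" by (intro sum.cong) (auto simp: h_def power2_eq_square)
    finally show ?thesis .
  qed
  moreover have "norm (O1 *v x) \<le> norm x" for x
  proof -
    have "transpose O1 ** O1 = conj_diag Q h ** (transpose A ** A) ** conj_diag Q h"
    proof -
      have "transpose O1 = conj_diag Q h ** transpose A"
        unfolding O1_def by (subst matrix_transpose_mul) simp
      then show ?thesis by (simp add: O1_def matrix_mul_assoc)
    qed
    also have "\<dots> = conj_diag Q (\<lambda>i. h i * (d i)\<^sup>2 * h i)"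
      unfolding A conj_diag_mul[OF Q] ..
    finally have "(norm (O1 *v x))\<^sup>2 = (\<Sum>i\<in>UNIV. h i * (d i)\<^sup>2 * h i * ((transpose Q *v x) $ i)\<^sup>2)"
      by (simp only: norm_matrix_vector_square conj_diag_quadratic_form)
    also have "\<dots> \<le> (\<Sum>i\<in>UNIV. 1 * ((transpose Q *v x) $ i)\<^sup>2)"
      by (intro sum_mono mult_right_mono) (auto simp: h_def power2_eq_square)
    also have "\<dots> = (norm (transpose Q *v x))\<^sup>2"
      by (simp add: power2_norm_eq_inner inner_vec_def) (simp add: power2_eq_square)
    finally show ?thesis by (simp add: orthogonal_matrix_norm[OF Q])
  qed
  ultimately show thesis using that nuclear_norm_eq_sum[OF Q A d] by metis
qed


lemma nuclear_norm_transpose [simp]: "nuclear_norm (transpose A) = nuclear_norm A"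
proof -
  have "nuclear_norm B \<le> nuclear_norm (transpose B)" for B :: "real^'x^'y"
  proof -
    obtain O1 where O1: "\<And>x. norm (O1 *v x) \<le> norm x" "nuclear_norm B = B \<bullet> O1" using nuclear_norm_attained by blast
    have "norm (transpose O1 *v x) \<le> 1 * norm x" for x
      by (rule matrix_bound_transpose) (simp add: O1)
    from inner_le_nuclear_norm[OF this, of "transpose B"] show ?thesis by (simp add: O1 inner_transpose)
  qed
  from this[of A] this[of "transpose A"] show ?thesis by simp
qed

lemma nuclear_norm_nonneg: "0 \<le> nuclear_norm A"
  using inner_le_nuclear_norm[of 0 1 A] by simp

lemma norm_le_of_vector_bound:
  fixes A :: "real^'n^'m"
  assumes "\<And>x. norm (A *v x) \<le> b * norm x"
  shows "norm A \<le> sqrt (CARD('n)) * b"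
proof -
  have col: "norm (A *v axis j 1) \<le> b" for j using assms[of "axis j 1"] by simp
  then have b: "0 \<le> b" by (rule order_trans[OF norm_ge_zero])
  have "(norm A)\<^sup>2 = (\<Sum>j\<in>UNIV. (norm (column j A))\<^sup>2)"
    unfolding power2_norm_eq_inner inner_matrix by (subst sum.swap) (simp add: inner_vec_def column_def)
  also have "\<dots> = (\<Sum>j\<in>UNIV. (norm (A *v axis j 1))\<^sup>2)" by (simp add: matrix_vector_mult_basis)
  also have "\<dots> \<le> (\<Sum>j\<in>(UNIV::'n set). b\<^sup>2)"
    by (intro sum_mono power_mono col) simp
  also have "\<dots> = (sqrt (CARD('n)) * b)\<^sup>2" by (simp add: power_mult_distrib)
  finally show ?thesis by (rule power2_le_imp_le) (simp add: b)
qed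

lemma continuous_on_nuclear_norm: "continuous_on UNIV (nuclear_norm :: real^'n^'m \<Rightarrow> real)"
proof -
  have le: "nuclear_norm A \<le> nuclear_norm B + sqrt (CARD('n)) * norm (A - B)" for A B :: "real^'n^'m"
  proof -
    obtain O1 where O1: "\<And>x. norm (O1 *v x) \<le> norm x" "nuclear_norm A = A \<bullet> O1" using nuclear_norm_attained by blast
    have "nuclear_norm A = B \<bullet> O1 + (A - B) \<bullet> O1" by (simp add: O1 inner_diff_left)
    moreover have "B \<bullet> O1 \<le> nuclear_norm B" using inner_le_nuclear_norm[of O1 1 B] O1 by simp
    moreover have "(A - B) \<bullet> O1 \<le> norm (A - B) * norm O1" by (rule norm_cauchy_schwarz)
    moreover have "norm O1 \<le> sqrt (CARD('n))" using norm_le_of_vector_bound[of O1 1] O1(1) by simp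
    ultimately show ?thesis
      by (smt (verit, best) mult.commute mult_right_mono norm_ge_zero)
  qed
  show ?thesis
  proof (rule lipschitz_on_continuous_on[OF lipschitz_onI])
    fix A B :: "real^'n^'m"
    show "dist (nuclear_norm A) (nuclear_norm B) \<le> sqrt (CARD('n)) * dist A B"
      using le[of A B] le[of B A] by (simp add: dist_norm norm_minus_commute abs_le_iff)
  qed simp
qed

subsection \<open>Interpolation between one-sided preconditioners\<close>

lemma norm_matrix_vector_le:
  fixes A :: "real^'n^'m"
  shows "norm (A *v v) \<le> norm A * norm v"
proof -
  have "norm (A *v v) = L2_set (\<lambda>i. \<bar>A $ i \<bullet> v\<bar>) UNIV"
    by (simp add: norm_vec_def matrix_vector_mul_component)
  also have "\<dots> \<le> L2_set (\<lambda>i. norm (A $ i) * norm v) UNIV"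
    by (intro L2_set_mono) (auto simp: Cauchy_Schwarz_ineq2)
  also have "\<dots> = norm A * norm v"
    by (simp add: norm_vec_def[of A] flip: L2_set_left_distrib)
  finally show ?thesis .
qed

definition interpolant :: "('m \<Rightarrow> real) \<Rightarrow> ('n \<Rightarrow> real) \<Rightarrow> real^'n^'m \<Rightarrow> real \<Rightarrow> real^'n^'m" where
  "interpolant l r N s = (\<chi> i j. l i powr (-s/2) * N $ i $ j * r j powr (-(1-s)/2))"

lemma interpolant_eq:
  "interpolant l r N s = diag_matrix (\<lambda>i. l i powr (-s/2)) ** N ** diag_matrix (\<lambda>j. r j powr (-(1-s)/2))"
  by (simp add: vec_eq_iff matrix_mul_diag interpolant_def)

text \<open>
  If \<open>v\<close> is a top right singular vector of the midpoint matrix, then \<open>r\<^sup>x v\<close> is for a suitable \<open>x\<close> an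
  eigenvector of \<open>B\<^sub>s\<^sup>T B\<^sub>t\<close> with the same eigenvalue.
\<close>

lemma interpolant_midpoint:
  fixes N :: "real^'n^'m"
  assumes l: "\<And>i. l i > 0" and r: "\<And>j. r j > 0"
  shows "(spectral_norm (interpolant l r N ((s + t) / 2)))\<^sup>2
           \<le> spectral_norm (interpolant l r N s) * spectral_norm (interpolant l r N t)"
proof -
  define m where "m = (s + t) / 2"
  define B where "B = interpolant l r N"
  define D where "D = diag_matrix (\<lambda>j. r j powr ((m - t) / 2))"
  obtain v where v: "v \<noteq> 0" "(transpose (B m) ** B m) *v v = (spectral_norm (B m))\<^sup>2 *\<^sub>R v"
    using spectral_norm_attained by blast
  define w where "w = D *v v"
  have "w \<noteq> 0"
  proof
    assume "w = 0"
    then have "\<forall>j. r j powr ((m - t) / 2) * v $ j = 0" by (simp add: w_def D_def vec_eq_iff)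
    then show False using v(1) r by (auto simp: vec_eq_iff powr_eq_0_iff) (metis less_irrefl)
  qed
  have "D ** (transpose (B m) ** B m) = transpose (B s) ** B t ** D"
  proof -
    have key: "r j powr ((m - t) / 2) * (l i powr (-m/2) * N$i$j * r j powr (-(1-m)/2) * (l i powr (-m/2) * N$i$k * r k powr (-(1-m)/2)))
        = l i powr (-s/2) * N$i$j * r j powr (-(1-s)/2) * (l i powr (-t/2) * N$i$k * r k powr (-(1-t)/2)) * r k powr ((m - t) / 2)" for i j k
    proof -
      have 1: "l i powr (-m/2) * l i powr (-m/2) = l i powr (-s/2) * l i powr (-t/2)"
        unfolding powr_add[symmetric] by (rule arg_cong[where f="(powr) _"]) (simp add: m_def field_simps)
      have 2: "r j powr ((m - t) / 2) * r j powr (-(1-m)/2) = r j powr (-(1-s)/2)"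
        unfolding powr_add[symmetric] by (rule arg_cong[where f="(powr) _"]) (simp add: m_def field_simps)
      have 3: "r k powr (-(1-m)/2) = r k powr (-(1-t)/2) * r k powr ((m - t) / 2)"
        unfolding powr_add[symmetric] by (rule arg_cong[where f="(powr) _"]) (simp add: m_def field_simps)
      have "r j powr ((m - t) / 2) * (l i powr (-m/2) * N$i$j * r j powr (-(1-m)/2) * (l i powr (-m/2) * N$i$k * r k powr (-(1-m)/2)))
          = (r j powr ((m - t) / 2) * r j powr (-(1-m)/2)) * (l i powr (-m/2) * l i powr (-m/2)) * N$i$j * N$i$k * r k powr (-(1-m)/2)"
        by (simp only: mult_ac)
      then show ?thesis unfolding 1 2 3 by (simp only: mult_ac)
    qed
    then have "(D ** (transpose (B m) ** B m)) $ j $ k = (transpose (B s) ** B t ** D) $ j $ k" for j k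
      by (simp only: D_def matrix_mul_diag)
         (simp only: matrix_matrix_mult_def transpose_def B_def interpolant_def vec_lambda_beta
           sum_distrib_left sum_distrib_right key)
    then show ?thesis by (simp add: vec_eq_iff)
  qed
  then have "transpose (B s) *v (B t *v w) = (spectral_norm (B m))\<^sup>2 *\<^sub>R w"
    by (metis matrix_vector_mul_assoc matrix_vector_mult_scaleR v(2) w_def)
  then have "(spectral_norm (B m))\<^sup>2 * norm w = norm (transpose (B s) *v (B t *v w))" by simp
  also have "\<dots> \<le> spectral_norm (B s) * norm (B t *v w)"
    by (rule matrix_bound_transpose[OF spectral_norm_bound])
  also have "\<dots> \<le> spectral_norm (B s) * (spectral_norm (B t) * norm w)"
    by (intro mult_left_mono spectral_norm_bound spectral_norm_nonneg)
  finally show ?thesis using \<open>w \<noteq> 0\<close> by (simp add: B_def m_def flip: mult.assoc)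
qed

text \<open>
  The supremum \<open>C\<close> of the midpoint-logarithmically convex function over the unit interval satisfies
  \<open>C\<^sup>2 \<le> c C\<close>, because every point is the midpoint of an endpoint and another point.
\<close>

lemma interpolant_bound:
  fixes N :: "real^'n^'m"
  assumes l: "\<And>i. l i > 0" and r: "\<And>j. r j > 0"
    and c0: "spectral_norm (interpolant l r N 0) \<le> c" and c1: "spectral_norm (interpolant l r N 1) \<le> c"
    and s: "s \<in> {0..1}"
  shows "spectral_norm (interpolant l r N s) \<le> c"
proof -
  define g where "g s = spectral_norm (interpolant l r N s)" for s
  have "c \<ge> 0" using c0 spectral_norm_nonneg order_trans by blast
  have "continuous_on {0..1} (interpolant l r N)"
    unfolding interpolant_def
    by (intro continuous_intros) (simp_all add: less_imp_neq[OF l, symmetric] less_imp_neq[OF r, symmetric])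
  then have "compact (interpolant l r N ` {0..1})" by (intro compact_continuous_image) auto
  then obtain b where b: "\<And>s. s \<in> {0..1} \<Longrightarrow> norm (interpolant l r N s) \<le> b"
    by (meson bounded_iff compact_imp_bounded imageI)
  have gb: "g s \<le> b" if "s \<in> {0..1}" for s
    unfolding g_def by (rule order_trans[OF spectral_norm_le[OF norm_matrix_vector_le] b[OF that]])
  have bdd: "bdd_above (g ` {0..1})" by (rule bdd_aboveI2) (rule gb)
  define C where "C = (SUP s\<in>{0..1}. g s)"
  have gC: "g s \<le> C" if "s \<in> {0..1}" for s unfolding C_def by (rule cSUP_upper[OF that bdd])
  have g0: "g s \<ge> 0" for s by (simp add: g_def spectral_norm_nonneg)
  have C0: "C \<ge> 0" using gC[of 0] g0[of 0] by simp
  have "g s \<le> sqrt (c * C)" if s: "s \<in> {0..1}" for s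
  proof -
    have "(g s)\<^sup>2 \<le> c * C"
    proof (cases "s \<le> 1/2")
      case True
      have "(g s)\<^sup>2 \<le> g 0 * g (2 * s)" using interpolant_midpoint[OF l r, where N=N and s=0 and t="2 * s"] by (simp add: g_def)
      also have "\<dots> \<le> c * C" using True s c0 g0 \<open>c \<ge> 0\<close> by (intro mult_mono gC) (auto simp: g_def)
      finally show ?thesis .
    next
      case False
      have "(g s)\<^sup>2 \<le> g 1 * g (2 * s - 1)" using interpolant_midpoint[OF l r, where N=N and s=1 and t="2 * s - 1"] by (simp add: g_def)
      also have "\<dots> \<le> c * C" using False s c1 g0 \<open>c \<ge> 0\<close> by (intro mult_mono gC) (auto simp: g_def)
      finally show ?thesis .
    qed
    then show ?thesis by (simp add: real_le_rsqrt)
  qed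
  then have "C \<le> sqrt (c * C)" unfolding C_def by (intro cSUP_least) auto
  then have "C\<^sup>2 \<le> c * C" using C0 by (metis \<open>0 \<le> c\<close> mult_nonneg_nonneg real_sqrt_pow2 power_mono)
  then have "C \<le> c" using C0 \<open>c \<ge> 0\<close> by (cases "C = 0") (auto simp: power2_eq_square)
  then show ?thesis using gC[OF s] by (simp add: g_def)
qed

lemma conj_diag_sandwich:
  "transpose Q ** (conj_diag Q d ** M ** conj_diag V e) ** V = diag_matrix d ** (transpose Q ** M ** V) ** diag_matrix e"
  if Q: "orthogonal_matrix Q" and V: "orthogonal_matrix V"
proof -
  have "transpose Q ** (conj_diag Q d ** M ** conj_diag V e) ** V =
      (transpose Q ** Q) ** diag_matrix d ** transpose Q ** M ** V ** diag_matrix e ** (transpose V ** V)"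
    by (simp add: matrix_mul_assoc)
  then show ?thesis by (simp add: orthogonal_matrixD[OF Q] orthogonal_matrixD[OF V] matrix_mul_assoc)
qed

lemma preconditioned_spectral_norm_le:
  fixes M :: "real^'n^'m"
  assumes e: "e > 0" and Le: "e *\<^sub>R mat 1 \<preceq>\<^sub>L Lp" and Re: "e *\<^sub>R mat 1 \<preceq>\<^sub>L Rp"
    and left_bound: "\<And>u. (norm (transpose M *v u))\<^sup>2 \<le> c\<^sup>2 * (u \<bullet> (Lp *v u))"
    and right_bound: "\<And>v. (norm (M *v v))\<^sup>2 \<le> c\<^sup>2 * (v \<bullet> (Rp *v v))"
    and s: "0 \<le> s" "0 \<le> t" "s + t = 1" and c: "c \<ge> 0"
  shows "norm ((matrix_powr Lp (-s/2) ** M ** matrix_powr Rp (-t/2)) *v x) \<le> c * norm x"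
proof -
  obtain Q l where Q: "orthogonal_matrix Q" and L: "Lp = conj_diag Q l" and l: "\<And>i. e \<le> l i"
    using loewner_ge_diagonalization[OF Le] by blast
  obtain V r where V: "orthogonal_matrix V" and R: "Rp = conj_diag V r" and r: "\<And>i. e \<le> r i"
    using loewner_ge_diagonalization[OF Re] by blast
  have lp: "l i > 0" and rp: "r j > 0" for i j using e l[of i] r[of j] by auto
  define N where "N = transpose Q ** M ** V"
  have half: "y * (y powr (-1/2) * z)\<^sup>2 = z\<^sup>2" if "y > 0" for y z :: real
  proof -
    have "y * (y powr (-1/2))\<^sup>2 = y powr 1 * (y powr (-1/2) * y powr (-1/2))" using that by (simp add: power2_eq_square)
    also have "\<dots> = 1" unfolding powr_add[symmetric] using that by simp
    finally show ?thesis by (simp add: power_mult_distrib flip: mult.assoc)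
  qed
  have c0: "spectral_norm (interpolant l r N 0) \<le> c"
  proof (rule spectral_norm_le)
    fix v
    let ?x = "V *v (diag_matrix (\<lambda>j. r j powr (-1/2)) *v v)"
    have "interpolant l r N 0 = N ** diag_matrix (\<lambda>j. r j powr (-1/2))"
      using lp by (simp add: interpolant_def vec_eq_iff matrix_mul_diag less_imp_neq[OF lp, symmetric] less_imp_neq[OF rp, symmetric])
    then have "interpolant l r N 0 *v v = transpose Q *v (M *v ?x)"
      by (simp add: N_def matrix_vector_mul_assoc matrix_mul_assoc)
    then have "(norm (interpolant l r N 0 *v v))\<^sup>2 = (norm (M *v ?x))\<^sup>2" by (simp add: orthogonal_matrix_norm[OF Q])
    also have "\<dots> \<le> c\<^sup>2 * (?x \<bullet> (Rp *v ?x))" by (rule right_bound)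
    also have "?x \<bullet> (Rp *v ?x) = (norm v)\<^sup>2"
      unfolding R conj_diag_quadratic_form matrix_vector_mul_assoc[of "transpose V"] orthogonal_matrixD[OF V]
      by (simp only: matrix_vector_mul_lid diag_matrix_vector half[OF rp] power2_norm_eq_inner inner_vec_def) (simp add: power2_eq_square)
    finally have "(norm (interpolant l r N 0 *v v))\<^sup>2 \<le> (c * norm v)\<^sup>2" by (simp add: power_mult_distrib)
    then show "norm (interpolant l r N 0 *v v) \<le> c * norm v" by (rule power2_le_imp_le) (simp add: c)
  qed
  have c1: "spectral_norm (interpolant l r N 1) \<le> c"
  proof (rule spectral_norm_le)
    fix v
    define B where "B = interpolant l r N 1"
    have "norm (transpose B *v u) \<le> c * norm u" for u
    proof -
      let ?x = "Q *v (diag_matrix (\<lambda>j. l j powr (-1/2)) *v u)"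
      have "transpose B = transpose N ** diag_matrix (\<lambda>j. l j powr (-1/2))"
        using rp by (simp add: B_def interpolant_def vec_eq_iff matrix_mul_diag transpose_def less_imp_neq[OF lp, symmetric] less_imp_neq[OF rp, symmetric])
      moreover have "transpose N = transpose V ** transpose M ** Q"
        by (simp add: N_def matrix_transpose_mul matrix_mul_assoc)
      ultimately have "transpose B *v u = transpose V *v (transpose M *v ?x)"
        by (simp add: matrix_vector_mul_assoc matrix_mul_assoc)
      then have "(norm (transpose B *v u))\<^sup>2 = (norm (transpose M *v ?x))\<^sup>2" by (simp add: orthogonal_matrix_norm[OF V])
      also have "\<dots> \<le> c\<^sup>2 * (?x \<bullet> (Lp *v ?x))" by (rule left_bound)
      also have "?x \<bullet> (Lp *v ?x) = (norm u)\<^sup>2"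
        unfolding L conj_diag_quadratic_form matrix_vector_mul_assoc[of "transpose Q"] orthogonal_matrixD[OF Q]
        by (simp only: matrix_vector_mul_lid diag_matrix_vector half[OF lp] power2_norm_eq_inner inner_vec_def) (simp add: power2_eq_square)
      finally have "(norm (transpose B *v u))\<^sup>2 \<le> (c * norm u)\<^sup>2" by (simp add: power_mult_distrib)
      then show ?thesis by (rule power2_le_imp_le) (simp add: c)
    qed
    from matrix_bound_transpose[OF this] show "norm (interpolant l r N 1 *v v) \<le> c * norm v" by (simp add: B_def)
  qed
  let ?U = "matrix_powr Lp (-s/2) ** M ** matrix_powr Rp (-t/2)"
  have "transpose Q ** ?U ** V = interpolant l r N s"
  proof -
    have t: "t = 1 - s" using s by simp
    show ?thesis
      by (simp only: L R t matrix_powr_conj_diag[OF Q] matrix_powr_conj_diag[OF V] conj_diag_sandwich[OF Q V] N_def interpolant_eq)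
  qed
  then have "?U = Q ** interpolant l r N s ** transpose V"
    by (metis matrix_mul_assoc orthogonal_cancel(2)[OF Q] orthogonal_cancel(4)[OF V])
  then have "norm (?U *v x) = norm (interpolant l r N s *v (transpose V *v x))"
    by (simp add: orthogonal_matrix_norm[OF Q] flip: matrix_vector_mul_assoc)
  also have "\<dots> \<le> c * norm (transpose V *v x)"
  proof -
    have "spectral_norm (interpolant l r N s) \<le> c"
      by (rule interpolant_bound[OF lp rp c0 c1]) (use s in auto)
    then show ?thesis by (meson norm_ge_zero mult_right_mono order_trans spectral_norm_bound)
  qed
  finally show ?thesis by (simp add: orthogonal_matrix_norm[OF V])
qed

subsection \<open>One preconditioned step\<close>

lemma weighted_contraction_bound:
  fixes O1 :: "real^'n^'m"
  assumes l: "\<And>i. l i > 0" and r: "\<And>j. r j > 0" and s: "0 \<le> s" "0 \<le> t" "s + t = 1"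
    and O1: "\<And>x. norm (O1 *v x) \<le> b * norm x"
  shows "(\<Sum>i\<in>UNIV. \<Sum>j\<in>UNIV. l i powr (s/2) * r j powr (t/2) * (O1$i$j)\<^sup>2)
         \<le> b\<^sup>2 * (s * (\<Sum>i\<in>UNIV. l i powr (1/2)) + t * (\<Sum>j\<in>UNIV. r j powr (1/2)))"
proof -
  have col: "(\<Sum>i\<in>UNIV. (B$i$j)\<^sup>2) \<le> b\<^sup>2" if "\<And>x. norm (B *v x) \<le> b * norm x" for B :: "real^'x^'y" and j
  proof -
    have "(\<Sum>i\<in>UNIV. (B$i$j)\<^sup>2) = (norm (B *v axis j 1))\<^sup>2"
      unfolding matrix_vector_mult_basis power2_norm_eq_inner inner_vec_def by (simp add: column_def power2_eq_square)
    also have "\<dots> \<le> (b * 1)\<^sup>2" using that[of "axis j 1"] by (intro power_mono) auto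
    finally show ?thesis by simp
  qed
  have row: "(\<Sum>j\<in>UNIV. (O1$i$j)\<^sup>2) \<le> b\<^sup>2" for i
    using col[of "transpose O1" i] matrix_bound_transpose[OF O1] by (simp add: transpose_def)
  have young: "l i powr (s/2) * r j powr (t/2) \<le> s * l i powr (1/2) + t * r j powr (1/2)" for i j
    using Youngs_inequality_0[of s t "l i powr (1/2)" "r j powr (1/2)"] s
    by (simp add: powr_powr less_imp_neq[OF l, symmetric] less_imp_neq[OF r, symmetric])
  have "(\<Sum>i\<in>UNIV. \<Sum>j\<in>UNIV. l i powr (s/2) * r j powr (t/2) * (O1$i$j)\<^sup>2)
      \<le> (\<Sum>i\<in>UNIV. \<Sum>j\<in>UNIV. (s * l i powr (1/2) + t * r j powr (1/2)) * (O1$i$j)\<^sup>2)"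
    by (intro sum_mono mult_right_mono young) auto
  also have "\<dots> = (\<Sum>i\<in>UNIV. \<Sum>j\<in>UNIV. s * l i powr (1/2) * (O1$i$j)\<^sup>2) + (\<Sum>i\<in>UNIV. \<Sum>j\<in>UNIV. t * r j powr (1/2) * (O1$i$j)\<^sup>2)"
    by (simp add: distrib_right sum.distrib)
  also have "(\<Sum>i\<in>UNIV. \<Sum>j\<in>UNIV. t * r j powr (1/2) * (O1$i$j)\<^sup>2) = (\<Sum>j\<in>UNIV. \<Sum>i\<in>UNIV. t * r j powr (1/2) * (O1$i$j)\<^sup>2)"
    by (rule sum.swap)
  also have "(\<Sum>i\<in>UNIV. \<Sum>j\<in>UNIV. s * l i powr (1/2) * (O1$i$j)\<^sup>2) + (\<Sum>j\<in>UNIV. \<Sum>i\<in>UNIV. t * r j powr (1/2) * (O1$i$j)\<^sup>2)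
     \<le> (\<Sum>i\<in>UNIV. s * l i powr (1/2) * b\<^sup>2) + (\<Sum>j\<in>UNIV. t * r j powr (1/2) * b\<^sup>2)"
    unfolding sum_distrib_left[symmetric] using s
    by (intro add_mono sum_mono mult_left_mono row col O1) auto
  also have "\<dots> = b\<^sup>2 * (s * (\<Sum>i\<in>UNIV. l i powr (1/2)) + t * (\<Sum>j\<in>UNIV. r j powr (1/2)))"
    by (simp add: sum_distrib_left sum_distrib_right algebra_simps)
  finally show ?thesis .
qed

lemma trace_conj_diag:
  assumes Q: "orthogonal_matrix Q"
  shows "trace (conj_diag Q d) = (\<Sum>i\<in>UNIV. d i)"
proof -
  have "trace (conj_diag Q d) = trace (diag_matrix d ** (transpose Q ** Q))"
    by (subst matrix_mul_assoc[symmetric], subst trace_mul_sym) (simp add: matrix_mul_assoc)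
  then show ?thesis by (simp add: orthogonal_matrixD[OF Q] trace_def diag_matrix_def)
qed

text \<open>
  The scalar estimate behind one step: with preconditioner entry \<open>c\<close> and \<open>k = 1 / c\<close>, complete the
  square in \<open>-g (c M + \<lambda> X)\<close>; \<open>O\<close> are the entries of the contraction that attains the nuclear norm.
\<close>

lemma scalar_step:
  fixes c k g M X lam x e o1 :: real
  assumes ck: "c * k = 1" and c: "c > 0" and e: "e > 0" "c \<le> 1 / e"
  shows "- (g * (c * M + lam * X)) \<le> - x * (g * o1) + x\<^sup>2 / 2 * (k * o1\<^sup>2) + lam\<^sup>2 * (k * X\<^sup>2)
           - e / 2 * (c * M + lam * X)\<^sup>2 + (g - M)\<^sup>2 / e"
proof -
  define u where "u = c * M + lam * X"
  have k: "k = 1 / c" using ck c by (simp add: field_simps)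
  have ke: "e \<le> k" using e c by (simp add: k field_simps)
  have 1: "(g - M)\<^sup>2 * c \<le> (g - M)\<^sup>2 / e" using mult_left_mono[OF e(2), of "(g - M)\<^sup>2"] by simp
  have 2: "e * u\<^sup>2 \<le> k * u\<^sup>2" using ke by (rule mult_right_mono) simp
  have 3: "0 \<le> c * (g - x * k * o1)\<^sup>2" using c by simp
  have 4: "0 \<le> c * (g - M + lam * k * X)\<^sup>2" using c by simp
  have 5: "c * (g - x * k * o1)\<^sup>2 = c * g\<^sup>2 - 2 * x * (g * o1) + x\<^sup>2 * (k * o1\<^sup>2)"
    using c by (simp add: k power2_eq_square field_simps)
  have 6: "c * (g - M + lam * k * X)\<^sup>2 = 2 * ((g - M)\<^sup>2 * c) + 2 * (lam\<^sup>2 * (k * X\<^sup>2)) - (c * g\<^sup>2 - 2 * g * u + k * u\<^sup>2)"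
    using c by (simp add: k u_def power2_eq_square field_simps)
  show ?thesis unfolding u_def[symmetric] using 1 2 3 4 unfolding 5 6 by linarith
qed

lemma preconditioned_step:
  fixes g M X :: "real^'n^'m"
  assumes e: "e > 0" and Le: "e *\<^sub>R mat 1 \<preceq>\<^sub>L Lp" and Re: "e *\<^sub>R mat 1 \<preceq>\<^sub>L Rp"
    and s: "0 \<le> s" "0 \<le> t" "s + t = 1"
    and X: "\<And>v. norm (X *v v) \<le> b * norm v"
    and U: "U = matrix_powr Lp (-s/2) ** M ** matrix_powr Rp (-t/2) + lam *\<^sub>R X"
    and T: "T = s * trace (matrix_powr Lp (1/2)) + t * trace (matrix_powr Rp (1/2))"
  shows "- (g \<bullet> U) \<le> - x * nuclear_norm g + (x\<^sup>2 / 2 + lam\<^sup>2 * b\<^sup>2) * T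
           - sqrt e / 2 * (norm U)\<^sup>2 + (norm (g - M))\<^sup>2 / sqrt e"
proof -
  obtain Q l where Q: "orthogonal_matrix Q" and L: "Lp = conj_diag Q l" and l: "\<And>i. e \<le> l i"
    using loewner_ge_diagonalization[OF Le] by blast
  obtain V r where V: "orthogonal_matrix V" and R: "Rp = conj_diag V r" and r: "\<And>i. e \<le> r i"
    using loewner_ge_diagonalization[OF Re] by blast
  have lp: "l i > 0" and rp: "r j > 0" for i j using e l[of i] r[of j] by auto
  obtain O1 where O1: "\<And>x. norm (O1 *v x) \<le> norm x" "nuclear_norm g = g \<bullet> O1" using nuclear_norm_attained by blast
  define C where "C Z = transpose Q ** Z ** V" for Z :: "real^'n^'m"
  have C_inner: "C Y \<bullet> C Z = Y \<bullet> Z" for Y Z by (simp add: C_def inner_orthogonal_conj[OF Q V])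
  have C_lin: "C (Y + Z) = C Y + C Z" "C (Y - Z) = C Y - C Z" "C (a *\<^sub>R Z) = a *\<^sub>R C Z" for Y Z a
    by (simp_all add: C_def vec_eq_iff matrix_matrix_mult_def distrib_left distrib_right left_diff_distrib
        right_diff_distrib sum.distrib sum_subtractf sum_distrib_left mult_ac)
  have C_bound: "norm (C Z *v v) \<le> a * norm v" if "\<And>v. norm (Z *v v) \<le> a * norm v" for Z a v
  proof -
    have "norm (C Z *v v) = norm (Z *v (V *v v))"
      by (simp add: C_def orthogonal_matrix_norm[OF Q] flip: matrix_vector_mul_assoc)
    also have "\<dots> \<le> a * norm v" using that[of "V *v v"] by (simp add: orthogonal_matrix_norm[OF V])
    finally show ?thesis .
  qed
  have norm2: "(norm Z)\<^sup>2 = (\<Sum>i\<in>UNIV. \<Sum>j\<in>UNIV. (C Z$i$j)\<^sup>2)" for Z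
  proof -
    have "(norm Z)\<^sup>2 = C Z \<bullet> C Z" by (simp only: C_inner power2_norm_eq_inner)
    then show ?thesis unfolding inner_matrix by (simp add: power2_eq_square)
  qed
  have inner: "Y \<bullet> Z = (\<Sum>i\<in>UNIV. \<Sum>j\<in>UNIV. C Y$i$j * C Z$i$j)" for Y Z
    using C_inner[of Y Z] unfolding inner_matrix by simp
  define c where "c i j = l i powr (-s/2) * r j powr (-t/2)" for i j
  define k where "k i j = l i powr (s/2) * r j powr (t/2)" for i j
  have ck: "c i j * k i j = 1" for i j
  proof -
    have "c i j * k i j = (l i powr (-s/2) * l i powr (s/2)) * (r j powr (-t/2) * r j powr (t/2))"
      by (simp add: c_def k_def mult_ac)
    then show ?thesis using lp rp by (simp add: less_imp_neq[OF lp, symmetric] less_imp_neq[OF rp, symmetric] flip: powr_add)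
  qed
  have cpos: "c i j > 0" for i j using lp rp by (simp add: c_def less_imp_neq[OF lp, symmetric] less_imp_neq[OF rp, symmetric])
  have ce: "c i j \<le> 1 / sqrt e" for i j
  proof -
    have "c i j \<le> e powr (-s/2) * e powr (-t/2)"
      unfolding c_def using l r e s by (intro mult_mono powr_mono2') auto
    also have "\<dots> = e powr (-s/2 + -t/2)" by (rule powr_add[symmetric])
    also have "-s/2 + -t/2 = -1/2" using s by simp
    also have "e powr (-1/2) = 1 / sqrt e"
      using e powr_minus_divide[of e "1/2"] by (simp add: powr_half_sqrt)
    finally show ?thesis .
  qed
  have CU: "C U $ i $ j = c i j * C M $ i $ j + lam * C X $ i $ j" for i j
  proof -
    have "C (matrix_powr Lp (-s/2) ** M ** matrix_powr Rp (-t/2)) $ i $ j = c i j * C M $ i $ j"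
      unfolding L R matrix_powr_conj_diag[OF Q] matrix_powr_conj_diag[OF V] C_def conj_diag_sandwich[OF Q V]
      by (simp add: matrix_mul_diag c_def)
    then show ?thesis by (simp add: U C_lin)
  qed
  have Teq: "T = s * (\<Sum>i\<in>UNIV. l i powr (1/2)) + t * (\<Sum>j\<in>UNIV. r j powr (1/2))"
    unfolding T L R matrix_powr_conj_diag[OF Q] matrix_powr_conj_diag[OF V] trace_conj_diag[OF Q] trace_conj_diag[OF V] ..
  have wX: "(\<Sum>i\<in>UNIV. \<Sum>j\<in>UNIV. k i j * (C X$i$j)\<^sup>2) \<le> b\<^sup>2 * T"
    unfolding k_def Teq by (rule weighted_contraction_bound[OF lp rp s C_bound[OF X]])
  have wO: "(\<Sum>i\<in>UNIV. \<Sum>j\<in>UNIV. k i j * (C O1$i$j)\<^sup>2) \<le> T"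
  proof -
    have "norm (C O1 *v v) \<le> 1 * norm v" for v by (rule C_bound) (simp add: O1(1))
    from weighted_contraction_bound[OF lp rp s this] show ?thesis unfolding k_def Teq by simp
  qed
  have "- (g \<bullet> U) = (\<Sum>i\<in>UNIV. \<Sum>j\<in>UNIV. - (C g$i$j * (c i j * C M$i$j + lam * C X$i$j)))"
    unfolding inner CU by (simp add: sum_negf)
  also have "\<dots> \<le> (\<Sum>i\<in>UNIV. \<Sum>j\<in>UNIV. - x * (C g$i$j * C O1$i$j) + x\<^sup>2 / 2 * (k i j * (C O1$i$j)\<^sup>2)
      + lam\<^sup>2 * (k i j * (C X$i$j)\<^sup>2) - sqrt e / 2 * (c i j * C M$i$j + lam * C X$i$j)\<^sup>2 + (C g$i$j - C M$i$j)\<^sup>2 / sqrt e)"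
    using e by (intro sum_mono scalar_step ck cpos ce) auto
  also have "\<dots> = - x * (g \<bullet> O1) + x\<^sup>2 / 2 * (\<Sum>i\<in>UNIV. \<Sum>j\<in>UNIV. k i j * (C O1$i$j)\<^sup>2)
      + lam\<^sup>2 * (\<Sum>i\<in>UNIV. \<Sum>j\<in>UNIV. k i j * (C X$i$j)\<^sup>2) - sqrt e / 2 * (norm U)\<^sup>2 + (norm (g - M))\<^sup>2 / sqrt e"
    unfolding inner norm2 CU C_lin
    by (simp add: sum.distrib sum_subtractf sum_distrib_left sum_divide_distrib sum_negf)
  also have "\<dots> \<le> - x * (g \<bullet> O1) + x\<^sup>2 / 2 * T + lam\<^sup>2 * (b\<^sup>2 * T) - sqrt e / 2 * (norm U)\<^sup>2 + (norm (g - M))\<^sup>2 / sqrt e"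
    using wX wO by (intro add_mono diff_mono mult_left_mono order_refl) auto
  finally show ?thesis by (simp add: O1(2) algebra_simps)
qed

subsection \<open>The trace of the square root of an accumulated preconditioner\<close>

lemma trace_nonneg_psd:
  assumes "psd A"
  shows "0 \<le> trace A"
proof -
  have "0 \<le> A $ i $ i" for i
  proof -
    have "0 \<le> axis i 1 \<bullet> (A *v axis i 1)" using assms by (simp add: psd_def)
    then show ?thesis by (simp add: matrix_vector_mult_basis inner_axis' column_def)
  qed
  then show ?thesis by (simp add: trace_def sum_nonneg)
qed

lemma matrix_sum_mul:
  fixes A :: "'b \<Rightarrow> real^'n^'m"
  shows "(\<Sum>i\<in>I. A i) *v x = (\<Sum>i\<in>I. A i *v x)"
  by (induction I rule: infinite_finite_induct) (simp_all add: matrix_vector_mult_add_rdistrib)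

lemma trace_sqrt_accumulated_le:
  fixes G :: "'b \<Rightarrow> real^'n^'m"
  assumes I: "finite I" and w: "\<And>i. i \<in> I \<Longrightarrow> 0 \<le> w i" and e: "e > 0" and y: "y > 0"
    and S: "S = (\<Sum>i\<in>I. w i *\<^sub>R (G i ** transpose (G i))) + e *\<^sub>R mat 1"
  shows "trace (matrix_powr S (1/2)) \<le> (\<Sum>i\<in>I. sqrt (w i) * nuclear_norm (g i)) + sqrt (CARD('m)) * y / 2
      + sqrt (CARD('m)) / (2 * y) * (\<Sum>i\<in>I. w i * (norm (G i - g i))\<^sup>2) + CARD('m) * sqrt e"
proof -
  have quad: "u \<bullet> (S *v u) = (\<Sum>i\<in>I. w i * (norm (transpose (G i) *v u))\<^sup>2) + e * (norm u)\<^sup>2" for u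
  proof -
    have "(norm (transpose (G i) *v u))\<^sup>2 = u \<bullet> ((G i ** transpose (G i)) *v u)" for i
      by (simp add: norm_matrix_vector_square)
    then show ?thesis
      unfolding S by (simp add: matrix_vector_mult_add_rdistrib matrix_sum_mul inner_add_right inner_sum_right
        scaleR_matrix_vector_assoc[symmetric] dot_square_norm)
  qed
  have "transpose S = S"
  proof -
    have "transpose (\<Sum>i\<in>I. w i *\<^sub>R (G i ** transpose (G i))) = (\<Sum>i\<in>I. w i *\<^sub>R (G i ** transpose (G i)))"
      by (induction I rule: infinite_finite_induct) (simp_all add: transpose_simps matrix_transpose_mul)
    then show ?thesis by (simp add: S transpose_simps)
  qed
  then have Se: "e *\<^sub>R mat 1 \<preceq>\<^sub>L S"
    using w by (auto simp: loewner_le_def psd_def transpose_simps matrix_vector_mult_diff_rdistrib inner_diff_right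
       quad scaleR_matrix_vector_assoc[symmetric] power2_norm_eq_inner intro!: sum_nonneg)
  then obtain Q d where Q: "orthogonal_matrix Q" and Sd: "S = conj_diag Q d" and d: "\<And>i. e \<le> d i"
    using loewner_ge_diagonalization by blast
  have dp: "d i > 0" for i using e d[of i] by simp
  define P where "P = matrix_powr S (-1/2)"
  have P: "P = conj_diag Q (\<lambda>i. d i powr (-1/2))" unfolding P_def Sd by (rule matrix_powr_conj_diag[OF Q])
  have Psym: "transpose P = P" by (simp add: P)
  have pw: "d i powr (-1/2) * d i = d i powr (1/2)" "d i powr (-1/2) * d i * d i powr (-1/2) = 1" for i
  proof -
    show 1: "d i powr (-1/2) * d i = d i powr (1/2)"
      using dp[of i] powr_add[of "d i" "-1/2" 1] by simp
    show "d i powr (-1/2) * d i * d i powr (-1/2) = 1"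
      unfolding 1 using dp[of i] by (simp flip: powr_add)
  qed
  have PSP: "P ** S ** P = mat 1"
    unfolding P Sd conj_diag_mul[OF Q] by (subst pw(2)) (rule conj_diag_one[OF Q])
  have half: "trace (matrix_powr S (1/2)) = P \<bullet> S"
  proof -
    have "P \<bullet> S = trace (P ** S)" unfolding trace_eq_inner using inner_matrix_mul_left[of P S "mat 1"] by (simp add: Psym inner_commute)
    also have "P ** S = matrix_powr S (1/2)"
      unfolding P Sd conj_diag_mul[OF Q] pw matrix_powr_conj_diag[OF Q] ..
    finally show ?thesis by simp
  qed
  have Pe: "e * (P \<bullet> mat 1) \<le> CARD('m) * sqrt e"
  proof -
    have "P \<bullet> mat 1 = (\<Sum>i\<in>UNIV. d i powr (-1/2))" by (simp add: P trace_conj_diag[OF Q] flip: trace_eq_inner)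
    also have "\<dots> \<le> (\<Sum>i\<in>(UNIV :: 'm set). e powr (-1/2))" using d e by (intro sum_mono powr_mono2') auto
    finally have "e * (P \<bullet> mat 1) \<le> e * (CARD('m) * e powr (-1/2))" using e by simp
    also have "\<dots> = CARD('m) * sqrt e"
      using e powr_add[of e "-1/2" 1] by (simp add: powr_half_sqrt mult_ac)
    finally show ?thesis .
  qed
  have Pinner: "P \<bullet> S = (\<Sum>i\<in>I. w i * ((P ** G i) \<bullet> G i)) + e * (P \<bullet> mat 1)"
    unfolding S inner_add_right inner_sum_right by (simp add: inner_matrix_mul_right)
  have PG: "(\<Sum>i\<in>I. w i * (norm (P ** G i))\<^sup>2) \<le> CARD('m)"
  proof -
    have "(norm (P ** G i))\<^sup>2 = (P ** P) \<bullet> (G i ** transpose (G i))" for i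
      unfolding power2_norm_eq_inner inner_matrix_mul_left[of P "G i"] Psym
      by (metis inner_commute inner_matrix_mul_right matrix_mul_assoc)
    then have "(P ** P) \<bullet> S = (\<Sum>i\<in>I. w i * (norm (P ** G i))\<^sup>2) + e * ((P ** P) \<bullet> mat 1)"
      unfolding S inner_add_right inner_sum_right by simp
    moreover have "(P ** P) \<bullet> S = CARD('m)"
    proof -
      have "(P ** P) \<bullet> S = mat 1 \<bullet> (P ** S ** P)"
        using inner_matrix_mul_left[of P P S] inner_matrix_mul_right[of "mat 1" P "P ** S"] by (simp add: Psym)
      moreover have "(mat 1 :: real^'m^'m) \<bullet> mat 1 = CARD('m)"
        unfolding trace_eq_inner[symmetric] by (simp add: trace_def mat_def)
      ultimately show ?thesis unfolding PSP by simp
    qed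
    moreover have "(P ** P) \<bullet> mat 1 \<ge> 0"
      using inner_matrix_mul_left[of P P "mat 1"] by (simp add: Psym)
    ultimately show ?thesis using e by (smt (verit) mult_nonneg_nonneg)
  qed
  have summand: "w i * ((P ** G i) \<bullet> G i) \<le> sqrt (w i) * nuclear_norm (g i)
      + y / (2 * sqrt (CARD('m))) * (w i * (norm (P ** G i))\<^sup>2) + sqrt (CARD('m)) / (2 * y) * (w i * (norm (G i - g i))\<^sup>2)"
    if "i \<in> I" for i
  proof -
    have split: "(P ** G i) \<bullet> G i = (P ** G i) \<bullet> g i + (P ** G i) \<bullet> (G i - g i)" by (simp add: inner_diff_right)
    have "norm ((sqrt (w i) *\<^sub>R (P ** G i)) *v v) \<le> 1 * norm v" for v
    proof -
      have "norm (transpose (sqrt (w i) *\<^sub>R (P ** G i)) *v u) \<le> 1 * norm u" for u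
      proof -
        have "transpose (sqrt (w i) *\<^sub>R (P ** G i)) *v u = sqrt (w i) *\<^sub>R (transpose (G i) *v (P *v u))"
          by (simp add: transpose_simps matrix_transpose_mul Psym matrix_vector_mul_assoc scaleR_matrix_vector_assoc[symmetric])
        then have "(norm (transpose (sqrt (w i) *\<^sub>R (P ** G i)) *v u))\<^sup>2 = w i * (norm (transpose (G i) *v (P *v u)))\<^sup>2"
          using w[OF that] by (simp add: power_mult_distrib)
        also have "\<dots> \<le> (\<Sum>i\<in>I. w i * (norm (transpose (G i) *v (P *v u)))\<^sup>2)"
          using that I w by (intro member_le_sum) auto
        also have "\<dots> \<le> (P *v u) \<bullet> (S *v (P *v u))" unfolding quad using e by simp
        also have "\<dots> = u \<bullet> ((P ** S ** P) *v u)"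
          by (metis Psym matrix_vector_mul_assoc transpose_vector_inner)
        also have "\<dots> = (norm u)\<^sup>2" by (simp add: PSP power2_norm_eq_inner)
        finally show ?thesis by simp
      qed
      from matrix_bound_transpose[OF this] show ?thesis by simp
    qed
    from inner_le_nuclear_norm[OF this, of "g i"] have 1: "sqrt (w i) * ((P ** G i) \<bullet> g i) \<le> nuclear_norm (g i)"
      by (simp add: inner_commute)
    have 1: "w i * ((P ** G i) \<bullet> g i) \<le> sqrt (w i) * nuclear_norm (g i)"
      using mult_left_mono[OF 1, of "sqrt (w i)"] w[OF that] by (simp flip: mult.assoc)
    define z where "z = y / sqrt (CARD('m))"
    have z: "z > 0" using y by (simp add: z_def)
    have "(P ** G i) \<bullet> (G i - g i) \<le> norm (P ** G i) * norm (G i - g i)" by (rule norm_cauchy_schwarz)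
    also have "\<dots> \<le> z / 2 * (norm (P ** G i))\<^sup>2 + 1 / (2 * z) * (norm (G i - g i))\<^sup>2"
    proof -
      have "0 \<le> (z * norm (P ** G i) - norm (G i - g i))\<^sup>2 / (2 * z)" using z by simp
      also have "\<dots> = z / 2 * (norm (P ** G i))\<^sup>2 + 1 / (2 * z) * (norm (G i - g i))\<^sup>2 - norm (P ** G i) * norm (G i - g i)"
        using z by (simp add: power2_eq_square field_simps)
      finally show ?thesis by simp
    qed
    finally have "w i * ((P ** G i) \<bullet> (G i - g i)) \<le> w i * (z / 2 * (norm (P ** G i))\<^sup>2 + 1 / (2 * z) * (norm (G i - g i))\<^sup>2)"
      by (rule mult_left_mono) (rule w[OF that])
    then show ?thesis unfolding split using 1 by (simp add: z_def algebra_simps)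
  qed
  have "(\<Sum>i\<in>I. w i * ((P ** G i) \<bullet> G i)) \<le> (\<Sum>i\<in>I. sqrt (w i) * nuclear_norm (g i)
      + y / (2 * sqrt (CARD('m))) * (w i * (norm (P ** G i))\<^sup>2) + sqrt (CARD('m)) / (2 * y) * (w i * (norm (G i - g i))\<^sup>2))"
    by (intro sum_mono summand)
  also have "\<dots> = (\<Sum>i\<in>I. sqrt (w i) * nuclear_norm (g i)) + y / (2 * sqrt (CARD('m))) * (\<Sum>i\<in>I. w i * (norm (P ** G i))\<^sup>2)
      + sqrt (CARD('m)) / (2 * y) * (\<Sum>i\<in>I. w i * (norm (G i - g i))\<^sup>2)"
    by (simp add: sum.distrib sum_distrib_left)
  also have "y / (2 * sqrt (CARD('m))) * (\<Sum>i\<in>I. w i * (norm (P ** G i))\<^sup>2) \<le> y / (2 * sqrt (CARD('m))) * CARD('m)"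
    using y by (intro mult_left_mono PG) auto
  also have "\<dots> = sqrt (CARD('m)) * y / 2" by (simp add: field_simps)
  finally show ?thesis unfolding half Pinner using Pe by simp
qed

subsection \<open>Smooth functions\<close>

lemma smooth_upper_bound:
  fixes f :: "'v::real_inner \<Rightarrow> real"
  assumes deriv: "\<And>Y. GDERIV f Y :> g Y" and lip: "\<And>Y Z. norm (g Z - g Y) \<le> L * norm (Z - Y)"
  shows "f Y \<le> f X + g X \<bullet> (Y - X) + L / 2 * (norm (Y - X))\<^sup>2"
proof -
  define h where "h = Y - X"
  define \<phi> where "\<phi> t = f (X + t *\<^sub>R h) - t * (g X \<bullet> h) - L / 2 * t\<^sup>2 * (norm h)\<^sup>2" for t
  have "\<phi> 1 \<le> \<phi> 0"
  proof (rule DERIV_nonpos_imp_nonincreasing[of 0 1])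
    fix t :: real assume t: "0 \<le> t" "t \<le> 1"
    have "(f has_derivative (\<lambda>u. u \<bullet> g (X + t *\<^sub>R h))) (at (X + t *\<^sub>R h))"
      using deriv by (simp add: gderiv_def)
    moreover have "((\<lambda>t. X + t *\<^sub>R h) has_derivative (\<lambda>u. u *\<^sub>R h)) (at t)"
      by (auto intro!: derivative_eq_intros)
    ultimately have "((\<lambda>t. f (X + t *\<^sub>R h)) has_derivative (\<lambda>u. (u *\<^sub>R h) \<bullet> g (X + t *\<^sub>R h))) (at t)"
      by (rule has_derivative_compose[rotated])
    then have "((\<lambda>t. f (X + t *\<^sub>R h)) has_real_derivative (h \<bullet> g (X + t *\<^sub>R h))) (at t)"
      by (simp add: has_field_derivative_def mult_commute_abs)
    then have "(\<phi> has_real_derivative (h \<bullet> g (X + t *\<^sub>R h) - g X \<bullet> h - L * t * (norm h)\<^sup>2)) (at t)"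
      unfolding \<phi>_def by (auto intro!: derivative_eq_intros)
    moreover have "h \<bullet> g (X + t *\<^sub>R h) - g X \<bullet> h - L * t * (norm h)\<^sup>2 \<le> 0"
    proof -
      have "h \<bullet> g (X + t *\<^sub>R h) - g X \<bullet> h = h \<bullet> (g (X + t *\<^sub>R h) - g X)" by (simp add: inner_diff_right inner_commute)
      also have "\<dots> \<le> norm h * norm (g (X + t *\<^sub>R h) - g X)" by (rule norm_cauchy_schwarz)
      also have "\<dots> \<le> norm h * (L * norm (X + t *\<^sub>R h - X))" by (intro mult_left_mono lip) auto
      also have "\<dots> = L * t * (norm h)\<^sup>2" using t by (simp add: power2_eq_square)
      finally show ?thesis by simp
    qed
    ultimately show "\<exists>y. (\<phi> has_real_derivative y) (at t) \<and> y \<le> 0" by blast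
  qed simp
  then show ?thesis by (simp add: \<phi>_def h_def)
qed

lemma smooth_gradient_bound:
  fixes f :: "'v::real_inner \<Rightarrow> real"
  assumes deriv: "\<And>Y. GDERIV f Y :> g Y" and lip: "\<And>Y Z. norm (g Z - g Y) \<le> L * norm (Z - Y)"
    and L: "L > 0" and low: "\<And>Y. f_star \<le> f Y"
  shows "(norm (g X))\<^sup>2 \<le> 2 * L * (f X - f_star)"
proof -
  have "f_star \<le> f (X - (1 / L) *\<^sub>R g X)" by (rule low)
  also have "\<dots> \<le> f X + g X \<bullet> (X - (1 / L) *\<^sub>R g X - X) + L / 2 * (norm (X - (1 / L) *\<^sub>R g X - X))\<^sup>2"
    by (rule smooth_upper_bound[OF deriv lip])
  also have "\<dots> = f X - (norm (g X))\<^sup>2 / (2 * L)"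
    using L by (simp add: dot_square_norm power_mult_distrib power2_eq_square[of L] field_simps)
  finally show ?thesis using L by (simp add: field_simps)
qed

subsection \<open>A single trajectory\<close>

lemma one_minus_le_twice:
  fixes \<theta> \<beta> :: real
  assumes "0 \<le> \<theta>" "\<theta> < 1" "\<beta> \<le> sqrt \<theta>"
  shows "1 - \<theta> \<le> 2 * (1 - \<beta>)"
proof -
  have "1 - \<theta> = (1 - sqrt \<theta>) * (1 + sqrt \<theta>)" using assms by (simp add: algebra_simps)
  also have "\<dots> \<le> (1 - sqrt \<theta>) * 2" using assms by (intro mult_left_mono) (auto simp: real_le_lsqrt)
  finally show ?thesis using assms by simp
qed

definition ema_weight :: "real \<Rightarrow> nat \<Rightarrow> nat \<Rightarrow> real" where
  "ema_weight \<beta> k i = (1 - \<beta>) * \<beta> ^ (k - i)"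

locale shampoo_trajectory =
  fixes \<eta> \<theta> \<beta> lam \<epsilon> s t :: real and K :: nat
    and G X Mo :: "nat \<Rightarrow> real^'n^'m" and Lp :: "nat \<Rightarrow> real^'m^'m" and Rp :: "nat \<Rightarrow> real^'n^'n"
  assumes \<eta>: "\<eta> > 0" and \<theta>: "0 \<le> \<theta>" "\<theta> < 1" and \<beta>: "\<theta> \<le> \<beta>" "\<beta> \<le> sqrt \<theta>" and \<epsilon>: "\<epsilon> > 0"
    and st: "0 \<le> s" "0 \<le> t" "s + t = 1"
    and init: "Mo 0 = 0" "Lp 0 = 0" "Rp 0 = 0"
    and Mo_step: "\<And>k. k \<in> {1..K} \<Longrightarrow> Mo k = \<theta> *\<^sub>R Mo (k - 1) + (1 - \<theta>) *\<^sub>R G k"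
    and Lp_step: "\<And>k. k \<in> {1..K} \<Longrightarrow> Lp k = \<beta> *\<^sub>R Lp (k - 1) + (1 - \<beta>) *\<^sub>R (G k ** transpose (G k))"
    and Rp_step: "\<And>k. k \<in> {1..K} \<Longrightarrow> Rp k = \<beta> *\<^sub>R Rp (k - 1) + (1 - \<beta>) *\<^sub>R (transpose (G k) ** G k)"
    and X_step: "\<And>k. k \<in> {1..K} \<Longrightarrow> X (k + 1) = (1 - lam * \<eta>) *\<^sub>R X k -
          \<eta> *\<^sub>R (matrix_powr (Lp k + \<epsilon> *\<^sub>R mat 1) (-s/2) ** Mo k ** matrix_powr (Rp k + \<epsilon> *\<^sub>R mat 1) (-t/2))"
begin

lemma \<beta>_less_1: "0 \<le> \<beta>" "\<beta> < 1"
  using \<theta> \<beta> by (auto intro: le_less_trans simp: real_sqrt_lt_1_iff)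

lemma momentum_weight: "1 - \<theta> \<le> 2 * (1 - \<beta>)"
  using \<theta> \<beta> by (intro one_minus_le_twice)

abbreviation w :: "nat \<Rightarrow> nat \<Rightarrow> real" where "w \<equiv> ema_weight \<beta>"

lemma w_nonneg: "0 \<le> w k i"
  using \<beta>_less_1 by (simp add: ema_weight_def)

lemma preconditioner_sums:
  assumes "k \<le> K"
  shows "Lp k = (\<Sum>i=1..k. w k i *\<^sub>R (G i ** transpose (G i)))"
    "Rp k = (\<Sum>i=1..k. w k i *\<^sub>R (transpose (G i) ** transpose (transpose (G i))))"
proof -
  have step: "(\<Sum>i=1..Suc k. w (Suc k) i *\<^sub>R H i) = \<beta> *\<^sub>R (\<Sum>i=1..k. w k i *\<^sub>R H i) + (1 - \<beta>) *\<^sub>R H (Suc k)"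
    for k and H :: "nat \<Rightarrow> real^'x^'x"
  proof -
    have "(\<Sum>i=1..k. w (Suc k) i *\<^sub>R H i) = \<beta> *\<^sub>R (\<Sum>i=1..k. w k i *\<^sub>R H i)"
      unfolding scaleR_sum_right by (intro sum.cong refl) (simp add: ema_weight_def Suc_diff_le)
    then show ?thesis by (simp add: ema_weight_def)
  qed
  have "Lp k = (\<Sum>i=1..k. w k i *\<^sub>R (G i ** transpose (G i))) \<and>
    Rp k = (\<Sum>i=1..k. w k i *\<^sub>R (transpose (G i) ** transpose (transpose (G i))))"
    using assms
  proof (induction k)
    case (Suc k)
    then have *: "Suc k \<in> {1..K}" by simp
    have IH: "Lp k = (\<Sum>i=1..k. w k i *\<^sub>R (G i ** transpose (G i)))"
      "Rp k = (\<Sum>i=1..k. w k i *\<^sub>R (transpose (G i) ** transpose (transpose (G i))))"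
      using Suc by auto
    show ?case unfolding step Lp_step[OF *] Rp_step[OF *] diff_Suc_1 IH by simp
  qed (simp add: init)
  then show "Lp k = (\<Sum>i=1..k. w k i *\<^sub>R (G i ** transpose (G i)))"
    "Rp k = (\<Sum>i=1..k. w k i *\<^sub>R (transpose (G i) ** transpose (transpose (G i))))" by auto
qed

lemma preconditioner_psd:
  assumes "k \<le> K"
  shows "psd (Lp k)" "psd (Rp k)"
proof -
  have gram: "psd (\<Sum>i=1..k. w k i *\<^sub>R (H i ** transpose (H i)))" for H :: "nat \<Rightarrow> real^'x^'y"
  proof -
    have "transpose (\<Sum>i\<in>I. w k i *\<^sub>R (H i ** transpose (H i))) = (\<Sum>i\<in>I. w k i *\<^sub>R (H i ** transpose (H i)))" for I
      by (induction I rule: infinite_finite_induct) (simp_all add: transpose_simps matrix_transpose_mul)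
    moreover have "0 \<le> x \<bullet> ((H i ** transpose (H i)) *v x)" for i x
      using norm_matrix_vector_square[of "transpose (H i)" x] by (metis transpose_transpose zero_le_power2)
    then have "0 \<le> x \<bullet> ((\<Sum>i=1..k. w k i *\<^sub>R (H i ** transpose (H i))) *v x)" for x
      by (simp add: matrix_sum_mul inner_sum_right scaleR_matrix_vector_assoc[symmetric] sum_nonneg w_nonneg)
    ultimately show ?thesis by (simp add: psd_def)
  qed
  show "psd (Lp k)" "psd (Rp k)"
    unfolding preconditioner_sums[OF assms] by (rule gram)+
qed

lemma preconditioner_loewner:
  assumes "k \<le> K"
  shows "\<epsilon> *\<^sub>R mat 1 \<preceq>\<^sub>L Lp k + \<epsilon> *\<^sub>R mat 1" "\<epsilon> *\<^sub>R mat 1 \<preceq>\<^sub>L Rp k + \<epsilon> *\<^sub>R mat 1"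
  using preconditioner_psd[OF assms] by (simp_all add: loewner_le_def)

lemma momentum_dominated:
  assumes "k \<le> K"
  shows "(norm (transpose (Mo k) *v u))\<^sup>2 \<le> 2 * (u \<bullet> (Lp k *v u))"
    "(norm (Mo k *v v))\<^sup>2 \<le> 2 * (v \<bullet> (Rp k *v v))"
proof -
  have convex: "(norm (\<theta> *\<^sub>R a + (1 - \<theta>) *\<^sub>R b))\<^sup>2 \<le> 2 * (\<beta> * l + (1 - \<beta>) * (norm b)\<^sup>2)"
    if "(norm a)\<^sup>2 \<le> 2 * l" for a b :: "'z::real_inner" and l
  proof -
    have "\<theta> * (norm a)\<^sup>2 + (1 - \<theta>) * (norm b)\<^sup>2 - (norm (\<theta> *\<^sub>R a + (1 - \<theta>) *\<^sub>R b))\<^sup>2 = \<theta> * (1 - \<theta>) * (norm (a - b))\<^sup>2"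
      by (simp add: power2_norm_eq_inner inner_add_left inner_add_right inner_diff_left inner_diff_right
          inner_commute[of b a] algebra_simps)
    moreover have "0 \<le> \<theta> * (1 - \<theta>) * (norm (a - b))\<^sup>2" using \<theta> by simp
    moreover have "\<theta> * (norm a)\<^sup>2 \<le> \<beta> * (2 * l)" using that \<beta> \<theta> by (intro mult_mono) auto
    moreover have "(1 - \<theta>) * (norm b)\<^sup>2 \<le> 2 * (1 - \<beta>) * (norm b)\<^sup>2" by (intro mult_right_mono momentum_weight) auto
    ultimately show ?thesis by (simp add: algebra_simps)
  qed
  have gram: "(norm (H *v x))\<^sup>2 = x \<bullet> ((transpose H ** H) *v x)" for H :: "real^'x^'y" and x
    by (rule norm_matrix_vector_square)
  show "(norm (transpose (Mo k) *v u))\<^sup>2 \<le> 2 * (u \<bullet> (Lp k *v u))"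
    using assms
  proof (induction k)
    case (Suc k)
    then have *: "Suc k \<in> {1..K}" by simp
    have "transpose (Mo (Suc k)) *v u = \<theta> *\<^sub>R (transpose (Mo k) *v u) + (1 - \<theta>) *\<^sub>R (transpose (G (Suc k)) *v u)"
      unfolding Mo_step[OF *] by (simp add: transpose_simps matrix_vector_mult_add_rdistrib scaleR_matrix_vector_assoc[symmetric])
    moreover have "u \<bullet> (Lp (Suc k) *v u) = \<beta> * (u \<bullet> (Lp k *v u)) + (1 - \<beta>) * (norm (transpose (G (Suc k)) *v u))\<^sup>2"
      unfolding Lp_step[OF *] gram by (simp add: matrix_vector_mult_add_rdistrib inner_add_right scaleR_matrix_vector_assoc[symmetric])
    ultimately show ?case using convex Suc by simp
  qed (simp add: init transpose_simps)
  show "(norm (Mo k *v v))\<^sup>2 \<le> 2 * (v \<bullet> (Rp k *v v))"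
    using assms
  proof (induction k)
    case (Suc k)
    then have *: "Suc k \<in> {1..K}" by simp
    have "Mo (Suc k) *v v = \<theta> *\<^sub>R (Mo k *v v) + (1 - \<theta>) *\<^sub>R (G (Suc k) *v v)"
      unfolding Mo_step[OF *] by (simp add: matrix_vector_mult_add_rdistrib scaleR_matrix_vector_assoc[symmetric])
    moreover have "v \<bullet> (Rp (Suc k) *v v) = \<beta> * (v \<bullet> (Rp k *v v)) + (1 - \<beta>) * (norm (G (Suc k) *v v))\<^sup>2"
      unfolding Rp_step[OF *] gram by (simp add: matrix_vector_mult_add_rdistrib inner_add_right scaleR_matrix_vector_assoc[symmetric])
    ultimately show ?case using convex Suc by simp
  qed (simp add: init)
qed

abbreviation update :: "nat \<Rightarrow> real^'n^'m" where
  "update k \<equiv> matrix_powr (Lp k + \<epsilon> *\<^sub>R mat 1) (-s/2) ** Mo k ** matrix_powr (Rp k + \<epsilon> *\<^sub>R mat 1) (-t/2)"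

lemma update_bound:
  assumes "k \<le> K"
  shows "norm (update k *v v) \<le> sqrt 2 * norm v"
proof (rule preconditioned_spectral_norm_le[OF \<epsilon> preconditioner_loewner[OF assms] _ _ st])
  fix u :: "real^'m" and v :: "real^'n"
  have "0 \<le> \<epsilon> * (u \<bullet> u)" "0 \<le> \<epsilon> * (v \<bullet> v)" using \<epsilon> by simp_all
  then show "(norm (transpose (Mo k) *v u))\<^sup>2 \<le> (sqrt 2)\<^sup>2 * (u \<bullet> ((Lp k + \<epsilon> *\<^sub>R mat 1) *v u))"
    "(norm (Mo k *v v))\<^sup>2 \<le> (sqrt 2)\<^sup>2 * (v \<bullet> ((Rp k + \<epsilon> *\<^sub>R mat 1) *v v))"
    using momentum_dominated(1)[OF assms, of u] momentum_dominated(2)[OF assms, of v]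
    by (simp_all add: matrix_vector_mult_add_rdistrib inner_add_right scaleR_matrix_vector_assoc[symmetric] add_increasing2)
qed simp

lemma iterate_bound:
  assumes b: "\<And>v. norm (X 1 *v v) \<le> b * norm v" and lam: "0 \<le> lam * \<eta>" "lam * \<eta> \<le> 1" and k: "k \<in> {1..K + 1}"
  shows "norm (X k *v v) \<le> (b + real (k - 1) * (\<eta> * sqrt 2)) * norm v"
proof -
  have "\<forall>v. norm (X (Suc j) *v v) \<le> (b + real j * (\<eta> * sqrt 2)) * norm v" if "j \<le> K" for j
    using that
  proof (induction j)
    case (Suc j)
    then have *: "Suc j \<in> {1..K}" by simp
    show ?case
    proof
      fix v
      have "X (Suc (Suc j)) *v v = (1 - lam * \<eta>) *\<^sub>R (X (Suc j) *v v) - \<eta> *\<^sub>R (update (Suc j) *v v)"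
        using X_step[OF *] by (simp add: matrix_vector_mult_diff_rdistrib scaleR_matrix_vector_assoc)
      then have "norm (X (Suc (Suc j)) *v v) \<le> norm ((1 - lam * \<eta>) *\<^sub>R (X (Suc j) *v v)) + norm (\<eta> *\<^sub>R (update (Suc j) *v v))"
        by (metis norm_triangle_ineq4)
      also have "\<dots> = (1 - lam * \<eta>) * norm (X (Suc j) *v v) + \<eta> * norm (update (Suc j) *v v)"
        using lam \<eta> by simp
      also have "\<dots> \<le> 1 * norm (X (Suc j) *v v) + \<eta> * (sqrt 2 * norm v)"
        using lam \<eta> Suc.prems by (intro add_mono mult_right_mono mult_left_mono update_bound) auto
      also have "\<dots> \<le> (b + real j * (\<eta> * sqrt 2)) * norm v + \<eta> * (sqrt 2 * norm v)" using Suc by simp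
      finally show "norm (X (Suc (Suc j)) *v v) \<le> (b + real (Suc j) * (\<eta> * sqrt 2)) * norm v"
        by (simp add: algebra_simps)
    qed
  qed (simp add: b[unfolded One_nat_def])
  then show ?thesis using k by (cases k) auto
qed

definition T :: "nat \<Rightarrow> real" where
  "T k = s * trace (matrix_powr (Lp k + \<epsilon> *\<^sub>R mat 1) (1/2)) + t * trace (matrix_powr (Rp k + \<epsilon> *\<^sub>R mat 1) (1/2))"

lemma T_bound:
  fixes g :: "nat \<Rightarrow> real^'n^'m"
  defines "\<mu> \<equiv> sqrt (real CARD('m) + real CARD('n))"
  assumes k: "k \<le> K" and y: "y > 0"
  shows "T k \<le> (\<Sum>i=1..k. sqrt (w k i) * nuclear_norm (g i)) + \<mu> * y / 2
      + \<mu> / (2 * y) * (\<Sum>i=1..k. w k i * (norm (G i - g i))\<^sup>2) + \<mu>\<^sup>2 * sqrt \<epsilon>" (is "_ \<le> ?B")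
proof -
  have mu: "sqrt (CARD('m)) \<le> \<mu>" "sqrt (CARD('n)) \<le> \<mu>" "CARD('m) \<le> \<mu>\<^sup>2" "CARD('n) \<le> \<mu>\<^sup>2"
    by (simp_all add: \<mu>_def)
  have S: "0 \<le> (\<Sum>i=1..k. w k i * (norm (G i - g i))\<^sup>2)" by (intro sum_nonneg mult_nonneg_nonneg w_nonneg) auto
  have *: "A + c * y / 2 + c / (2 * y) * Z + d * sqrt \<epsilon> \<le> A + \<mu> * y / 2 + \<mu> / (2 * y) * Z + \<mu>\<^sup>2 * sqrt \<epsilon>"
    if "c \<le> \<mu>" "d \<le> \<mu>\<^sup>2" "0 \<le> Z" for A c d Z
    using that y \<epsilon> by (intro add_mono mult_right_mono divide_right_mono order_refl) auto
  have "trace (matrix_powr (Lp k + \<epsilon> *\<^sub>R mat 1) (1/2)) \<le>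
      (\<Sum>i=1..k. sqrt (w k i) * nuclear_norm (g i)) + sqrt (CARD('m)) * y / 2
      + sqrt (CARD('m)) / (2 * y) * (\<Sum>i=1..k. w k i * (norm (G i - g i))\<^sup>2) + CARD('m) * sqrt \<epsilon>"
    by (rule trace_sqrt_accumulated_le[OF _ w_nonneg \<epsilon> y])
       (simp_all only: preconditioner_sums(1)[OF k] finite_atLeastAtMost)
  also have "\<dots> \<le> ?B" by (rule *[OF mu(1,3) S])
  finally have L: "trace (matrix_powr (Lp k + \<epsilon> *\<^sub>R mat 1) (1/2)) \<le> ?B" .
  have "trace (matrix_powr (Rp k + \<epsilon> *\<^sub>R mat 1) (1/2)) \<le>
      (\<Sum>i=1..k. sqrt (w k i) * nuclear_norm (transpose (g i))) + sqrt (CARD('n)) * y / 2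
      + sqrt (CARD('n)) / (2 * y) * (\<Sum>i=1..k. w k i * (norm (transpose (G i) - transpose (g i)))\<^sup>2) + CARD('n) * sqrt \<epsilon>"
    by (rule trace_sqrt_accumulated_le[OF _ w_nonneg \<epsilon> y])
       (simp_all only: preconditioner_sums(2)[OF k] finite_atLeastAtMost)
  also have "\<dots> \<le> ?B"
    unfolding transpose_simps(2)[symmetric] norm_transpose nuclear_norm_transpose by (rule *[OF mu(2,4) S])
  finally have R: "trace (matrix_powr (Rp k + \<epsilon> *\<^sub>R mat 1) (1/2)) \<le> ?B" .
  have "T k \<le> s * ?B + t * ?B" unfolding T_def using st L R by (intro add_mono mult_left_mono) auto
  also have "\<dots> = ?B" by (simp only: distrib_right[symmetric] st(3) mult_1)
  finally show ?thesis .
qed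

lemma descent_step:
  assumes deriv: "\<And>Y. GDERIV f Y :> g Y" and lip: "\<And>Y Z. norm (g Z - g Y) \<le> L * norm (Z - Y)"
    and e: "e > 0" and Le: "e *\<^sub>R mat 1 \<preceq>\<^sub>L Lp k + \<epsilon> *\<^sub>R mat 1" and Re: "e *\<^sub>R mat 1 \<preceq>\<^sub>L Rp k + \<epsilon> *\<^sub>R mat 1"
    and b: "\<And>v. norm (X k *v v) \<le> b * norm v" and k: "k \<in> {1..K}"
  shows "f (X (k + 1)) \<le> f (X k) - \<eta> * x * nuclear_norm (g (X k)) + \<eta> * (x\<^sup>2 / 2 + lam\<^sup>2 * b\<^sup>2) * T k
     - (sqrt e / (2 * \<eta>) - L / 2) * (norm (X (k + 1) - X k))\<^sup>2 + \<eta> / sqrt e * (norm (Mo k - g (X k)))\<^sup>2"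
proof -
  define U where "U = update k + lam *\<^sub>R X k"
  have dX: "X (k + 1) - X k = - \<eta> *\<^sub>R U"
    unfolding X_step[OF k] U_def by (simp add: algebra_simps)
  have "- (g (X k) \<bullet> U) \<le> - x * nuclear_norm (g (X k)) + (x\<^sup>2 / 2 + lam\<^sup>2 * b\<^sup>2) * T k
           - sqrt e / 2 * (norm U)\<^sup>2 + (norm (g (X k) - Mo k))\<^sup>2 / sqrt e"
    by (rule preconditioned_step[OF e Le Re st b U_def T_def])
  from mult_left_mono[OF this, of \<eta>] have "- \<eta> * (g (X k) \<bullet> U) \<le> - \<eta> * x * nuclear_norm (g (X k))
      + \<eta> * (x\<^sup>2 / 2 + lam\<^sup>2 * b\<^sup>2) * T k - \<eta> * (sqrt e / 2) * (norm U)\<^sup>2 + \<eta> / sqrt e * (norm (Mo k - g (X k)))\<^sup>2"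
    using \<eta> by (simp add: algebra_simps norm_minus_commute)
  moreover have "\<eta> * (sqrt e / 2) * (norm U)\<^sup>2 = sqrt e / (2 * \<eta>) * (norm (X (k + 1) - X k))\<^sup>2"
    unfolding dX using \<eta> by (simp add: power_mult_distrib power2_eq_square[of \<eta>])
  moreover have "g (X k) \<bullet> (X (k + 1) - X k) = - \<eta> * (g (X k) \<bullet> U)" unfolding dX by simp
  moreover have "f (X (k + 1)) \<le> f (X k) + g (X k) \<bullet> (X (k + 1) - X k) + L / 2 * (norm (X (k + 1) - X k))\<^sup>2"
    by (rule smooth_upper_bound[OF deriv lip])
  ultimately show ?thesis by (simp add: left_diff_distrib)
qed

lemma accumulated_descent_step:
  fixes g :: "real^'n^'m \<Rightarrow> real^'n^'m"
  defines "\<mu> \<equiv> sqrt (real CARD('m) + real CARD('n))"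
  assumes deriv: "\<And>Y. GDERIV f Y :> g Y" and lip: "\<And>Y Z. norm (g Z - g Y) \<le> L * norm (Z - Y)"
    and e: "e > 0" and Le: "e *\<^sub>R mat 1 \<preceq>\<^sub>L Lp k + \<epsilon> *\<^sub>R mat 1" and Re: "e *\<^sub>R mat 1 \<preceq>\<^sub>L Rp k + \<epsilon> *\<^sub>R mat 1"
    and b: "\<And>v. norm (X k *v v) \<le> b * norm v" and k: "k \<in> {1..K}" and y: "y > 0"
    and q: "x\<^sup>2 / 2 + lam\<^sup>2 * b\<^sup>2 \<le> q"
  shows "f (X (k + 1)) \<le> f (X k) - \<eta> * x * nuclear_norm (g (X k)) + \<eta> * q *
     ((\<Sum>i=1..k. sqrt (w k i) * nuclear_norm (g (X i))) + \<mu> * y / 2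
      + \<mu> / (2 * y) * (\<Sum>i=1..k. w k i * (norm (G i - g (X i)))\<^sup>2) + \<mu>\<^sup>2 * sqrt \<epsilon>)
     - (sqrt e / (2 * \<eta>) - L / 2) * (norm (X (k + 1) - X k))\<^sup>2 + \<eta> / sqrt e * (norm (Mo k - g (X k)))\<^sup>2"
proof -
  let ?B = "(\<Sum>i=1..k. sqrt (w k i) * nuclear_norm (g (X i))) + \<mu> * y / 2
      + \<mu> / (2 * y) * (\<Sum>i=1..k. w k i * (norm (G i - g (X i)))\<^sup>2) + \<mu>\<^sup>2 * sqrt \<epsilon>"
  have T: "T k \<le> ?B" unfolding \<mu>_def by (rule T_bound[OF _ y]) (use k in simp)
  have "0 \<le> ?B"
    using y \<epsilon> by (intro add_nonneg_nonneg sum_nonneg mult_nonneg_nonneg) (auto simp: w_nonneg nuclear_norm_nonneg \<mu>_def)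
  have "(x\<^sup>2 / 2 + lam\<^sup>2 * b\<^sup>2) * T k \<le> q * ?B"
    by (rule order_trans[OF mult_left_mono[OF T] mult_right_mono[OF q]]) (use \<open>0 \<le> ?B\<close> in auto)
  then have "\<eta> * (x\<^sup>2 / 2 + lam\<^sup>2 * b\<^sup>2) * T k \<le> \<eta> * q * ?B"
    using \<eta> by (simp add: mult.assoc)
  with descent_step[OF deriv lip e Le Re b k, of x] show ?thesis by linarith
qed

end

subsection \<open>Weighted sums along the run\<close>

lemma sum_ema_weight_le_1:
  assumes "0 \<le> \<beta>" "\<beta> < 1"
  shows "(\<Sum>i=1..k. ema_weight \<beta> k i) \<le> 1"
proof -
  have "(\<Sum>i=1..k. ema_weight \<beta> k i) = 1 - \<beta> ^ k"
  proof (induction k)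
    case (Suc k)
    have "(\<Sum>i=1..k. ema_weight \<beta> (Suc k) i) = \<beta> * (\<Sum>i=1..k. ema_weight \<beta> k i)"
      unfolding sum_distrib_left by (intro sum.cong refl) (simp add: ema_weight_def Suc_diff_le)
    then have "(\<Sum>i=1..Suc k. ema_weight \<beta> (Suc k) i) = \<beta> * (\<Sum>i=1..k. ema_weight \<beta> k i) + ema_weight \<beta> (Suc k) (Suc k)"
      by simp
    then show ?case unfolding Suc by (simp add: ema_weight_def algebra_simps)
  qed simp
  then show ?thesis using assms by simp
qed

lemma sum_sqrt_ema_weight_le:
  assumes \<theta>: "0 \<le> \<theta>" "\<theta> < 1" and \<beta>: "0 \<le> \<beta>" "\<beta> \<le> sqrt \<theta>" and N: "\<And>i. 0 \<le> N i"
  shows "(\<Sum>k=1..K. \<Sum>i=1..k. sqrt (ema_weight \<beta> k i) * N i) \<le> 3 / sqrt (1 - \<theta>) * (\<Sum>i=1..K. N i)"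
proof -
  define r where "r = sqrt \<beta>"
  have "\<beta> < 1" using \<beta> \<theta> by (auto intro: le_less_trans simp: real_sqrt_lt_1_iff)
  then have r: "0 \<le> r" "r < 1" "r\<^sup>2 = \<beta>" using \<beta> by (auto simp: r_def)
  define A where "A k = (\<Sum>i=1..k. r ^ (k - i) * N i)" for k :: nat
  have A0: "A k \<ge> 0" for k using r N by (auto simp: A_def intro!: sum_nonneg)
  have A_Suc: "A (Suc k) = r * A k + N (Suc k)" for k
  proof -
    have "(\<Sum>i=1..k. r ^ (Suc k - i) * N i) = r * A k"
      unfolding A_def sum_distrib_left by (intro sum.cong refl) (simp add: Suc_diff_le)
    then show ?thesis by (simp add: A_def)
  qed
  have "(1 - r) * (\<Sum>k=1..n. A k) + r * A n = (\<Sum>i=1..n. N i)" for n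
  proof (induction n)
    case (Suc n)
    have "(1 - r) * (\<Sum>k=1..Suc n. A k) + r * A (Suc n) = ((1 - r) * (\<Sum>k=1..n. A k) + r * A n) + N (Suc n)"
      using A_Suc[of n] by (simp add: algebra_simps)
    then show ?case using Suc by simp
  qed (simp add: A_def)
  from this[of K] have "(1 - r) * (\<Sum>k=1..K. A k) \<le> (\<Sum>i=1..K. N i)" using A0[of K] r by (smt (verit) mult_nonneg_nonneg)
  then have SA: "(\<Sum>k=1..K. A k) \<le> (\<Sum>i=1..K. N i) / (1 - r)" using r by (simp add: field_simps)
  have "1 - \<theta> \<le> 2 * (1 - \<beta>)" using \<theta> \<beta> by (intro one_minus_le_twice)
  then have w: "sqrt (1 - \<theta>) \<le> sqrt 2 * sqrt (1 - \<beta>)" by (simp flip: real_sqrt_mult)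
  have "sqrt 2 \<le> 3 / 2" by (rule real_le_lsqrt) (simp_all add: power2_eq_square)
  have "sqrt (1 - \<beta>) / (1 - r) \<le> 3 / sqrt (1 - \<theta>)"
  proof -
    have "sqrt (1 - \<beta>) * sqrt (1 - \<theta>) \<le> sqrt (1 - \<beta>) * (sqrt 2 * sqrt (1 - \<beta>))"
      using \<open>\<beta> < 1\<close> by (intro mult_left_mono w) auto
    also have "\<dots> = sqrt 2 * (sqrt (1 - \<beta>) * sqrt (1 - \<beta>))" by (simp only: mult_ac)
    also have "\<dots> = sqrt 2 * (1 - \<beta>)" using \<open>\<beta> < 1\<close> by simp
    also have "\<dots> = sqrt 2 * ((1 + r) * (1 - r))" using r(3) by (simp add: power2_eq_square algebra_simps)
    also have "\<dots> \<le> (3 / 2) * (2 * (1 - r))" using r \<open>sqrt 2 \<le> 3 / 2\<close> by (intro mult_mono) auto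
    finally show ?thesis using r \<theta> by (simp add: field_simps)
  qed
  have "(\<Sum>k=1..K. \<Sum>i=1..k. sqrt (ema_weight \<beta> k i) * N i) = sqrt (1 - \<beta>) * (\<Sum>k=1..K. A k)"
    unfolding A_def sum_distrib_left by (intro sum.cong refl) (simp add: ema_weight_def r_def real_sqrt_mult real_sqrt_power)
  also have "\<dots> \<le> sqrt (1 - \<beta>) * ((\<Sum>i=1..K. N i) / (1 - r))" using SA \<open>\<beta> < 1\<close> by (intro mult_left_mono) auto
  also have "\<dots> = sqrt (1 - \<beta>) / (1 - r) * (\<Sum>i=1..K. N i)" by simp
  also have "\<dots> \<le> 3 / sqrt (1 - \<theta>) * (\<Sum>i=1..K. N i)"
    by (intro mult_right_mono sum_nonneg N) fact
  finally show ?thesis .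
qed

lemma error_recursion_sum:
  fixes E D :: "nat \<Rightarrow> real"
  assumes "E 1 \<le> c0 + c" and "\<And>k. k \<in> {1..<K} \<Longrightarrow> E (Suc k) \<le> \<theta> * E k + d * D k + c"
    and "K \<ge> 1" "0 \<le> \<theta>" "0 \<le> d" "\<And>k. 0 \<le> E k" "\<And>k. 0 \<le> D k"
  shows "(1 - \<theta>) * (\<Sum>k=1..K. E k) \<le> c0 + K * c + d * (\<Sum>k=1..K. D k)"
proof -
  have "(1 - \<theta>) * (\<Sum>k=1..Suc n. E k) + \<theta> * E (Suc n) \<le> c0 + Suc n * c + d * (\<Sum>k=1..n. D k)" if "n < K" for n
    using that
  proof (induction n)
    case 0
    then show ?case using assms(1) by (simp add: algebra_simps)
  next
    case (Suc n)
    have "E (Suc (Suc n)) \<le> \<theta> * E (Suc n) + d * D (Suc n) + c" using assms(2)[of "Suc n"] Suc by simp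
    then show ?case using Suc by (simp add: algebra_simps)
  qed
  from this[of "K - 1"] have "(1 - \<theta>) * (\<Sum>k=1..K. E k) + \<theta> * E K \<le> c0 + K * c + d * (\<Sum>k=1..K-1. D k)"
    using \<open>K \<ge> 1\<close> by simp
  moreover have "(\<Sum>k=1..K-1. D k) \<le> (\<Sum>k=1..K. D k)" using assms by (intro sum_mono2) auto
  then have "d * (\<Sum>k=1..K-1. D k) \<le> d * (\<Sum>k=1..K. D k)" using assms by (intro mult_left_mono) auto
  moreover have "0 \<le> \<theta> * E K" using assms by simp
  ultimately show ?thesis by linarith
qed

subsection \<open>Measurability of the iterates\<close>

lemma borel_measurable_matrix_mult [measurable (raw)]:
  fixes A :: "'a \<Rightarrow> real^'k^'m" and B :: "'a \<Rightarrow> real^'n^'k"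
  assumes "A \<in> borel_measurable M" "B \<in> borel_measurable M"
  shows "(\<lambda>\<omega>. A \<omega> ** B \<omega>) \<in> borel_measurable M"
proof -
  have "continuous_on UNIV (\<lambda>x :: (real^'k^'m) \<times> (real^'n^'k). fst x ** snd x)"
    unfolding matrix_matrix_mult_def by (intro continuous_intros)
  then show ?thesis by (rule borel_measurable_continuous_Pair[OF assms])
qed

lemma borel_measurable_transpose [measurable (raw)]:
  fixes A :: "'a \<Rightarrow> real^'n^'m"
  assumes "A \<in> borel_measurable M"
  shows "(\<lambda>\<omega>. transpose (A \<omega>)) \<in> borel_measurable M"
proof -
  have "continuous_on UNIV (transpose :: real^'n^'m \<Rightarrow> _)"
    unfolding transpose_def by (intro continuous_intros)
  then show ?thesis using assms by (rule borel_measurable_continuous_on)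
qed

lemma borel_measurable_matrix_powr:
  fixes A :: "'a \<Rightarrow> real^'n^'n"
  assumes A: "A \<in> borel_measurable M" and e: "e > 0" "\<And>\<omega>. \<omega> \<in> space M \<Longrightarrow> e *\<^sub>R mat 1 \<preceq>\<^sub>L A \<omega>" and r: "r \<le> 1"
  shows "(\<lambda>\<omega>. matrix_powr (A \<omega>) r) \<in> borel_measurable M"
proof -
  have "A \<in> measurable M (restrict_space borel {A. e *\<^sub>R mat 1 \<preceq>\<^sub>L A})"
    by (rule measurable_restrict_space2) (use A e in auto)
  then show ?thesis
    using borel_measurable_continuous_on_restrict[OF continuous_on_matrix_powr[OF e(1) r]]
    by (rule measurable_compose)
qed

lemma space_gen_sigma [simp]: "space (gen_sigma P G k) = space P"
  by (simp add: gen_sigma_def space_measure_of_conv)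

lemma gen_sigma_generators: "(\<Union>t\<in>{1..k}. {G t -` A \<inter> space P | A. A \<in> sets borel}) \<subseteq> Pow (space P)"
  by auto

lemma measurable_gen_sigma:
  assumes "t \<in> {1..k}"
  shows "G t \<in> borel_measurable (gen_sigma P G k)"
proof (rule measurableI)
  fix A :: "'b set" assume "A \<in> sets borel"
  then have "G t -` A \<inter> space P \<in> (\<Union>t\<in>{1..k}. {G t -` A \<inter> space P | A. A \<in> sets borel})"
    using assms by blast
  then show "G t -` A \<inter> space (gen_sigma P G k) \<in> sets (gen_sigma P G k)"
    unfolding space_gen_sigma unfolding gen_sigma_def sets_measure_of[OF gen_sigma_generators] by blast
qed simp

lemma sets_gen_sigma_mono:
  assumes "j \<le> k"
  shows "sets (gen_sigma P G j) \<subseteq> sets (gen_sigma P G k)"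
  unfolding gen_sigma_def sets_measure_of[OF gen_sigma_generators]
  using assms by (intro sigma_sets_mono' UN_mono) auto

lemma subalgebra_gen_sigma:
  assumes "\<And>t. t \<in> {1..k} \<Longrightarrow> G t \<in> borel_measurable P"
  shows "subalgebra P (gen_sigma P G k)"
proof -
  have "(\<Union>t\<in>{1..k}. {G t -` A \<inter> space P | A. A \<in> sets borel}) \<subseteq> sets P"
    using assms by (auto intro: measurable_sets)
  then have "sigma_sets (space P) (\<Union>t\<in>{1..k}. {G t -` A \<inter> space P | A. A \<in> sets borel}) \<subseteq> sets P"
    by (rule sets.sigma_sets_subset)
  then show ?thesis
    unfolding subalgebra_def space_gen_sigma unfolding gen_sigma_def sets_measure_of[OF gen_sigma_generators] by simp
qed

lemma norm_add_square_le:
  fixes a b :: "'v::real_inner"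
  shows "(norm (a + b))\<^sup>2 \<le> 2 * (norm a)\<^sup>2 + 2 * (norm b)\<^sup>2"
proof -
  have "2 * (norm a)\<^sup>2 + 2 * (norm b)\<^sup>2 - (norm (a + b))\<^sup>2 = (norm (a - b))\<^sup>2"
    by (simp add: power2_norm_eq_inner inner_add_left inner_add_right inner_diff_left inner_diff_right inner_commute[of b a])
  then show ?thesis by (smt (verit) zero_le_power2)
qed

lemma (in prob_space) integrable_square_add:
  fixes Y Z :: "'a \<Rightarrow> 'v::euclidean_space"
  assumes [measurable]: "Y \<in> borel_measurable M" "Z \<in> borel_measurable M"
    and "integrable M (\<lambda>\<omega>. (norm (Y \<omega>))\<^sup>2)" "integrable M (\<lambda>\<omega>. (norm (Z \<omega>))\<^sup>2)"
  shows "integrable M (\<lambda>\<omega>. (norm (Y \<omega> + Z \<omega>))\<^sup>2)"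
  by (rule Bochner_Integration.integrable_bound[where f="\<lambda>\<omega>. 2 * (norm (Y \<omega>))\<^sup>2 + 2 * (norm (Z \<omega>))\<^sup>2"])
     (use assms in \<open>auto intro: norm_add_square_le\<close>)

lemma (in prob_space) integrable_square_scaleR:
  fixes Y :: "'a \<Rightarrow> 'v::euclidean_space"
  assumes "integrable M (\<lambda>\<omega>. (norm (Y \<omega>))\<^sup>2)"
  shows "integrable M (\<lambda>\<omega>. (norm (c *\<^sub>R Y \<omega>))\<^sup>2)"
  using assms by (simp add: power_mult_distrib)

lemma integrable_matrix_component:
  fixes Z :: "'a \<Rightarrow> real^'n^'m"
  assumes "integrable M Z"
  shows "integrable M (\<lambda>\<omega>. Z \<omega> $ i $ j)"
  using integrable_bounded_linear[OF bounded_linear_compose[OF bounded_linear_vec_nth bounded_linear_vec_nth] assms] .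

lemma (in prob_space) expectation_trace_le:
  fixes Z :: "'a \<Rightarrow> real^'n^'n"
  assumes Z: "integrable M Z" and F: "subalgebra M F" and le: "AE \<omega> in M. matrix_cond_exp M F Z \<omega> \<preceq>\<^sub>L \<Sigma>"
  shows "expectation (\<lambda>\<omega>. trace (Z \<omega>)) \<le> trace \<Sigma>"
proof -
  interpret sigma_finite_subalgebra M F
    by (rule finite_measure_subalgebra_is_sigma_finite, intro finite_measure_subalgebra.intro
        finite_measure_subalgebra_axioms.intro finite_measure_axioms F)
  note int = integrable_matrix_component[OF Z]
  have "expectation (\<lambda>\<omega>. trace (Z \<omega>)) = (\<Sum>i\<in>UNIV. expectation (\<lambda>\<omega>. Z \<omega> $ i $ i))"
    unfolding trace_def using int by (rule Bochner_Integration.integral_sum)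
  also have "\<dots> = (\<Sum>i\<in>UNIV. expectation (real_cond_exp M F (\<lambda>\<omega>. Z \<omega> $ i $ i)))"
    by (simp add: real_cond_exp_int(2)[OF int])
  also have "\<dots> = expectation (\<lambda>\<omega>. trace (matrix_cond_exp M F Z \<omega>))"
    unfolding trace_def matrix_cond_exp_def vec_lambda_beta
    by (rule Bochner_Integration.integral_sum[symmetric]) (rule real_cond_exp_int(1)[OF int])
  also have "\<dots> \<le> expectation (\<lambda>\<omega>. trace \<Sigma>)"
  proof (rule integral_mono_AE)
    show "integrable M (\<lambda>\<omega>. trace (matrix_cond_exp M F Z \<omega>))"
      unfolding trace_def matrix_cond_exp_def vec_lambda_beta
      by (rule Bochner_Integration.integrable_sum) (rule real_cond_exp_int(1)[OF int])
    show "AE \<omega> in M. trace (matrix_cond_exp M F Z \<omega>) \<le> trace \<Sigma>"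
      using le
    proof eventually_elim
      case (elim \<omega>)
      then have "0 \<le> trace (\<Sigma> - matrix_cond_exp M F Z \<omega>)" unfolding loewner_le_def by (rule trace_nonneg_psd)
      then show ?case by (simp add: trace_sub)
    qed
  qed simp
  finally show ?thesis by (simp add: prob_space)
qed

locale stochastic_shampoo = prob_space P for P :: "'a measure" +
  fixes \<eta> \<theta> \<beta> lam \<epsilon> s t L sig b :: real and K :: nat
    and G X Mo :: "nat \<Rightarrow> 'a \<Rightarrow> real^'n^'m" and Lp :: "nat \<Rightarrow> 'a \<Rightarrow> real^'m^'m" and Rp :: "nat \<Rightarrow> 'a \<Rightarrow> real^'n^'n"
    and X1 :: "real^'n^'m" and f :: "real^'n^'m \<Rightarrow> real" and g :: "real^'n^'m \<Rightarrow> real^'n^'m" and f_star :: real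
  assumes trajectory: "\<And>\<omega>. \<omega> \<in> space P \<Longrightarrow> shampoo_trajectory \<eta> \<theta> \<beta> lam \<epsilon> s t K
        (\<lambda>k. G k \<omega>) (\<lambda>k. X k \<omega>) (\<lambda>k. Mo k \<omega>) (\<lambda>k. Lp k \<omega>) (\<lambda>k. Rp k \<omega>)"
    and X1: "\<And>\<omega>. \<omega> \<in> space P \<Longrightarrow> X 1 \<omega> = X1"
    and K: "K \<ge> 1"
    and deriv: "\<And>Y. GDERIV f Y :> g Y" and L: "L > 0" and lip: "\<And>Y Z. norm (g Z - g Y) \<le> L * norm (Z - Y)"
    and low: "\<And>Y. f_star \<le> f Y"
    and G_integrable: "\<And>k. k \<in> {1..K} \<Longrightarrow> integrable P (G k)"
    and unbiased: "\<And>k. k \<in> {1..K} \<Longrightarrow> AE \<omega> in P. matrix_cond_exp P (gen_sigma P G (k - 1)) (G k) \<omega> = g (X k \<omega>)"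
    and noise_integrable: "\<And>k. k \<in> {1..K} \<Longrightarrow> integrable P (\<lambda>\<omega>. (norm (G k \<omega> - g (X k \<omega>)))\<^sup>2)"
    and noise_bound: "\<And>k. k \<in> {1..K} \<Longrightarrow> expectation (\<lambda>\<omega>. (norm (G k \<omega> - g (X k \<omega>)))\<^sup>2) \<le> sig\<^sup>2"
    and sig: "sig > 0"
    and bounded: "\<And>\<omega> k v. \<omega> \<in> space P \<Longrightarrow> k \<in> {1..K + 1} \<Longrightarrow> norm (X k \<omega> *v v) \<le> b * norm v"
begin

lemma parameters: "\<eta> > 0" "0 \<le> \<theta>" "\<theta> < 1" "0 \<le> \<beta>" "\<beta> < 1" "\<beta> \<le> sqrt \<theta>" "\<epsilon> > 0" "0 \<le> s" "0 \<le> t" "s + t = 1"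
proof -
  obtain \<omega> where "\<omega> \<in> space P" using not_empty by blast
  then interpret shampoo_trajectory \<eta> \<theta> \<beta> lam \<epsilon> s t K "\<lambda>k. G k \<omega>" "\<lambda>k. X k \<omega>" "\<lambda>k. Mo k \<omega>" "\<lambda>k. Lp k \<omega>" "\<lambda>k. Rp k \<omega>"
    by (rule trajectory)
  show "\<eta> > 0" "0 \<le> \<theta>" "\<theta> < 1" "0 \<le> \<beta>" "\<beta> < 1" "\<beta> \<le> sqrt \<theta>" "\<epsilon> > 0" "0 \<le> s" "0 \<le> t" "s + t = 1"
    using \<eta> \<theta> \<beta> \<beta>_less_1 \<epsilon> st by auto
qed

abbreviation F :: "nat \<Rightarrow> 'a measure" where "F \<equiv> gen_sigma P G"

lemma G_measurable: "k \<in> {1..K} \<Longrightarrow> G k \<in> borel_measurable P"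
  using G_integrable by (rule borel_measurable_integrable)

lemma subalgebra_F: "k \<le> K \<Longrightarrow> subalgebra P (F k)"
  by (rule subalgebra_gen_sigma) (auto intro: G_measurable)

lemma F_mono: "h \<in> borel_measurable (F j) \<Longrightarrow> j \<le> k \<Longrightarrow> h \<in> borel_measurable (F k)"
  using sets_gen_sigma_mono[of j k P G] unfolding measurable_def by auto

lemma F_measurable:
  assumes "k \<le> K"
  shows "Mo k \<in> borel_measurable (F k)" "Lp k \<in> borel_measurable (F k)" "Rp k \<in> borel_measurable (F k)"
    "X (k + 1) \<in> borel_measurable (F k)"
proof -
  have "Mo k \<in> borel_measurable (F k) \<and> Lp k \<in> borel_measurable (F k) \<and> Rp k \<in> borel_measurable (F k) \<and>
    X (k + 1) \<in> borel_measurable (F k)"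
    using assms
  proof (induction k)
    case 0
    have "Mo 0 \<omega> = 0" "Lp 0 \<omega> = 0" "Rp 0 \<omega> = 0" "X 1 \<omega> = X1" if "\<omega> \<in> space (F 0)" for \<omega>
      using shampoo_trajectory.init[OF trajectory, of \<omega>] X1[of \<omega>] that by auto
    note eq = this
    have "Mo 0 \<in> borel_measurable (F 0)" "Lp 0 \<in> borel_measurable (F 0)" "Rp 0 \<in> borel_measurable (F 0)"
      "X 1 \<in> borel_measurable (F 0)"
      by (subst measurable_cong[OF eq(1)] measurable_cong[OF eq(2)] measurable_cong[OF eq(3)] measurable_cong[OF eq(4)]; simp)+
    then show ?case by simp
  next
    case (Suc k)
    then have k: "Suc k \<in> {1..K}" by simp
    have IH: "Mo k \<in> borel_measurable (F (Suc k))" "Lp k \<in> borel_measurable (F (Suc k))" "Rp k \<in> borel_measurable (F (Suc k))"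
      "X (Suc k) \<in> borel_measurable (F (Suc k))"
      using Suc by (auto intro: F_mono)
    have [measurable]: "G (Suc k) \<in> borel_measurable (F (Suc k))" by (rule measurable_gen_sigma) simp
    note [measurable] = IH
    have Mo: "Mo (Suc k) \<omega> = \<theta> *\<^sub>R Mo k \<omega> + (1 - \<theta>) *\<^sub>R G (Suc k) \<omega>"
      and Lp: "Lp (Suc k) \<omega> = \<beta> *\<^sub>R Lp k \<omega> + (1 - \<beta>) *\<^sub>R (G (Suc k) \<omega> ** transpose (G (Suc k) \<omega>))"
      and Rp: "Rp (Suc k) \<omega> = \<beta> *\<^sub>R Rp k \<omega> + (1 - \<beta>) *\<^sub>R (transpose (G (Suc k) \<omega>) ** G (Suc k) \<omega>)"
      and X: "X (Suc (Suc k)) \<omega> = (1 - lam * \<eta>) *\<^sub>R X (Suc k) \<omega> - \<eta> *\<^sub>R (matrix_powr (Lp (Suc k) \<omega> + \<epsilon> *\<^sub>R mat 1) (-s/2)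
           ** Mo (Suc k) \<omega> ** matrix_powr (Rp (Suc k) \<omega> + \<epsilon> *\<^sub>R mat 1) (-t/2))"
      if "\<omega> \<in> space (F (Suc k))" for \<omega>
      using shampoo_trajectory.Mo_step[OF trajectory k, of \<omega>] shampoo_trajectory.Lp_step[OF trajectory k, of \<omega>]
        shampoo_trajectory.Rp_step[OF trajectory k, of \<omega>] shampoo_trajectory.X_step[OF trajectory k, of \<omega>] that by simp_all
    have M1 [measurable]: "Mo (Suc k) \<in> borel_measurable (F (Suc k))"
      by (subst measurable_cong[OF Mo]) simp_all
    have L1 [measurable]: "Lp (Suc k) \<in> borel_measurable (F (Suc k))"
      by (subst measurable_cong[OF Lp]) simp_all
    have R1 [measurable]: "Rp (Suc k) \<in> borel_measurable (F (Suc k))"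
      by (subst measurable_cong[OF Rp]) simp_all
    have PL: "(\<lambda>\<omega>. matrix_powr (Lp (Suc k) \<omega> + \<epsilon> *\<^sub>R mat 1) (-s/2)) \<in> borel_measurable (F (Suc k))"
      by (rule borel_measurable_matrix_powr[OF _ parameters(7)])
         (use Suc.prems shampoo_trajectory.preconditioner_loewner(1)[OF trajectory] parameters in simp_all)
    have PR: "(\<lambda>\<omega>. matrix_powr (Rp (Suc k) \<omega> + \<epsilon> *\<^sub>R mat 1) (-t/2)) \<in> borel_measurable (F (Suc k))"
      by (rule borel_measurable_matrix_powr[OF _ parameters(7)])
         (use Suc.prems shampoo_trajectory.preconditioner_loewner(2)[OF trajectory] parameters in simp_all)
    have "X (Suc (Suc k)) \<in> borel_measurable (F (Suc k))"
      by (subst measurable_cong[OF X], assumption)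
         (intro borel_measurable_diff borel_measurable_scaleR borel_measurable_const borel_measurable_matrix_mult PL PR IH M1)
    with M1 L1 R1 show ?case by simp
  qed
  then show "Mo k \<in> borel_measurable (F k)" "Lp k \<in> borel_measurable (F k)" "Rp k \<in> borel_measurable (F k)"
    "X (k + 1) \<in> borel_measurable (F k)" by auto
qed

lemma P_measurable:
  shows Mo_measurable: "k \<le> K \<Longrightarrow> Mo k \<in> borel_measurable P"
    and X_measurable: "k \<in> {1..K + 1} \<Longrightarrow> X k \<in> borel_measurable P"
proof -
  show "Mo k \<in> borel_measurable P" if "k \<le> K"
    using measurable_from_subalg[OF subalgebra_F[OF that]] F_measurable[OF that] by blast
  show "X k \<in> borel_measurable P" if "k \<in> {1..K + 1}"
  proof -
    have k: "k - 1 \<le> K" "k - 1 + 1 = k" using that by auto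
    show ?thesis using measurable_from_subalg[OF subalgebra_F[OF k(1)] F_measurable(4)[OF k(1)]] unfolding k(2) .
  qed
qed

lemma g_continuous: "continuous_on UNIV g"
  by (rule lipschitz_on_continuous_on[of L], rule lipschitz_onI) (use L lip in \<open>auto simp: dist_norm\<close>)

lemma f_continuous: "continuous_on UNIV f"
  using deriv unfolding gderiv_def by (auto simp: continuous_on_eq_continuous_at intro: has_derivative_continuous)

lemma g_measurable: "k \<in> {1..K + 1} \<Longrightarrow> (\<lambda>\<omega>. g (X k \<omega>)) \<in> borel_measurable P"
  by (rule borel_measurable_continuous_on[OF g_continuous X_measurable])

text \<open>The iterates stay in a fixed compact ball, so every continuous function of them is integrable.\<close>

lemma integrable_continuous_iterate:
  fixes h :: "real^'n^'m \<Rightarrow> 'v::euclidean_space"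
  assumes h: "continuous_on UNIV h" and k: "k \<in> {1..K + 1}"
  shows "integrable P (\<lambda>\<omega>. h (X k \<omega>))"
proof -
  have "norm (X k \<omega>) \<le> sqrt (CARD('n)) * b" if "\<omega> \<in> space P" for \<omega>
    by (rule norm_le_of_vector_bound[OF bounded[OF that k]])
  then have ball: "X k \<omega> \<in> cball 0 (sqrt (CARD('n)) * b)" if "\<omega> \<in> space P" for \<omega> using that by simp
  have "bounded (h ` cball 0 (sqrt (CARD('n)) * b))"
    by (intro compact_imp_bounded compact_continuous_image continuous_on_subset[OF h]) auto
  then obtain B where "\<And>Y. Y \<in> cball 0 (sqrt (CARD('n)) * b) \<Longrightarrow> norm (h Y) \<le> B"
    unfolding bounded_iff by blast
  with ball have "AE \<omega> in P. norm (h (X k \<omega>)) \<le> B" by auto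
  then show ?thesis
    by (intro integrable_const_bound[where B=B] borel_measurable_continuous_on[OF h X_measurable[OF k]]) auto
qed

lemma nuclear_integrable: "k \<in> {1..K + 1} \<Longrightarrow> integrable P (\<lambda>\<omega>. nuclear_norm (g (X k \<omega>)))"
  by (rule integrable_continuous_iterate)
     (auto intro!: continuous_on_compose2[OF continuous_on_nuclear_norm g_continuous])

lemma f_integrable: "k \<in> {1..K + 1} \<Longrightarrow> integrable P (\<lambda>\<omega>. f (X k \<omega>))"
  by (rule integrable_continuous_iterate[OF f_continuous])

lemma X_square_integrable: "k \<in> {1..K + 1} \<Longrightarrow> integrable P (\<lambda>\<omega>. (norm (X k \<omega>))\<^sup>2)"
  by (rule integrable_continuous_iterate) (intro continuous_intros)

lemma g_square_integrable: "k \<in> {1..K + 1} \<Longrightarrow> integrable P (\<lambda>\<omega>. (norm (g (X k \<omega>)))\<^sup>2)"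
  by (rule integrable_continuous_iterate) (intro continuous_intros g_continuous)

lemma G_square_integrable:
  assumes "k \<in> {1..K}"
  shows "integrable P (\<lambda>\<omega>. (norm (G k \<omega>))\<^sup>2)"
proof -
  have "integrable P (\<lambda>\<omega>. (norm ((G k \<omega> - g (X k \<omega>)) + g (X k \<omega>)))\<^sup>2)"
    by (rule integrable_square_add)
       (use assms in \<open>auto intro!: borel_measurable_diff G_measurable g_measurable noise_integrable g_square_integrable\<close>)
  then show ?thesis by simp
qed

lemma Mo_square_integrable:
  assumes "k \<le> K"
  shows "integrable P (\<lambda>\<omega>. (norm (Mo k \<omega>))\<^sup>2)"
  using assms
proof (induction k)
  case 0
  have "integrable P (\<lambda>\<omega>. (norm (Mo 0 \<omega>))\<^sup>2) \<longleftrightarrow> integrable P (\<lambda>\<omega>. 0 :: real)"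
    by (rule Bochner_Integration.integrable_cong) (auto simp: shampoo_trajectory.init(1)[OF trajectory])
  then show ?case by simp
next
  case (Suc k)
  then have k: "Suc k \<in> {1..K}" by simp
  have "integrable P (\<lambda>\<omega>. (norm (\<theta> *\<^sub>R Mo k \<omega> + (1 - \<theta>) *\<^sub>R G (Suc k) \<omega>))\<^sup>2)"
    by (intro integrable_square_add integrable_square_scaleR borel_measurable_scaleR borel_measurable_const
        G_square_integrable[OF k] Mo_measurable G_measurable[OF k] Suc.IH) (use Suc in auto)
  moreover have "integrable P (\<lambda>\<omega>. (norm (Mo (Suc k) \<omega>))\<^sup>2) \<longleftrightarrow>
      integrable P (\<lambda>\<omega>. (norm (\<theta> *\<^sub>R Mo k \<omega> + (1 - \<theta>) *\<^sub>R G (Suc k) \<omega>))\<^sup>2)"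
    by (rule Bochner_Integration.integrable_cong) (auto simp: shampoo_trajectory.Mo_step[OF trajectory k])
  ultimately show ?case by simp
qed

lemma square_integrable_diff:
  fixes Y Z :: "'a \<Rightarrow> real^'n^'m"
  assumes "Y \<in> borel_measurable P" "Z \<in> borel_measurable P"
    and "integrable P (\<lambda>\<omega>. (norm (Y \<omega>))\<^sup>2)" "integrable P (\<lambda>\<omega>. (norm (Z \<omega>))\<^sup>2)"
  shows "integrable P (\<lambda>\<omega>. (norm (Y \<omega> - Z \<omega>))\<^sup>2)"
  using integrable_square_add[of Y "\<lambda>\<omega>. - Z \<omega>"] assms by simp

lemma error_integrable: "k \<in> {1..K} \<Longrightarrow> integrable P (\<lambda>\<omega>. (norm (Mo k \<omega> - g (X k \<omega>)))\<^sup>2)"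
  by (rule square_integrable_diff) (auto intro: Mo_measurable g_measurable Mo_square_integrable g_square_integrable)

lemma lag_error_integrable: "k \<in> {1..K} \<Longrightarrow> integrable P (\<lambda>\<omega>. (norm (Mo (k - 1) \<omega> - g (X k \<omega>)))\<^sup>2)"
  by (rule square_integrable_diff) (auto intro!: Mo_measurable g_measurable Mo_square_integrable g_square_integrable)

lemma step_integrable: "k \<in> {1..K} \<Longrightarrow> integrable P (\<lambda>\<omega>. (norm (X (k + 1) \<omega> - X k \<omega>))\<^sup>2)"
  by (rule square_integrable_diff) (auto intro!: X_measurable X_square_integrable)

lemma integrable_inner:
  fixes Y Z :: "'a \<Rightarrow> 'v::euclidean_space"
  assumes [measurable]: "Y \<in> borel_measurable P" "Z \<in> borel_measurable P"
    and "integrable P (\<lambda>\<omega>. (norm (Y \<omega>))\<^sup>2)" "integrable P (\<lambda>\<omega>. (norm (Z \<omega>))\<^sup>2)"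
  shows "integrable P (\<lambda>\<omega>. Y \<omega> \<bullet> Z \<omega>)"
proof (rule Bochner_Integration.integrable_bound[where f="\<lambda>\<omega>. (norm (Y \<omega>))\<^sup>2 + (norm (Z \<omega>))\<^sup>2"])
  have "\<bar>y \<bullet> z\<bar> \<le> (norm y)\<^sup>2 + (norm z)\<^sup>2" for y z :: 'v
  proof -
    have "\<bar>y \<bullet> z\<bar> \<le> norm y * norm z" by (rule Cauchy_Schwarz_ineq2)
    moreover have "2 * (norm y * norm z) \<le> (norm y)\<^sup>2 + (norm z)\<^sup>2"
      using sum_squares_bound[of "norm y" "norm z"] by (simp only: mult.assoc)
    moreover have "0 \<le> norm y * norm z" by simp
    ultimately show ?thesis by linarith
  qed
  then show "AE \<omega> in P. norm (Y \<omega> \<bullet> Z \<omega>) \<le> norm ((norm (Y \<omega>))\<^sup>2 + (norm (Z \<omega>))\<^sup>2)" by simp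
qed (use assms in auto)

lemma noise_orthogonal:
  assumes k: "k \<in> {1..K}"
  shows "expectation (\<lambda>\<omega>. (Mo (k - 1) \<omega> - g (X k \<omega>)) \<bullet> (G k \<omega> - g (X k \<omega>))) = 0"
proof -
  define h where "h \<omega> = Mo (k - 1) \<omega> - g (X k \<omega>)" for \<omega>
  have k': "k - 1 \<le> K" "k - 1 + 1 = k" using k by auto
  interpret sigma_finite_subalgebra P "F (k - 1)"
    by (rule finite_measure_subalgebra_is_sigma_finite, intro finite_measure_subalgebra.intro
        finite_measure_subalgebra_axioms.intro finite_measure_axioms subalgebra_F[OF k'(1)])
  have X_F: "X k \<in> borel_measurable (F (k - 1))" using F_measurable(4)[OF k'(1)] k'(2) by simp
  have h_F: "h \<in> borel_measurable (F (k - 1))"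
    unfolding h_def by (intro borel_measurable_diff F_measurable(1)[OF k'(1)] borel_measurable_continuous_on[OF g_continuous X_F])
  have h_P: "h \<in> borel_measurable P" by (rule measurable_from_subalg[OF subalgebra_F[OF k'(1)] h_F])
  have h2: "integrable P (\<lambda>\<omega>. (norm (h \<omega>))\<^sup>2)" unfolding h_def by (rule lag_error_integrable[OF k])
  have comp: "integrable P (\<lambda>\<omega>. (norm (Y \<omega> $ i $ j))\<^sup>2)" "(\<lambda>\<omega>. Y \<omega> $ i $ j) \<in> borel_measurable P"
    if [measurable]: "Y \<in> borel_measurable P" and "integrable P (\<lambda>\<omega>. (norm (Y \<omega>))\<^sup>2)" for Y :: "'a \<Rightarrow> real^'n^'m" and i j
  proof -
    have cont: "continuous_on UNIV (\<lambda>Y :: real^'n^'m. Y $ i $ j)" by (intro continuous_intros)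
    show [measurable]: "(\<lambda>\<omega>. Y \<omega> $ i $ j) \<in> borel_measurable P"
      by (rule borel_measurable_continuous_on[OF cont]) fact
    have "norm (Y \<omega> $ i $ j) \<le> norm (Y \<omega>)" for \<omega> by (rule order_trans[OF Finite_Cartesian_Product.norm_nth_le Finite_Cartesian_Product.norm_nth_le])
    then have "(norm (Y \<omega> $ i $ j))\<^sup>2 \<le> (norm (Y \<omega>))\<^sup>2" for \<omega> by (rule power_mono) simp
    then show "integrable P (\<lambda>\<omega>. (norm (Y \<omega> $ i $ j))\<^sup>2)"
      by (intro Bochner_Integration.integrable_bound[OF that(2)]) (simp_all add: that(1))
  qed
  have prod: "integrable P (\<lambda>\<omega>. h \<omega> $ i $ j * Y \<omega> $ i $ j)"
    if "Y \<in> borel_measurable P" "integrable P (\<lambda>\<omega>. (norm (Y \<omega>))\<^sup>2)" for Y i j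
    using integrable_inner[OF comp(2)[OF h_P h2] comp(2)[OF that] comp(1)[OF h_P h2] comp(1)[OF that], of i j i j] by simp
  have GP: "G k \<in> borel_measurable P" "integrable P (\<lambda>\<omega>. (norm (G k \<omega>))\<^sup>2)"
    using G_measurable[OF k] G_square_integrable[OF k] by auto
  have gP: "(\<lambda>\<omega>. g (X k \<omega>)) \<in> borel_measurable P" "integrable P (\<lambda>\<omega>. (norm (g (X k \<omega>)))\<^sup>2)"
    using g_measurable[of k] g_square_integrable[of k] k by auto
  have eq: "expectation (\<lambda>\<omega>. h \<omega> $ i $ j * G k \<omega> $ i $ j) = expectation (\<lambda>\<omega>. h \<omega> $ i $ j * g (X k \<omega>) $ i $ j)" for i j
  proof -
    have "(\<lambda>\<omega>. h \<omega> $ i $ j) \<in> borel_measurable (F (k - 1))"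
      by (rule borel_measurable_continuous_on[OF _ h_F]) (intro continuous_intros)
    from real_cond_exp_intg(2)[OF prod[OF GP] this comp(2)[OF GP]]
    have "expectation (\<lambda>\<omega>. h \<omega> $ i $ j * G k \<omega> $ i $ j) =
        expectation (\<lambda>\<omega>. h \<omega> $ i $ j * real_cond_exp P (F (k - 1)) (\<lambda>\<omega>. G k \<omega> $ i $ j) \<omega>)" by simp
    also have "\<dots> = expectation (\<lambda>\<omega>. h \<omega> $ i $ j * g (X k \<omega>) $ i $ j)"
    proof (rule integral_cong_AE)
      show "AE \<omega> in P. h \<omega> $ i $ j * real_cond_exp P (F (k - 1)) (\<lambda>\<omega>. G k \<omega> $ i $ j) \<omega> = h \<omega> $ i $ j * g (X k \<omega>) $ i $ j"
        using unbiased[OF k] by eventually_elim (auto simp: matrix_cond_exp_def vec_eq_iff)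
      show "(\<lambda>\<omega>. h \<omega> $ i $ j * real_cond_exp P (F (k - 1)) (\<lambda>\<omega>. G k \<omega> $ i $ j) \<omega>) \<in> borel_measurable P"
        by (intro borel_measurable_times comp(2)[OF h_P h2] borel_measurable_cond_exp2)
    qed (intro borel_measurable_integrable prod gP)
    finally show ?thesis .
  qed
  have "expectation (\<lambda>\<omega>. h \<omega> \<bullet> (G k \<omega> - g (X k \<omega>))) =
      (\<Sum>i\<in>UNIV. \<Sum>j\<in>UNIV. expectation (\<lambda>\<omega>. h \<omega> $ i $ j * G k \<omega> $ i $ j) - expectation (\<lambda>\<omega>. h \<omega> $ i $ j * g (X k \<omega>) $ i $ j))"
    unfolding inner_matrix by (simp add: right_diff_distrib prod[OF GP] prod[OF gP])
  then have "expectation (\<lambda>\<omega>. h \<omega> \<bullet> (G k \<omega> - g (X k \<omega>))) = 0" unfolding eq by simp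
  then show ?thesis unfolding h_def .
qed

abbreviation "step2 k \<equiv> expectation (\<lambda>\<omega>. (norm (X (k + 1) \<omega> - X k \<omega>))\<^sup>2)"
abbreviation "error2 k \<equiv> expectation (\<lambda>\<omega>. (norm (Mo k \<omega> - g (X k \<omega>)))\<^sup>2)"
abbreviation "mean_nuclear k \<equiv> expectation (\<lambda>\<omega>. nuclear_norm (g (X k \<omega>)))"

lemma error_step:
  assumes k: "k \<in> {1..K}"
  shows "error2 k \<le> \<theta>\<^sup>2 * expectation (\<lambda>\<omega>. (norm (Mo (k - 1) \<omega> - g (X k \<omega>)))\<^sup>2) + (1 - \<theta>)\<^sup>2 * sig\<^sup>2"
proof -
  define h where "h \<omega> = Mo (k - 1) \<omega> - g (X k \<omega>)" for \<omega>
  define \<xi> where "\<xi> \<omega> = G k \<omega> - g (X k \<omega>)" for \<omega>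
  have k': "k - 1 \<le> K" "k \<in> {1..K + 1}" using k by auto
  have meas: "h \<in> borel_measurable P" "\<xi> \<in> borel_measurable P"
    unfolding h_def \<xi>_def
    by (intro borel_measurable_diff Mo_measurable g_measurable G_measurable k k')+
  have sq: "integrable P (\<lambda>\<omega>. (norm (h \<omega>))\<^sup>2)" "integrable P (\<lambda>\<omega>. (norm (\<xi> \<omega>))\<^sup>2)"
    unfolding h_def \<xi>_def by (rule lag_error_integrable[OF k] noise_integrable[OF k])+
  have "error2 k = expectation (\<lambda>\<omega>. \<theta>\<^sup>2 * (norm (h \<omega>))\<^sup>2 + 2 * \<theta> * (1 - \<theta>) * (h \<omega> \<bullet> \<xi> \<omega>) + (1 - \<theta>)\<^sup>2 * (norm (\<xi> \<omega>))\<^sup>2)"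
  proof (rule Bochner_Integration.integral_cong[OF refl])
    fix \<omega> assume \<omega>: "\<omega> \<in> space P"
    have "Mo k \<omega> - g (X k \<omega>) = \<theta> *\<^sub>R h \<omega> + (1 - \<theta>) *\<^sub>R \<xi> \<omega>"
      unfolding shampoo_trajectory.Mo_step[OF trajectory[OF \<omega>] k] h_def \<xi>_def by (simp add: algebra_simps)
    then show "(norm (Mo k \<omega> - g (X k \<omega>)))\<^sup>2 = \<theta>\<^sup>2 * (norm (h \<omega>))\<^sup>2 + 2 * \<theta> * (1 - \<theta>) * (h \<omega> \<bullet> \<xi> \<omega>) + (1 - \<theta>)\<^sup>2 * (norm (\<xi> \<omega>))\<^sup>2"
      by (simp only: power2_norm_eq_inner inner_add_left inner_add_right inner_scaleR_left inner_scaleR_right inner_commute[of "\<xi> \<omega>" "h \<omega>"])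
         (simp add: power2_eq_square algebra_simps)
  qed
  also have "\<dots> = \<theta>\<^sup>2 * expectation (\<lambda>\<omega>. (norm (h \<omega>))\<^sup>2) + 2 * \<theta> * (1 - \<theta>) * expectation (\<lambda>\<omega>. h \<omega> \<bullet> \<xi> \<omega>)
      + (1 - \<theta>)\<^sup>2 * expectation (\<lambda>\<omega>. (norm (\<xi> \<omega>))\<^sup>2)"
    using sq integrable_inner[OF meas sq] by simp
  also have "expectation (\<lambda>\<omega>. h \<omega> \<bullet> \<xi> \<omega>) = 0" unfolding h_def \<xi>_def by (rule noise_orthogonal[OF k])
  also have "(1 - \<theta>)\<^sup>2 * expectation (\<lambda>\<omega>. (norm (\<xi> \<omega>))\<^sup>2) \<le> (1 - \<theta>)\<^sup>2 * sig\<^sup>2"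
    unfolding \<xi>_def by (intro mult_left_mono noise_bound[OF k]) simp
  finally show ?thesis by (simp add: h_def)
qed

lemma error_first: "error2 1 \<le> 2 * L * (f X1 - f_star) + (1 - \<theta>)\<^sup>2 * sig\<^sup>2"
proof -
  have "expectation (\<lambda>\<omega>. (norm (Mo (1 - 1) \<omega> - g (X 1 \<omega>)))\<^sup>2) = expectation (\<lambda>\<omega>. (norm (g X1))\<^sup>2)"
    by (rule Bochner_Integration.integral_cong) (auto simp: shampoo_trajectory.init(1)[OF trajectory] X1[unfolded One_nat_def])
  then have "error2 1 \<le> \<theta>\<^sup>2 * (norm (g X1))\<^sup>2 + (1 - \<theta>)\<^sup>2 * sig\<^sup>2"
    using error_step[of 1] K by (simp add: prob_space)
  moreover have "\<theta>\<^sup>2 * (norm (g X1))\<^sup>2 \<le> 1 * (2 * L * (f X1 - f_star))"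
    by (intro mult_mono smooth_gradient_bound[OF deriv lip L low]) (use parameters in \<open>auto simp: power_le_one\<close>)
  ultimately show ?thesis by simp
qed

lemma error_next:
  assumes k: "k \<in> {1..<K}"
  shows "error2 (Suc k) \<le> \<theta> * error2 k + L\<^sup>2 / (1 - \<theta>) * step2 k + (1 - \<theta>)\<^sup>2 * sig\<^sup>2"
proof -
  have k': "k \<in> {1..K}" "Suc k \<in> {1..K}" using k by auto
  have young: "\<theta>\<^sup>2 * (norm (u + v))\<^sup>2 \<le> \<theta> * (norm u)\<^sup>2 + 1 / (1 - \<theta>) * (norm v)\<^sup>2" for u v :: "real^'n^'m"
  proof -
    have th: "0 \<le> \<theta>" "\<theta> < 1" using parameters by auto
    have "0 \<le> \<theta> / (1 - \<theta>) * (norm ((1 - \<theta>) *\<^sub>R u - \<theta> *\<^sub>R v))\<^sup>2" using th by simp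
    also have "\<dots> = \<theta> / (1 - \<theta>) * ((1 - \<theta>)\<^sup>2 * (norm u)\<^sup>2 - 2 * \<theta> * (1 - \<theta>) * (u \<bullet> v) + \<theta>\<^sup>2 * (norm v)\<^sup>2)"
      by (simp only: power2_norm_eq_inner inner_diff_left inner_diff_right inner_scaleR_left inner_scaleR_right inner_commute[of v u])
         (simp add: power2_eq_square algebra_simps)
    also have "\<dots> = \<theta> * (1 - \<theta>) * (norm u)\<^sup>2 - 2 * \<theta>\<^sup>2 * (u \<bullet> v) + \<theta> ^ 3 / (1 - \<theta>) * (norm v)\<^sup>2"
      using th by (simp add: divide_simps) (simp add: power2_eq_square power3_eq_cube algebra_simps)
    finally have 1: "2 * \<theta>\<^sup>2 * (u \<bullet> v) \<le> \<theta> * (1 - \<theta>) * (norm u)\<^sup>2 + \<theta> ^ 3 / (1 - \<theta>) * (norm v)\<^sup>2" by simp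
    have "(norm (u + v))\<^sup>2 = (norm u)\<^sup>2 + 2 * (u \<bullet> v) + (norm v)\<^sup>2"
      by (simp add: power2_norm_eq_inner inner_add_left inner_add_right inner_commute[of v u])
    then have "\<theta>\<^sup>2 * (norm (u + v))\<^sup>2 = \<theta>\<^sup>2 * (norm u)\<^sup>2 + 2 * \<theta>\<^sup>2 * (u \<bullet> v) + \<theta>\<^sup>2 * (norm v)\<^sup>2"
      by (simp add: algebra_simps)
    also have "\<dots> \<le> \<theta> * (norm u)\<^sup>2 + (\<theta> ^ 3 / (1 - \<theta>) + \<theta>\<^sup>2) * (norm v)\<^sup>2"
      using 1 by (simp add: power2_eq_square algebra_simps)
    also have "\<theta> ^ 3 / (1 - \<theta>) + \<theta>\<^sup>2 = \<theta>\<^sup>2 / (1 - \<theta>)"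
      using th by (simp add: divide_simps power2_eq_square power3_eq_cube algebra_simps)
    also have "\<theta> * (norm u)\<^sup>2 + \<theta>\<^sup>2 / (1 - \<theta>) * (norm v)\<^sup>2 \<le> \<theta> * (norm u)\<^sup>2 + 1 / (1 - \<theta>) * (norm v)\<^sup>2"
      using th by (intro add_left_mono mult_right_mono divide_right_mono) (auto simp: power_le_one)
    finally show ?thesis .
  qed
  have "\<theta>\<^sup>2 * expectation (\<lambda>\<omega>. (norm (Mo k \<omega> - g (X (Suc k) \<omega>)))\<^sup>2)
      = expectation (\<lambda>\<omega>. \<theta>\<^sup>2 * (norm (Mo k \<omega> - g (X (Suc k) \<omega>)))\<^sup>2)" by simp
  also have "\<dots> \<le> expectation (\<lambda>\<omega>. \<theta> * (norm (Mo k \<omega> - g (X k \<omega>)))\<^sup>2 + L\<^sup>2 / (1 - \<theta>) * (norm (X (k + 1) \<omega> - X k \<omega>))\<^sup>2)"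
  proof (rule integral_mono)
    show "integrable P (\<lambda>\<omega>. \<theta>\<^sup>2 * (norm (Mo k \<omega> - g (X (Suc k) \<omega>)))\<^sup>2)"
      using lag_error_integrable[OF k'(2)] by simp
    show "integrable P (\<lambda>\<omega>. \<theta> * (norm (Mo k \<omega> - g (X k \<omega>)))\<^sup>2 + L\<^sup>2 / (1 - \<theta>) * (norm (X (k + 1) \<omega> - X k \<omega>))\<^sup>2)"
      by (intro Bochner_Integration.integrable_add integrable_mult_right error_integrable[OF k'(1)] step_integrable[OF k'(1)])
    fix \<omega>
    have "\<theta>\<^sup>2 * (norm ((Mo k \<omega> - g (X k \<omega>)) + (g (X k \<omega>) - g (X (Suc k) \<omega>))))\<^sup>2
      \<le> \<theta> * (norm (Mo k \<omega> - g (X k \<omega>)))\<^sup>2 + 1 / (1 - \<theta>) * (norm (g (X k \<omega>) - g (X (Suc k) \<omega>)))\<^sup>2" by (rule young)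
    also have "\<dots> \<le> \<theta> * (norm (Mo k \<omega> - g (X k \<omega>)))\<^sup>2 + 1 / (1 - \<theta>) * (L * norm (X k \<omega> - X (Suc k) \<omega>))\<^sup>2"
      using parameters by (intro add_left_mono mult_left_mono power_mono lip) auto
    finally show "\<theta>\<^sup>2 * (norm (Mo k \<omega> - g (X (Suc k) \<omega>)))\<^sup>2 \<le> \<theta> * (norm (Mo k \<omega> - g (X k \<omega>)))\<^sup>2 + L\<^sup>2 / (1 - \<theta>) * (norm (X (k + 1) \<omega> - X k \<omega>))\<^sup>2"
      by (simp add: power_mult_distrib norm_minus_commute)
  qed
  also have "\<dots> = \<theta> * error2 k + L\<^sup>2 / (1 - \<theta>) * step2 k"
    using error_integrable[OF k'(1)] step_integrable[OF k'(1)] by simp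
  finally show ?thesis using error_step[OF k'(2)] by simp
qed

lemma error_sum:
  "(1 - \<theta>) * (\<Sum>k=1..K. error2 k) \<le> 2 * L * (f X1 - f_star) + K * ((1 - \<theta>)\<^sup>2 * sig\<^sup>2) + L\<^sup>2 / (1 - \<theta>) * (\<Sum>k=1..K. step2 k)"
  by (rule error_recursion_sum[OF error_first error_next K]) (use parameters in auto)

lemma expected_descent:
  fixes \<mu> :: real
  defines "\<mu> \<equiv> sqrt (real CARD('m) + real CARD('n))"
  assumes e: "e > 0" and k: "k \<in> {1..K}"
    and cond: "AE \<omega> in P. e *\<^sub>R mat 1 \<preceq>\<^sub>L Lp k \<omega> + \<epsilon> *\<^sub>R mat 1 \<and> e *\<^sub>R mat 1 \<preceq>\<^sub>L Rp k \<omega> + \<epsilon> *\<^sub>R mat 1"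
    and q: "x\<^sup>2 / 2 + lam\<^sup>2 * b\<^sup>2 \<le> q" and \<mu>\<epsilon>: "\<mu> * sqrt \<epsilon> \<le> sig"
  shows "expectation (\<lambda>\<omega>. f (X (k + 1) \<omega>)) \<le> expectation (\<lambda>\<omega>. f (X k \<omega>)) - \<eta> * x * mean_nuclear k
     + \<eta> * q * ((\<Sum>i=1..k. sqrt (ema_weight \<beta> k i) * mean_nuclear i) + 2 * \<mu> * sig)
     - (sqrt e / (2 * \<eta>) - L / 2) * step2 k + \<eta> / sqrt e * error2 k"
proof -
  have ik: "i \<in> {1..K + 1}" "i \<in> {1..K}" if "i \<in> {1..k}" for i using that k by auto
  have k1: "k \<in> {1..K + 1}" "k + 1 \<in> {1..K + 1}" using k by auto
  let ?N = "\<lambda>\<omega>. \<Sum>i=1..k. sqrt (ema_weight \<beta> k i) * nuclear_norm (g (X i \<omega>))"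
  let ?S = "\<lambda>\<omega>. \<Sum>i=1..k. ema_weight \<beta> k i * (norm (G i \<omega> - g (X i \<omega>)))\<^sup>2"
  let ?R = "\<lambda>\<omega>. f (X k \<omega>) - \<eta> * x * nuclear_norm (g (X k \<omega>)) + \<eta> * q * (?N \<omega> + \<mu> * sig / 2 + \<mu> / (2 * sig) * ?S \<omega> + \<mu>\<^sup>2 * sqrt \<epsilon>)
     - (sqrt e / (2 * \<eta>) - L / 2) * (norm (X (k + 1) \<omega> - X k \<omega>))\<^sup>2 + \<eta> / sqrt e * (norm (Mo k \<omega> - g (X k \<omega>)))\<^sup>2"
  have int_N: "integrable P ?N"
    by (intro Bochner_Integration.integrable_sum integrable_mult_right nuclear_integrable ik)
  have int_S: "integrable P ?S"
    by (intro Bochner_Integration.integrable_sum integrable_mult_right noise_integrable ik)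
  have ints: "integrable P (\<lambda>\<omega>. f (X k \<omega>))" "integrable P (\<lambda>\<omega>. nuclear_norm (g (X k \<omega>)))"
    "integrable P (\<lambda>\<omega>. (norm (X (k + 1) \<omega> - X k \<omega>))\<^sup>2)" "integrable P (\<lambda>\<omega>. (norm (Mo k \<omega> - g (X k \<omega>)))\<^sup>2)"
    by (rule f_integrable[OF k1(1)] nuclear_integrable[OF k1(1)] step_integrable[OF k] error_integrable[OF k])+
  have "AE \<omega> in P. f (X (k + 1) \<omega>) \<le> ?R \<omega>"
    using cond AE_space
  proof eventually_elim
    fix \<omega>
    assume "e *\<^sub>R mat 1 \<preceq>\<^sub>L Lp k \<omega> + \<epsilon> *\<^sub>R mat 1 \<and> e *\<^sub>R mat 1 \<preceq>\<^sub>L Rp k \<omega> + \<epsilon> *\<^sub>R mat 1" and \<omega>: "\<omega> \<in> space P"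
    then show "f (X (k + 1) \<omega>) \<le> ?R \<omega>"
      unfolding \<mu>_def
      by (intro shampoo_trajectory.accumulated_descent_step[OF trajectory[OF \<omega>] deriv lip e _ _ bounded[OF \<omega> k1(1)] k sig q]) auto
  qed
  then have "expectation (\<lambda>\<omega>. f (X (k + 1) \<omega>)) \<le> expectation ?R"
    by (intro integral_mono_AE f_integrable[OF k1(2)]) (use ints int_N int_S in simp_all)
  also have "\<dots> = expectation (\<lambda>\<omega>. f (X k \<omega>)) - \<eta> * x * mean_nuclear k
     + \<eta> * q * (expectation ?N + \<mu> * sig / 2 + \<mu> / (2 * sig) * expectation ?S + \<mu>\<^sup>2 * sqrt \<epsilon>)
     - (sqrt e / (2 * \<eta>) - L / 2) * step2 k + \<eta> / sqrt e * error2 k"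
    using ints int_N int_S by (simp add: prob_space)
  also have "expectation ?N = (\<Sum>i=1..k. sqrt (ema_weight \<beta> k i) * mean_nuclear i)"
    using nuclear_integrable ik by (subst Bochner_Integration.integral_sum) auto
  also have "\<eta> * q * ((\<Sum>i=1..k. sqrt (ema_weight \<beta> k i) * mean_nuclear i) + \<mu> * sig / 2 + \<mu> / (2 * sig) * expectation ?S + \<mu>\<^sup>2 * sqrt \<epsilon>)
      \<le> \<eta> * q * ((\<Sum>i=1..k. sqrt (ema_weight \<beta> k i) * mean_nuclear i) + 2 * \<mu> * sig)"
  proof (rule mult_left_mono)
    have \<mu>: "0 \<le> \<mu>" by (simp add: \<mu>_def)
    have "expectation ?S = (\<Sum>i=1..k. ema_weight \<beta> k i * expectation (\<lambda>\<omega>. (norm (G i \<omega> - g (X i \<omega>)))\<^sup>2))"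
      using noise_integrable ik by (subst Bochner_Integration.integral_sum) auto
    also have "\<dots> \<le> (\<Sum>i=1..k. ema_weight \<beta> k i * sig\<^sup>2)"
      using parameters by (intro sum_mono mult_left_mono noise_bound ik) (auto simp: ema_weight_def)
    also have "\<dots> \<le> 1 * sig\<^sup>2"
      unfolding sum_distrib_right[symmetric] using parameters by (intro mult_right_mono sum_ema_weight_le_1) auto
    finally have "\<mu> / (2 * sig) * expectation ?S \<le> \<mu> / (2 * sig) * sig\<^sup>2"
      using \<mu> sig by (intro mult_left_mono) auto
    also have "\<dots> = \<mu> * sig / 2" using sig by (simp add: power2_eq_square)
    finally have 1: "\<mu> / (2 * sig) * expectation ?S \<le> \<mu> * sig / 2" .
    have "\<mu>\<^sup>2 * sqrt \<epsilon> \<le> \<mu> * sig" using mult_left_mono[OF \<mu>\<epsilon> \<mu>] by (simp add: power2_eq_square)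
    with 1 show "(\<Sum>i=1..k. sqrt (ema_weight \<beta> k i) * mean_nuclear i) + \<mu> * sig / 2 + \<mu> / (2 * sig) * expectation ?S + \<mu>\<^sup>2 * sqrt \<epsilon>
      \<le> (\<Sum>i=1..k. sqrt (ema_weight \<beta> k i) * mean_nuclear i) + 2 * \<mu> * sig" by simp
    have "0 \<le> q" by (rule order_trans[OF _ q]) simp
    then show "0 \<le> \<eta> * q" using parameters by simp
  qed
  finally show ?thesis by simp
qed

lemma summed_descent:
  fixes \<mu> :: real
  defines "\<mu> \<equiv> sqrt (real CARD('m) + real CARD('n))"
  assumes e: "e > 0"
    and cond: "AE \<omega> in P. \<forall>k\<in>{1..K}. e *\<^sub>R mat 1 \<preceq>\<^sub>L Lp k \<omega> + \<epsilon> *\<^sub>R mat 1 \<and> e *\<^sub>R mat 1 \<preceq>\<^sub>L Rp k \<omega> + \<epsilon> *\<^sub>R mat 1"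
    and q: "x\<^sup>2 / 2 + lam\<^sup>2 * b\<^sup>2 \<le> q" and \<mu>\<epsilon>: "\<mu> * sqrt \<epsilon> \<le> sig"
  shows "\<eta> * x * (\<Sum>k=1..K. mean_nuclear k) \<le> f X1 - f_star
     + \<eta> * q * (3 / sqrt (1 - \<theta>) * (\<Sum>k=1..K. mean_nuclear k) + K * (2 * \<mu> * sig))
     - (sqrt e / (2 * \<eta>) - L / 2) * (\<Sum>k=1..K. step2 k) + \<eta> / sqrt e * (\<Sum>k=1..K. error2 k)"
proof -
  let ?W = "\<lambda>k. \<Sum>i=1..k. sqrt (ema_weight \<beta> k i) * mean_nuclear i"
  let ?d = "\<lambda>k. - \<eta> * x * mean_nuclear k + \<eta> * q * (?W k + 2 * \<mu> * sig)
     - (sqrt e / (2 * \<eta>) - L / 2) * step2 k + \<eta> / sqrt e * error2 k"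
  have "expectation (\<lambda>\<omega>. f (X (n + 1) \<omega>)) \<le> f X1 + (\<Sum>k=1..n. ?d k)" if "n \<le> K" for n
    using that
  proof (induction n)
    case 0
    have "expectation (\<lambda>\<omega>. f (X (0 + 1) \<omega>)) = expectation (\<lambda>\<omega>. f X1)"
      by (rule Bochner_Integration.integral_cong) (simp_all add: X1[unfolded One_nat_def])
    then show ?case by (simp add: prob_space)
  next
    case (Suc n)
    have c: "AE \<omega> in P. e *\<^sub>R mat 1 \<preceq>\<^sub>L Lp (Suc n) \<omega> + \<epsilon> *\<^sub>R mat 1 \<and> e *\<^sub>R mat 1 \<preceq>\<^sub>L Rp (Suc n) \<omega> + \<epsilon> *\<^sub>R mat 1"
      by (rule eventually_mono[OF cond]) (use Suc.prems in auto)
    show ?case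
      using expected_descent[OF e _ c q \<mu>\<epsilon>[unfolded \<mu>_def], folded \<mu>_def] Suc by simp
  qed
  from this[of K] have 1: "expectation (\<lambda>\<omega>. f (X (K + 1) \<omega>)) \<le> f X1 + (\<Sum>k=1..K. ?d k)" by simp
  have "f_star = expectation (\<lambda>\<omega>. f_star)" by (simp add: prob_space)
  also have "\<dots> \<le> expectation (\<lambda>\<omega>. f (X (K + 1) \<omega>))" by (intro integral_mono f_integrable low) auto
  finally have 2: "f_star \<le> expectation (\<lambda>\<omega>. f (X (K + 1) \<omega>))" .
  have 3: "(\<Sum>k=1..K. ?d k) = - \<eta> * x * (\<Sum>k=1..K. mean_nuclear k) + \<eta> * q * ((\<Sum>k=1..K. ?W k) + K * (2 * \<mu> * sig))
     - (sqrt e / (2 * \<eta>) - L / 2) * (\<Sum>k=1..K. step2 k) + \<eta> / sqrt e * (\<Sum>k=1..K. error2 k)"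
    by (simp add: sum.distrib sum_subtractf sum_distrib_left[symmetric] sum_divide_distrib[symmetric] sum_negf)
  have "(\<Sum>k=1..K. ?W k) \<le> 3 / sqrt (1 - \<theta>) * (\<Sum>k=1..K. mean_nuclear k)"
    by (rule sum_sqrt_ema_weight_le) (use parameters in \<open>auto intro!: Bochner_Integration.integral_nonneg nuclear_norm_nonneg\<close>)
  moreover have "0 \<le> \<eta> * q"
  proof -
    have "0 \<le> q" by (rule order_trans[OF _ q]) simp
    then show ?thesis using parameters by simp
  qed
  ultimately have "\<eta> * q * ((\<Sum>k=1..K. ?W k) + K * (2 * \<mu> * sig)) \<le> \<eta> * q * (3 / sqrt (1 - \<theta>) * (\<Sum>k=1..K. mean_nuclear k) + K * (2 * \<mu> * sig))"
    by (intro mult_left_mono) auto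
  with 1 2 3 show ?thesis by simp
qed

end

subsection \<open>The convergence rate\<close>

lemma convergence_rate_arithmetic:
  fixes S W E a h e L D \<mu> \<kappa> \<eta> :: real
  assumes pos: "0 < a" "a \<le> 1" "0 < h" "0 < e" "0 < L" "0 < \<kappa>" "0 \<le> \<mu>" "0 \<le> W"
    and D: "D = \<kappa> * h\<^sup>2 * a\<^sup>2 / L" and \<eta>: "\<eta> = sqrt e * a / (2 * L)"
    and descent: "\<eta> * (sqrt a / 10) * S \<le> D + \<eta> * (a / 200 + a / 288) * (3 / sqrt a * S + \<kappa> * (2 * \<mu> * h))
        - (sqrt e / (2 * \<eta>) - L / 2) * W + \<eta> / sqrt e * E"
    and error: "a * E \<le> 2 * L * D + \<kappa> * (a\<^sup>2 * h\<^sup>2) + L\<^sup>2 / a * W"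
  shows "S \<le> \<kappa> * ((8 * \<mu> + 119 * h / sqrt e) * (h * sqrt a))"
proof -
  define r where "r = sqrt a"
  have r: "r > 0" "a = r\<^sup>2" using pos by (auto simp: r_def)
  have se: "sqrt e > 0" using pos by simp
  have \<eta>pos: "\<eta> > 0" using pos by (simp add: \<eta>)
  have 1: "\<eta> / sqrt e * E = (a * E) / (2 * L)" using se by (simp add: \<eta>)
  have 2: "sqrt e / (2 * \<eta>) = L / a" using pos by (simp add: \<eta>)
  have "(a * E) / (2 * L) \<le> (2 * L * D + \<kappa> * (a\<^sup>2 * h\<^sup>2) + L\<^sup>2 / a * W) / (2 * L)"
    using error pos by (intro divide_right_mono) auto
  also have "\<dots> = 3 / 2 * D + L / (2 * a) * W"
    using pos by (simp add: D divide_simps) (simp add: power2_eq_square algebra_simps)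
  finally have 3: "\<eta> / sqrt e * E \<le> 3 / 2 * D + L / (2 * a) * W" unfolding 1 .
  have "L / 2 \<le> L / (2 * a)" using pos by (simp add: field_simps)
  then have "L / (2 * a) * W \<le> (L / a - L / 2) * W"
    using pos by (intro mult_right_mono) (auto simp: field_simps)
  with descent 3 have 4: "\<eta> * (sqrt a / 10) * S \<le> 5 / 2 * D + \<eta> * (a / 200 + a / 288) * (3 / sqrt a * S + \<kappa> * (2 * \<mu> * h))"
    unfolding 2 by linarith
  define u where "u = \<kappa> * h\<^sup>2 * r / sqrt e"
  define v where "v = \<kappa> * \<mu> * h * r"
  have uv: "0 \<le> u" "0 \<le> v" using pos r by (auto simp: u_def v_def)
  have D': "5 / 2 * D = \<eta> * r * (5 * u)"
    using pos r(1) se unfolding D \<eta> u_def r(2) by (simp add: divide_simps) (simp add: power2_eq_square power4_eq_xxxx)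
  have "(a / 200 + a / 288) * (3 / sqrt a * S + \<kappa> * (2 * \<mu> * h)) = r * ((61 / 7200) * (3 * S + 2 * v))"
    using r by (simp add: r_def[symmetric] v_def divide_simps) (simp add: power2_eq_square algebra_simps)
  then have 5: "\<eta> * (a / 200 + a / 288) * (3 / sqrt a * S + \<kappa> * (2 * \<mu> * h)) = \<eta> * r * ((61 / 7200) * (3 * S + 2 * v))"
    by (simp only: mult.assoc)
  have "\<eta> * (sqrt a / 10) * S = \<eta> * r * (S / 10)" by (simp add: r_def)
  then have "\<eta> * r * (S / 10) \<le> \<eta> * r * (5 * u + (61 / 7200) * (3 * S + 2 * v))"
    using 4 unfolding 5 D' by (simp only: distrib_left)
  then have "S / 10 \<le> 5 * u + (61 / 7200) * (3 * S + 2 * v)" using \<eta>pos r(1) by simp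
  then have "S \<le> 119 * u + 8 * v" using uv by (simp add: field_simps)
  also have "\<dots> = \<kappa> * ((8 * \<mu> + 119 * h / sqrt e) * (h * sqrt a))"
    using se by (simp add: u_def v_def r_def field_simps power2_eq_square)
  finally show ?thesis .
qed

lemma preconditioner_exponents:
  fixes p q :: ereal
  assumes "p > 0" "q > 0" "1 / p + 1 / q = 1"
  obtains s t where "0 \<le> s" "0 \<le> t" "s + t = 1" "real_of_ereal (- 1 / (2 * p)) = - s / 2" "real_of_ereal (- 1 / (2 * q)) = - t / 2"
proof -
  have *: "0 \<le> real_of_ereal (1 / x)" "real_of_ereal (- 1 / (2 * x)) = - real_of_ereal (1 / x) / 2" "1 / x = ereal (real_of_ereal (1 / x))"
    if "x > 0" for x :: ereal
    using that by (cases x; simp add: one_ereal_def numeral_eq_ereal)+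
  have "ereal (real_of_ereal (1 / p) + real_of_ereal (1 / q)) = 1"
    using assms(3) *(3)[OF assms(1)] *(3)[OF assms(2)] by (metis plus_ereal.simps(1))
  then have "real_of_ereal (1 / p) + real_of_ereal (1 / q) = 1" by (simp add: one_ereal_def)
  then show thesis using that *[OF assms(1)] *[OF assms(2)] by blast
qed

theorem theorem1:
  fixes P :: "'a measure"
    and f :: "real^'n^'m \<Rightarrow> real" and gradf :: "real^'n^'m \<Rightarrow> real^'n^'m"
    and G X Mo :: "nat \<Rightarrow> 'a \<Rightarrow> real^'n^'m"
    and Lp :: "nat \<Rightarrow> 'a \<Rightarrow> real^'m^'m" and Rp :: "nat \<Rightarrow> 'a \<Rightarrow> real^'n^'n"
    and X\<^sub>1 :: "real^'n^'m" and \<Sigma>\<^sub>L :: "real^'m^'m" and \<Sigma>\<^sub>R :: "real^'n^'n"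
    and f_star L \<eta> \<theta> \<beta> lam \<epsilon> eps_hat \<gamma> \<tau> sigma2 sigma_hat2 :: real
    and p q :: ereal and K :: nat
  assumes "prob_space P"
    and "K \<ge> 1"
    and "\<And>Y. GDERIV f Y :> gradf Y"
    and "\<And>Y. f_star \<le> f Y" and "f X\<^sub>1 > f_star"
    and "\<eta> > 0" and "0 \<le> \<theta>" and "\<theta> < 1" and "0 \<le> \<beta>" and "\<beta> < 1" and "lam \<ge> 0" and "\<epsilon> > 0"
    and "p > 0" and "q > 0" and "1 / p + 1 / q = 1"
    and algorithm: "\<And>\<omega>. \<omega> \<in> space P \<Longrightarrow>
          adamw_shampoo \<eta> \<theta> \<beta> lam \<epsilon> p q K X\<^sub>1
            (\<lambda>k. G k \<omega>) (\<lambda>k. X k \<omega>) (\<lambda>k. Mo k \<omega>) (\<lambda>k. Lp k \<omega>) (\<lambda>k. Rp k \<omega>)"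
    and smooth: "L > 0" "\<And>Y Z. norm (gradf Z - gradf Y) \<le> L * norm (Z - Y)"
    and unbiased:
      "\<And>k. k \<in> {1..K} \<Longrightarrow> integrable P (G k)"
      "\<And>k. k \<in> {1..K} \<Longrightarrow>
         AE \<omega> in P. matrix_cond_exp P (gen_sigma P G (k - 1)) (G k) \<omega> = gradf (X k \<omega>)"
    and noise:
      "psd \<Sigma>\<^sub>L" "psd \<Sigma>\<^sub>R"
      "\<And>k. k \<in> {1..K} \<Longrightarrow> integrable P
         (\<lambda>\<omega>. (G k \<omega> - gradf (X k \<omega>)) ** transpose (G k \<omega> - gradf (X k \<omega>)))"
      "\<And>k. k \<in> {1..K} \<Longrightarrow> integrable P
         (\<lambda>\<omega>. transpose (G k \<omega> - gradf (X k \<omega>)) ** (G k \<omega> - gradf (X k \<omega>)))"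
      "\<And>k. k \<in> {1..K} \<Longrightarrow> AE \<omega> in P. matrix_cond_exp P (gen_sigma P G (k - 1))
         (\<lambda>\<omega>. (G k \<omega> - gradf (X k \<omega>)) ** transpose (G k \<omega> - gradf (X k \<omega>))) \<omega> \<preceq>\<^sub>L \<Sigma>\<^sub>L"
      "\<And>k. k \<in> {1..K} \<Longrightarrow> AE \<omega> in P. matrix_cond_exp P (gen_sigma P G (k - 1))
         (\<lambda>\<omega>. transpose (G k \<omega> - gradf (X k \<omega>)) ** (G k \<omega> - gradf (X k \<omega>))) \<omega> \<preceq>\<^sub>L \<Sigma>\<^sub>R"
    and sigma2: "sigma2 = (trace \<Sigma>\<^sub>L + trace \<Sigma>\<^sub>R) / 2"
    and "eps_hat \<ge> \<epsilon>"
    and "0 < \<gamma>" and "\<gamma> < 1" and "0 < \<tau>" and "\<tau> \<le> 1"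
    and "sigma_hat2 = max sigma2 (L * (f X\<^sub>1 - f_star) / (real K * \<gamma>\<^sup>2))"
    and "1 - \<theta> = sqrt (L * (f X\<^sub>1 - f_star) / (real K * sigma_hat2))"
    and "\<theta> \<le> \<beta>" and "\<beta> \<le> sqrt \<theta>"
    and "\<epsilon> = \<tau> * sigma_hat2 / (real CARD('m) + real CARD('n))"
    and "\<eta> = sqrt (eps_hat * (f X\<^sub>1 - f_star) / (4 * L * real K * sigma_hat2))"
    and "lam \<le> 1 / (sqrt (1152 * eps_hat) * real K powr (3 / 4)) *
              root 4 (L ^ 3 * sigma_hat2 / (f X\<^sub>1 - f_star))"
    and "spectral_norm X\<^sub>1 \<le> sqrt (eps_hat * real K * (f X\<^sub>1 - f_star) / (L * sigma_hat2))"
  shows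
    "(\<forall>k\<in>{1..K}. integrable P (\<lambda>\<omega>. nuclear_norm (gradf (X k \<omega>)))) \<and>
     ((AE \<omega> in P. \<forall>k\<in>{1..K}. eps_hat *\<^sub>R mat 1 \<preceq>\<^sub>L Lp k \<omega> + \<epsilon> *\<^sub>R mat 1 \<and>
                             eps_hat *\<^sub>R mat 1 \<preceq>\<^sub>L Rp k \<omega> + \<epsilon> *\<^sub>R mat 1) \<longrightarrow>
        (AE \<omega> in P. \<forall>k\<in>{1..K}. lam * spectral_norm (X k \<omega>) < 1) \<and>
        1 / real K * (\<Sum>k=1..K. prob_space.expectation P (\<lambda>\<omega>. nuclear_norm (gradf (X k \<omega>)))) \<le>
          (8 * sqrt (real CARD('m) + real CARD('n)) + 119 * sqrt sigma_hat2 / sqrt eps_hat) *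
          max (root 4 (sigma2 * L * (f X\<^sub>1 - f_star) / real K))
              (sqrt (L * (f X\<^sub>1 - f_star) / (real K * \<gamma>)))) \<and>
     (eps_hat = \<epsilon> \<longrightarrow>
        (\<forall>\<omega>\<in>space P. \<forall>k\<in>{1..K}. eps_hat *\<^sub>R mat 1 \<preceq>\<^sub>L Lp k \<omega> + \<epsilon> *\<^sub>R mat 1 \<and>
                                 eps_hat *\<^sub>R mat 1 \<preceq>\<^sub>L Rp k \<omega> + \<epsilon> *\<^sub>R mat 1) \<and>
        1 / real K * (\<Sum>k=1..K. prob_space.expectation P (\<lambda>\<omega>. nuclear_norm (gradf (X k \<omega>)))) \<le>
          127 * sqrt ((real CARD('m) + real CARD('n)) / \<tau>) *
          max (root 4 (sigma2 * L * (f X\<^sub>1 - f_star) / real K))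
              (sqrt (L * (f X\<^sub>1 - f_star) / (real K * \<gamma>))) \<and>
        (\<tau> = 1 \<longrightarrow>
          1 / real K * (\<Sum>k=1..K. prob_space.expectation P (\<lambda>\<omega>. nuclear_norm (gradf (X k \<omega>)))) \<le>
            127 * sqrt (real CARD('m) + real CARD('n)) *
            max (root 4 (sigma2 * L * (f X\<^sub>1 - f_star) / real K))
                (sqrt (L * (f X\<^sub>1 - f_star) / (real K * \<gamma>)))))"
proof -
  let ?D = "f X\<^sub>1 - f_star"
  define a where "a = 1 - \<theta>"
  define h where "h = sqrt sigma_hat2"
  define \<mu> where "\<mu> = sqrt (real CARD('m) + real CARD('n))"
  define \<kappa> where "\<kappa> = real K"
  note K = \<open>K \<ge> 1\<close> and L = smooth(1) and lip = smooth(2) and deriv = assms(3) and low = assms(4)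
  have \<kappa>: "\<kappa> > 0" using K by (simp add: \<kappa>_def)
  have D: "?D > 0" using \<open>f X\<^sub>1 > f_star\<close> by simp
  have sh: "sigma_hat2 > 0"
  proof -
    have "0 < L * ?D / (real K * \<gamma>\<^sup>2)" using K L D \<open>0 < \<gamma>\<close> by simp
    also have "\<dots> \<le> sigma_hat2" using assms(33) by simp
    finally show ?thesis .
  qed
  have h: "h > 0" "h\<^sup>2 = sigma_hat2" using sh by (auto simp: h_def)
  have e: "eps_hat > 0" using \<open>\<epsilon> > 0\<close> \<open>eps_hat \<ge> \<epsilon>\<close> by simp
  have mu: "\<mu> > 0" "\<mu>\<^sup>2 = real CARD('m) + real CARD('n)" by (simp_all add: \<mu>_def add_pos_pos)
  have a_eq: "a = sqrt (L * ?D / (\<kappa> * h\<^sup>2))" using \<open>1 - \<theta> = _\<close> by (simp add: a_def h(2) \<kappa>_def)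
  have "a > 0" unfolding a_eq using L D \<kappa> sh by (simp add: h(2))
  moreover have "a \<le> 1" using \<open>0 \<le> \<theta>\<close> by (simp add: a_def)
  ultimately have a: "a > 0" "a \<le> 1" .
  have a2: "a\<^sup>2 = L * ?D / (\<kappa> * h\<^sup>2)" using L D \<kappa> sh unfolding a_eq by (simp add: h(2))
  then have D_eq: "?D = \<kappa> * h\<^sup>2 * a\<^sup>2 / L" using \<kappa> sh L unfolding a2 by (simp add: h(2))
  have \<eta>_eq: "\<eta> = sqrt eps_hat * a / (2 * L)"
  proof -
    have "eps_hat * ?D / (4 * L * real K * sigma_hat2) = eps_hat * (a / (2 * L))\<^sup>2"
      using L \<kappa> h by (simp add: D_eq power_divide h(2)[symmetric] \<kappa>_def[symmetric]) (simp add: power2_eq_square)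
    then have "\<eta> = sqrt (eps_hat * (a / (2 * L))\<^sup>2)" using assms(38) by simp
    then show ?thesis using a L by (simp add: real_sqrt_mult)
  qed
  have lam_le: "lam \<le> L / (sqrt (1152 * eps_hat) * \<kappa> * sqrt a)"
  proof -
    have "L ^ 3 * sigma_hat2 / ?D = (L / (\<kappa> powr (1/4) * sqrt a)) ^ 4"
    proof -
      have "(\<kappa> powr (1/4)) ^ 4 = \<kappa>" using \<kappa> by (simp add: powr_power)
      moreover have "(sqrt a) ^ 4 = a\<^sup>2" using a by (simp add: power4_eq_xxxx power2_eq_square mult.assoc)
      ultimately show ?thesis
        using L \<kappa> h a by (simp add: D_eq h(2)[symmetric] power_divide power_mult_distrib)
          (simp add: power2_eq_square power3_eq_cube power4_eq_xxxx)
    qed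
    moreover have "0 \<le> L / (\<kappa> powr (1/4) * sqrt a)" using L a by simp
    ultimately have "root 4 (L ^ 3 * sigma_hat2 / ?D) = L / (\<kappa> powr (1/4) * sqrt a)"
      by (simp add: real_root_power_cancel)
    moreover have "\<kappa> powr (3/4) * \<kappa> powr (1/4) = \<kappa>" using \<kappa> by (simp flip: powr_add)
    ultimately show ?thesis
      using assms(39) by (simp add: \<kappa>_def[symmetric]) (metis (no_types, opaque_lifting) mult.assoc)
  qed
  define b where "b = 2 * sqrt eps_hat * \<kappa> * a / L"
  have lamb: "lam * b \<le> 2 * sqrt a / sqrt 1152"
  proof -
    have "lam * b \<le> L / (sqrt (1152 * eps_hat) * \<kappa> * sqrt a) * b"
      using lam_le e a L \<kappa> by (intro mult_right_mono) (auto simp: b_def)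
    also have "\<dots> = 2 * (sqrt a * sqrt a) / (sqrt 1152 * sqrt a)"
      using e a L \<kappa> by (simp add: b_def real_sqrt_mult)
    also have "\<dots> = 2 * sqrt a / sqrt 1152"
    proof -
      have "sqrt a \<noteq> 0" using a by simp
      from nonzero_mult_divide_mult_cancel_right[OF this, of "2 * sqrt a" "sqrt 1152"] show ?thesis
        by (simp only: mult.assoc)
    qed
    finally show ?thesis .
  qed
  have b0: "b \<ge> 0" using e a L \<kappa> by (simp add: b_def)
  have lamb2: "lam\<^sup>2 * b\<^sup>2 \<le> a / 288"
  proof -
    have "(lam * b)\<^sup>2 \<le> (2 * sqrt a / sqrt 1152)\<^sup>2" using lamb \<open>lam \<ge> 0\<close> b0 by (intro power_mono) auto
    then show ?thesis using a by (simp add: power_mult_distrib power_divide)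
  qed
  have lamb1: "lam * b < 1"
  proof -
    have "2 * sqrt a < sqrt 1152" by (rule power2_less_imp_less) (use a in \<open>auto simp: power_mult_distrib\<close>)
    then have "2 * sqrt a / sqrt 1152 < 1" by simp
    with lamb show ?thesis by linarith
  qed
  have lam\<eta>: "0 \<le> lam * \<eta>" "lam * \<eta> \<le> 1"
  proof -
    have "\<eta> \<le> b"
    proof -
      have "sqrt eps_hat * a / (2 * L) \<le> sqrt eps_hat * a / L * (2 * \<kappa>)"
        using e a L K by (simp add: field_simps \<kappa>_def)
      then show ?thesis by (simp add: \<eta>_eq b_def mult_ac)
    qed
    then have "lam * \<eta> \<le> lam * b" using \<open>lam \<ge> 0\<close> by (intro mult_left_mono) auto
    with lamb1 show "lam * \<eta> \<le> 1" by linarith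
    show "0 \<le> lam * \<eta>" using \<open>lam \<ge> 0\<close> \<open>\<eta> > 0\<close> by simp
  qed
  obtain s t where st: "0 \<le> s" "0 \<le> t" "s + t = 1"
    "real_of_ereal (- 1 / (2 * p)) = - s / 2" "real_of_ereal (- 1 / (2 * q)) = - t / 2"
    using preconditioner_exponents[OF \<open>p > 0\<close> \<open>q > 0\<close> \<open>1 / p + 1 / q = 1\<close>] by blast
  have traj: "shampoo_trajectory \<eta> \<theta> \<beta> lam \<epsilon> s t K (\<lambda>k. G k \<omega>) (\<lambda>k. X k \<omega>) (\<lambda>k. Mo k \<omega>) (\<lambda>k. Lp k \<omega>) (\<lambda>k. Rp k \<omega>)"
    and X1: "X 1 \<omega> = X\<^sub>1" if "\<omega> \<in> space P" for \<omega>
  proof -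
    note alg = algorithm[OF that, unfolded adamw_shampoo_def st(4,5)]
    show "shampoo_trajectory \<eta> \<theta> \<beta> lam \<epsilon> s t K (\<lambda>k. G k \<omega>) (\<lambda>k. X k \<omega>) (\<lambda>k. Mo k \<omega>) (\<lambda>k. Lp k \<omega>) (\<lambda>k. Rp k \<omega>)"
      by (rule shampoo_trajectory.intro)
         (use alg \<open>\<eta> > 0\<close> \<open>0 \<le> \<theta>\<close> \<open>\<theta> < 1\<close> \<open>\<epsilon> > 0\<close> \<open>\<theta> \<le> \<beta>\<close> \<open>\<beta> \<le> sqrt \<theta>\<close> st(1-3) in \<open>blast+\<close>)
    show "X 1 \<omega> = X\<^sub>1" using alg by blast
  qed
  have bounded: "norm (X k \<omega> *v v) \<le> b * norm v" if \<omega>: "\<omega> \<in> space P" and k: "k \<in> {1..K + 1}" for \<omega> k v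
  proof -
    interpret shampoo_trajectory \<eta> \<theta> \<beta> lam \<epsilon> s t K "\<lambda>k. G k \<omega>" "\<lambda>k. X k \<omega>" "\<lambda>k. Mo k \<omega>" "\<lambda>k. Lp k \<omega>" "\<lambda>k. Rp k \<omega>"
      by (rule traj[OF \<omega>])
    have "norm (X 1 \<omega> *v v) \<le> spectral_norm X\<^sub>1 * norm v" for v
      unfolding X1[OF \<omega>] by (rule spectral_norm_bound)
    from iterate_bound[OF this lam\<eta> k] have "norm (X k \<omega> *v v) \<le> (spectral_norm X\<^sub>1 + real (k - 1) * (\<eta> * sqrt 2)) * norm v" .
    also have "\<dots> \<le> b * norm v"
    proof (rule mult_right_mono)
      have "eps_hat * real K * ?D / (L * sigma_hat2) = eps_hat * (\<kappa> * a / L)\<^sup>2"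
        using L h \<kappa> by (simp add: D_eq h(2)[symmetric] \<kappa>_def[symmetric] power_divide power_mult_distrib) (simp add: power2_eq_square)
      then have x1: "spectral_norm X\<^sub>1 \<le> sqrt eps_hat * (\<kappa> * a / L)"
        using assms(40) L \<kappa> a by (simp add: real_sqrt_mult)
      have "real (k - 1) * (\<eta> * sqrt 2) \<le> \<kappa> * (\<eta> * 2)"
        using k \<open>\<eta> > 0\<close> by (intro mult_mono mult_left_mono) (auto simp: \<kappa>_def real_le_lsqrt)
      also have "\<dots> = sqrt eps_hat * (\<kappa> * a / L)" using L by (simp add: \<eta>_eq)
      finally have "real (k - 1) * (\<eta> * sqrt 2) \<le> sqrt eps_hat * (\<kappa> * a / L)" .
      moreover have "b = sqrt eps_hat * (\<kappa> * a / L) + sqrt eps_hat * (\<kappa> * a / L)" by (simp add: b_def)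
      ultimately show "spectral_norm X\<^sub>1 + real (k - 1) * (\<eta> * sqrt 2) \<le> b" using x1 by linarith
    qed simp
    finally show ?thesis .
  qed
  have sub: "subalgebra P (gen_sigma P G (k - 1))" if "k \<in> {1..K}" for k
    by (rule subalgebra_gen_sigma) (use that unbiased(1) borel_measurable_integrable in auto)
  interpret prob_space P by fact
  have noise_int: "integrable P (\<lambda>\<omega>. (norm (G k \<omega> - gradf (X k \<omega>)))\<^sup>2)" if "k \<in> {1..K}" for k
  proof -
    have "integrable P (\<lambda>\<omega>. trace ((G k \<omega> - gradf (X k \<omega>)) ** transpose (G k \<omega> - gradf (X k \<omega>))))"
      unfolding trace_def by (intro Bochner_Integration.integrable_sum integrable_matrix_component noise(3) that)
    then show ?thesis unfolding inner_gram .
  qed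
  have noise_le: "expectation (\<lambda>\<omega>. (norm (G k \<omega> - gradf (X k \<omega>)))\<^sup>2) \<le> h\<^sup>2" if k: "k \<in> {1..K}" for k
  proof -
    have 1: "expectation (\<lambda>\<omega>. (norm (G k \<omega> - gradf (X k \<omega>)))\<^sup>2) \<le> trace \<Sigma>\<^sub>L"
      using expectation_trace_le[OF noise(3)[OF k] sub[OF k] noise(5)[OF k]] unfolding inner_gram .
    have "(norm (G k \<omega> - gradf (X k \<omega>)))\<^sup>2 = trace (transpose (G k \<omega> - gradf (X k \<omega>)) ** (G k \<omega> - gradf (X k \<omega>)))" for \<omega>
      using inner_gram[of "transpose (G k \<omega> - gradf (X k \<omega>))"] by simp
    then have 2: "expectation (\<lambda>\<omega>. (norm (G k \<omega> - gradf (X k \<omega>)))\<^sup>2) \<le> trace \<Sigma>\<^sub>R"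
      using expectation_trace_le[OF noise(4)[OF k] sub[OF k] noise(6)[OF k]] by simp
    have "sigma2 \<le> sigma_hat2" using assms(33) by simp
    with 1 2 sigma2 show ?thesis by (simp add: h(2))
  qed
  interpret stochastic_shampoo P \<eta> \<theta> \<beta> lam \<epsilon> s t L h b K G X Mo Lp Rp X\<^sub>1 f gradf f_star
    by (intro stochastic_shampoo.intro stochastic_shampoo_axioms.intro prob_space_axioms traj X1 K deriv L lip low
        unbiased noise_int noise_le h(1) bounded)
  have eps_mu: "\<mu> * sqrt \<epsilon> = sqrt \<tau> * h"
  proof -
    have "\<epsilon> = \<tau> * h\<^sup>2 / \<mu>\<^sup>2" using assms(37) by (simp add: h(2) mu(2))
    then show ?thesis using mu(1) h(1) by (simp add: real_sqrt_mult real_sqrt_divide)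
  qed
  have \<mu>\<epsilon>: "\<mu> * sqrt \<epsilon> \<le> h" unfolding eps_mu using h \<open>\<tau> \<le> 1\<close> by simp
  define \<rho> where "\<rho> = max (root 4 (sigma2 * L * ?D / real K)) (sqrt (L * ?D / (real K * \<gamma>)))"
  have rho: "h * sqrt a \<le> \<rho>"
  proof (cases "sigma_hat2 = sigma2")
    case True
    have "sigma2 * L * ?D / real K = h\<^sup>2 * (h\<^sup>2 * a\<^sup>2)"
      using L \<kappa> by (simp add: D_eq True[symmetric] h(2) \<kappa>_def[symmetric])
    also have "\<dots> = (h * sqrt a) ^ 4" using a by (simp add: power_mult_distrib power4_eq_xxxx power2_eq_square)
    finally have "root 4 (sigma2 * L * ?D / real K) = h * sqrt a" using h a by (simp add: real_root_power_cancel)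
    then show ?thesis by (simp add: \<rho>_def)
  next
    case False
    then have eq: "h\<^sup>2 = L * ?D / (\<kappa> * \<gamma>\<^sup>2)" using assms(33) by (auto simp: h(2) \<kappa>_def max_def split: if_splits)
    have "a\<^sup>2 = \<gamma>\<^sup>2" unfolding a2 eq using L D \<kappa> \<open>0 < \<gamma>\<close> by simp
    then have "a = \<gamma>" using a \<open>0 < \<gamma>\<close> by (simp add: power2_eq_iff_nonneg)
    then have "L * ?D / (real K * \<gamma>) = h\<^sup>2 * a" using eq a by (simp add: \<kappa>_def power2_eq_square)
    then have "sqrt (L * ?D / (real K * \<gamma>)) = h * sqrt a" using h(1) by (simp add: real_sqrt_mult)
    then show ?thesis by (simp add: \<rho>_def)
  qed
  have rate: "1 / real K * (\<Sum>k=1..K. mean_nuclear k) \<le> (8 * \<mu> + 119 * h / sqrt eps_hat) * \<rho>"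
    if cond: "AE \<omega> in P. \<forall>k\<in>{1..K}. eps_hat *\<^sub>R mat 1 \<preceq>\<^sub>L Lp k \<omega> + \<epsilon> *\<^sub>R mat 1 \<and> eps_hat *\<^sub>R mat 1 \<preceq>\<^sub>L Rp k \<omega> + \<epsilon> *\<^sub>R mat 1"
  proof -
    have "(sqrt a / 10)\<^sup>2 / 2 = a / 200" using a by (simp add: power_divide)
    with lamb2 have "(sqrt a / 10)\<^sup>2 / 2 + lam\<^sup>2 * b\<^sup>2 \<le> a / 200 + a / 288" by linarith
    note descent = summed_descent[OF e cond this \<mu>\<epsilon>[unfolded \<mu>_def], folded \<mu>_def a_def \<kappa>_def]
    have "(\<Sum>k=1..K. mean_nuclear k) \<le> \<kappa> * ((8 * \<mu> + 119 * h / sqrt eps_hat) * (h * sqrt a))"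
      by (rule convergence_rate_arithmetic[OF a h(1) e L \<kappa> _ _ D_eq \<eta>_eq descent error_sum[folded a_def \<kappa>_def]])
         (use mu in \<open>auto intro!: sum_nonneg\<close>)
    also have "\<dots> \<le> \<kappa> * ((8 * \<mu> + 119 * h / sqrt eps_hat) * \<rho>)"
      using rho \<kappa> mu h e by (intro mult_left_mono) auto
    finally show ?thesis using \<kappa> by (simp add: \<kappa>_def[symmetric] field_simps)
  qed
  have spectral: "AE \<omega> in P. \<forall>k\<in>{1..K}. lam * spectral_norm (X k \<omega>) < 1"
  proof (intro AE_I2 ballI)
    fix \<omega> k assume "\<omega> \<in> space P" "k \<in> {1..K}"
    then have "spectral_norm (X k \<omega>) \<le> b" by (intro spectral_norm_le bounded) auto
    then have "lam * spectral_norm (X k \<omega>) \<le> lam * b" using \<open>lam \<ge> 0\<close> by (intro mult_left_mono) auto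
    with lamb1 show "lam * spectral_norm (X k \<omega>) < 1" by linarith
  qed
  have always: "\<forall>\<omega>\<in>space P. \<forall>k\<in>{1..K}. \<epsilon> *\<^sub>R mat 1 \<preceq>\<^sub>L Lp k \<omega> + \<epsilon> *\<^sub>R mat 1 \<and> \<epsilon> *\<^sub>R mat 1 \<preceq>\<^sub>L Rp k \<omega> + \<epsilon> *\<^sub>R mat 1"
    using shampoo_trajectory.preconditioner_loewner[OF traj] by auto
  have rate_eps: "1 / real K * (\<Sum>k=1..K. mean_nuclear k) \<le> 127 * sqrt ((real CARD('m) + real CARD('n)) / \<tau>) * \<rho>"
    if "eps_hat = \<epsilon>"
  proof -
    have "0 \<le> \<rho>" using rho h a by (meson less_imp_le mult_pos_pos order_trans real_sqrt_gt_zero)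
    have st1: "0 < sqrt \<tau>" "sqrt \<tau> \<le> 1" using \<open>0 < \<tau>\<close> \<open>\<tau> \<le> 1\<close> by auto
    have "h / sqrt eps_hat = \<mu> / sqrt \<tau>"
      using eps_mu st1 \<open>\<epsilon> > 0\<close> by (simp add: that field_simps)
    moreover have "\<mu> \<le> \<mu> / sqrt \<tau>" using st1 mu by (simp add: field_simps)
    ultimately have "8 * \<mu> + 119 * h / sqrt eps_hat \<le> 127 * (\<mu> / sqrt \<tau>)" by simp
    also have "\<dots> = 127 * sqrt ((real CARD('m) + real CARD('n)) / \<tau>)" by (simp add: \<mu>_def real_sqrt_divide)
    finally have "(8 * \<mu> + 119 * h / sqrt eps_hat) * \<rho> \<le> 127 * sqrt ((real CARD('m) + real CARD('n)) / \<tau>) * \<rho>"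
      using \<open>0 \<le> \<rho>\<close> by (rule mult_right_mono)
    with rate show ?thesis using always that by (intro order_trans[OF rate]) auto
  qed
  show ?thesis
  proof (intro conjI impI)
    show "\<forall>k\<in>{1..K}. integrable P (\<lambda>\<omega>. nuclear_norm (gradf (X k \<omega>)))"
      using nuclear_integrable by auto
    show "\<forall>\<omega>\<in>space P. \<forall>k\<in>{1..K}. eps_hat *\<^sub>R mat 1 \<preceq>\<^sub>L Lp k \<omega> + \<epsilon> *\<^sub>R mat 1 \<and> eps_hat *\<^sub>R mat 1 \<preceq>\<^sub>L Rp k \<omega> + \<epsilon> *\<^sub>R mat 1"
      if "eps_hat = \<epsilon>" using always that by simp
  qed (use rate rate_eps spectral in \<open>simp_all add: \<rho>_def[symmetric] \<mu>_def h_def\<close>)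
qed

end
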